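(* Let $P=(P,\leq,\textrm{Con},\equiv)$ be an event structure with disjunctive causes (edc). Then $P\cong\mathit{edc}(G)$ for some general event structure $G$ if and only if $P$ satisfies: (A) for every finite down-closed $X\subseteq P$ and $y\in\mathcal{C}(P)$, if $X\equiv y$ then $X\in\mathcal{C}(P)$; (B) for $p,q\in P$, if $[p)=[q)$ and $p\equiv q$ then $p=q$; (C) for $X$ a down-closed subset of $P$ and $p\equiv q$, if $X\subseteq[p)$ and $[q)_\equiv\subseteq X_\equiv$ then $X=[p)$; (D$_1$) for $x$ an unambiguous configuration in $\mathcal{C}(P)$ and $t\in P$, if $x\cup[t]\in\mathcal{C}(P)$ and $(x\cup[t])_\equiv=x_\equiv\cup\{\{t\}_\equiv\}$, then there is $p\in P$ with $p\equiv t$ and $x\cup\{p\}\in\mathcal{C}(P)$.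
   Context: A prime event structure $(P,\leq,\textrm{Con})$: a set with a partial order and a non-empty set $\textrm{Con}$ of finite subsets such that $[p]=\{p'\mid p'\leq p\}$ is finite, $\{p\}\in\textrm{Con}$, $\textrm{Con}$ is closed under subsets, and $X\in\textrm{Con}$, $p\leq p'\in X$ imply $X\cup\{p\}\in\textrm{Con}$. Configurations: down-closed subsets all of whose finite subsets are in $\textrm{Con}$; $\mathcal{C}(P)$ denotes the finite configurations. $[p)=[p]\setminus\{p\}$. An event structure with equivalence (ese) is a prime event structure with an equivalence $\equiv$ on $P$; it is an edc if $p_1,p_2\leq p$ and $p_1\equiv p_2$ imply $p_1=p_2$. A configuration $x$ is unambiguous if $p_1,p_2\in x$, $p_1\equiv p_2$ imply $p_1=p_2$. For $X,Y\subseteq P$, $X_\equiv=\{\{p\}_\equiv\mid p\in X\}$ and $X\equiv Y$ means $X_\equiv=Y_\equiv$. Maps of ese's: partial functions preserving $\equiv$ (equivalent arguments are both undefined or both defined with equivalent values) such that images of configurations are configurations and, within a configuration, equivalent images force equivalent arguments; isomorphisms are bijective maps with inverse a map. A general event structure $(E,\textrm{Con},\vdash)$: $\textrm{Con}$ a non-empty subset-closed set of finite subsets of $E$, $\vdash\subseteq\textrm{Con}\times E$ with $Y\in\textrm{Con}$, $Y\supseteq X\vdash e\Rightarrow Y\vdash e$; its configurations are the $x\subseteq E$ with finite subsets in $\textrm{Con}$ such that each $e\in x$ has $e_1,\dots,e_n=e$ in $x$ with $\{e_1,\dots,e_{i-1}\}\vdash e_i$ for all $i$. For a family of configurations $\mathcal{A}$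 with $A=\bigcup\mathcal{A}$: a realisation is a partial order $(R,\leq)$ with finite down-sets and $\rho:R\to A$ with $\rho x\in\mathcal{A}$ for all down-closed $x$; maps of realisations $\rho\to\rho'$ are partial surjective functions between carriers sending down-closed sets to down-closed sets and commuting with the $\rho$'s where defined; $\rho'\preceq\rho$ if such a map exists; isomorphisms are bijective total maps with inverse a map; $\rho$ is extremal if every total map out of it is an isomorphism, prime extremal if its carrier also has a top, whose image is $\max(\rho)$. For a general event structure $G$, let $\mathcal{A}$ be its set of configurations and form the ese $(P',\textrm{Con}',\leq',\equiv')$: $P'$ a choice of one representative of each isomorphism class of prime extremal realisations of $\mathcal{A}$; $\leq'$ is $\preceq$; $X\in\textrm{Con}'$ iff $X$ is finite and $\max[X]\in\mathcal{A}$ ($[X]$ the $\leq'$-down-closure); $p_1\equiv'p_2$ iff $\max(p_1)=\max(p_2)$. Then $\mathit{edc}(G)$ is its restriction to those events $p$ such that for all $p_1,p_2\leq'p$, $p_1\equiv'p_2$ implies $p_1=p_2$, with order, consistency and equivalence restricted. *)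

theory Defs
  imports Main
begin

definition down_closed :: "'a set \<Rightarrow> 'a rel \<Rightarrow> 'a set \<Rightarrow> bool" where
  "down_closed A r X \<longleftrightarrow> X \<subseteq> A \<and> (\<forall>x\<in>X. \<forall>y\<in>A. (y, x) \<in> r \<longrightarrow> y \<in> X)"

section \<open>Prime event structures, with equivalence, with disjunctive causes\<close>

record 'p pes =
  events :: "'p set"
  leq :: "'p rel"
  con :: "'p set set"

record 'p ese = "'p pes" +
  eqv :: "'p rel"

definition down :: "('p, 'm) pes_scheme \<Rightarrow> 'p \<Rightarrow> 'p set" where
  "down P p = {p' \<in> events P. (p', p) \<in> leq P}"

definition sdown :: "('p, 'm) pes_scheme \<Rightarrow> 'p \<Rightarrow> 'p set" where
  "sdown P p = down P p - {p}"

definition prime_es :: "('p, 'm) pes_scheme \<Rightarrow> bool" where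
  "prime_es P \<longleftrightarrow>
     partial_order_on (events P) (leq P) \<and>
     con P \<noteq> {} \<and>
     (\<forall>X\<in>con P. finite X \<and> X \<subseteq> events P) \<and>
     (\<forall>p\<in>events P. finite (down P p)) \<and>
     (\<forall>p\<in>events P. {p} \<in> con P) \<and>
     (\<forall>X\<in>con P. \<forall>Y. Y \<subseteq> X \<longrightarrow> Y \<in> con P) \<and>
     (\<forall>X\<in>con P. \<forall>p'\<in>X. \<forall>p\<in>events P. (p, p') \<in> leq P \<longrightarrow> X \<union> {p} \<in> con P)"

abbreviation dclosed :: "('p, 'm) pes_scheme \<Rightarrow> 'p set \<Rightarrow> bool" where
  "dclosed P X \<equiv> down_closed (events P) (leq P) X"

definition configurations :: "('p, 'm) pes_scheme \<Rightarrow> 'p set set" where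
  "configurations P =
     {x. dclosed P x \<and> (\<forall>Y. finite Y \<and> Y \<subseteq> x \<longrightarrow> Y \<in> con P)}"

definition fin_configurations :: "('p, 'm) pes_scheme \<Rightarrow> 'p set set" where
  "fin_configurations P = {x \<in> configurations P. finite x}"

definition ese :: "'p ese \<Rightarrow> bool" where
  "ese P \<longleftrightarrow> prime_es P \<and> equiv (events P) (eqv P)"

definition edc :: "'p ese \<Rightarrow> bool" where
  "edc P \<longleftrightarrow> ese P \<and>
     (\<forall>p\<in>events P. \<forall>p1\<in>down P p. \<forall>p2\<in>down P p. (p1, p2) \<in> eqv P \<longrightarrow> p1 = p2)"

definition unambiguous :: "'p ese \<Rightarrow> 'p set \<Rightarrow> bool" where
  "unambiguous P x \<longleftrightarrow> (\<forall>p1\<in>x. \<forall>p2\<in>x. (p1, p2) \<in> eqv P \<longrightarrow> p1 = p2)"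

definition classes :: "'p ese \<Rightarrow> 'p set \<Rightarrow> 'p set set" where
  "classes P X = X // eqv P"

text \<open>The direct image of a set \<open>x\<close> under a partial function \<open>f\<close> is \<open>ran (f |` x)\<close>.\<close>

definition ese_map :: "'p ese \<Rightarrow> 'q ese \<Rightarrow> ('p \<rightharpoonup> 'q) \<Rightarrow> bool" where
  "ese_map P Q f \<longleftrightarrow>
     dom f \<subseteq> events P \<and> ran f \<subseteq> events Q \<and>
     (\<forall>p1\<in>events P. \<forall>p2\<in>events P. (p1, p2) \<in> eqv P \<longrightarrow>
        f p1 = None \<and> f p2 = None \<or>
        (\<exists>q1 q2. f p1 = Some q1 \<and> f p2 = Some q2 \<and> (q1, q2) \<in> eqv Q)) \<and>
     (\<forall>x\<in>configurations P.
        ran (f |` x) \<in> configurations Q \<and>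
        (\<forall>p1\<in>x. \<forall>p2\<in>x. \<forall>q1 q2. f p1 = Some q1 \<and> f p2 = Some q2 \<and> (q1, q2) \<in> eqv Q
           \<longrightarrow> (p1, p2) \<in> eqv P))"

definition ese_iso :: "'p ese \<Rightarrow> 'q ese \<Rightarrow> bool" where
  "ese_iso P Q \<longleftrightarrow>
     (\<exists>f. bij_betw f (events P) (events Q) \<and>
        ese_map P Q ((\<lambda>p. Some (f p)) |` events P) \<and>
        ese_map Q P ((\<lambda>q. Some (inv_into (events P) f q)) |` events Q))"

section \<open>General event structures\<close>

record 'e ges =
  gevents :: "'e set"
  gcon :: "'e set set"
  enables :: "('e set \<times> 'e) set"

definition general_es :: "'e ges \<Rightarrow> bool" where
  "general_es G \<longleftrightarrow>
     gcon G \<noteq> {} \<and>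
     (\<forall>X\<in>gcon G. finite X \<and> X \<subseteq> gevents G) \<and>
     (\<forall>X\<in>gcon G. \<forall>Y. Y \<subseteq> X \<longrightarrow> Y \<in> gcon G) \<and>
     enables G \<subseteq> gcon G \<times> gevents G \<and>
     (\<forall>X Y e. (X, e) \<in> enables G \<and> X \<subseteq> Y \<and> Y \<in> gcon G \<longrightarrow> (Y, e) \<in> enables G)"

definition gconfigurations :: "'e ges \<Rightarrow> 'e set set" where
  "gconfigurations G =
     {x. x \<subseteq> gevents G \<and>
         (\<forall>Y. finite Y \<and> Y \<subseteq> x \<longrightarrow> Y \<in> gcon G) \<and>
         (\<forall>e\<in>x. \<exists>es. es \<noteq> [] \<and> set es \<subseteq> x \<and> last es = e \<and>
            (\<forall>i<length es. (set (take i es), es ! i) \<in> enables G))}"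

section \<open>Realisations\<close>

record ('r, 'e) realisation =
  carr :: "'r set"
  ord :: "'r rel"
  rho :: "'r \<Rightarrow> 'e"

definition realisation :: "'e set set \<Rightarrow> ('r, 'e) realisation \<Rightarrow> bool" where
  "realisation \<A> R \<longleftrightarrow>
     partial_order_on (carr R) (ord R) \<and>
     (\<forall>r\<in>carr R. finite {r' \<in> carr R. (r', r) \<in> ord R}) \<and>
     rho R ` carr R \<subseteq> \<Union>\<A> \<and>
     (\<forall>x. down_closed (carr R) (ord R) x \<longrightarrow> rho R ` x \<in> \<A>)"

definition real_map ::
    "('r, 'e) realisation \<Rightarrow> ('s, 'e) realisation \<Rightarrow> ('r \<rightharpoonup> 's) \<Rightarrow> bool" where
  "real_map R S f \<longleftrightarrow>
     dom f \<subseteq> carr R \<and> ran f = carr S \<and>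
     (\<forall>x. down_closed (carr R) (ord R) x \<longrightarrow> down_closed (carr S) (ord S) (ran (f |` x))) \<and>
     (\<forall>r s. f r = Some s \<longrightarrow> rho R r = rho S s)"

definition total_real_map ::
    "('r, 'e) realisation \<Rightarrow> ('s, 'e) realisation \<Rightarrow> ('r \<rightharpoonup> 's) \<Rightarrow> bool" where
  "total_real_map R S f \<longleftrightarrow> real_map R S f \<and> dom f = carr R"

definition real_iso_map ::
    "('r, 'e) realisation \<Rightarrow> ('s, 'e) realisation \<Rightarrow> ('r \<rightharpoonup> 's) \<Rightarrow> bool" where
  "real_iso_map R S f \<longleftrightarrow>
     total_real_map R S f \<and> bij_betw (\<lambda>r. the (f r)) (carr R) (carr S) \<and>
     real_map S R ((\<lambda>s. Some (inv_into (carr R) (\<lambda>r. the (f r)) s)) |` carr S)"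

definition real_iso :: "('r, 'e) realisation \<Rightarrow> ('s, 'e) realisation \<Rightarrow> bool" where
  "real_iso R S \<longleftrightarrow> (\<exists>f. real_iso_map R S f)"

definition real_le :: "('s, 'e) realisation \<Rightarrow> ('r, 'e) realisation \<Rightarrow> bool" where
  "real_le S R \<longleftrightarrow> (\<exists>f. real_map R S f)"

text \<open>Maps of realisations are surjective, so the codomain of a map out of \<open>R\<close> always has
  an isomorphic copy whose carrier is a subset of the carrier of \<open>R\<close>. Hence letting \<open>S\<close>
  range over the same carrier type as \<open>R\<close> loses no generality.\<close>

definition extremal :: "'e set set \<Rightarrow> ('r, 'e) realisation \<Rightarrow> bool" where
  "extremal \<A> R \<longleftrightarrow> realisation \<A> R \<and>
     (\<forall>(S :: ('r, 'e) realisation) f.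
        realisation \<A> S \<and> total_real_map R S f \<longrightarrow> real_iso_map R S f)"

definition is_top :: "('r, 'e) realisation \<Rightarrow> 'r \<Rightarrow> bool" where
  "is_top R t \<longleftrightarrow> t \<in> carr R \<and> (\<forall>r\<in>carr R. (r, t) \<in> ord R)"

definition prime_extremal :: "'e set set \<Rightarrow> ('r, 'e) realisation \<Rightarrow> bool" where
  "prime_extremal \<A> R \<longleftrightarrow> extremal \<A> R \<and> (\<exists>t. is_top R t)"

definition rmax :: "('r, 'e) realisation \<Rightarrow> 'e" where
  "rmax R = rho R (THE t. is_top R t)"

section \<open>From general event structures to edc's\<close>

text \<open>The carrier of a prime extremal realisation is the down-set of its top, hence finite.
  So every isomorphism class is represented by a realisation with carrier a set of
  natural numbers.\<close>

definition prime_extremal_reps :: "'e set set \<Rightarrow> (nat, 'e) realisation set" where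
  "prime_extremal_reps \<A> =
     (\<lambda>C. SOME R. R \<in> C) `
       ({R. prime_extremal \<A> R} //
        {(R, S). prime_extremal \<A> R \<and> prime_extremal \<A> S \<and> real_iso R S})"

definition ese_of :: "'e ges \<Rightarrow> (nat, 'e) realisation ese" where
  "ese_of G =
     (let \<A> = gconfigurations G; P' = prime_extremal_reps \<A> in
      \<lparr> events = P',
        leq = {(p, q). p \<in> P' \<and> q \<in> P' \<and> real_le p q},
        con = {X. X \<subseteq> P' \<and> finite X \<and>
                  rmax ` {p \<in> P'. \<exists>q\<in>X. real_le p q} \<in> \<A>},
        eqv = {(p, q). p \<in> P' \<and> q \<in> P' \<and> rmax p = rmax q} \<rparr>)"

definition ese_restrict :: "'p ese \<Rightarrow> 'p set \<Rightarrow> 'p ese" where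
  "ese_restrict P Q =
     \<lparr> events = events P \<inter> Q,
       leq = leq P \<inter> (Q \<times> Q),
       con = {X \<in> con P. X \<subseteq> Q},
       eqv = eqv P \<inter> (Q \<times> Q) \<rparr>"

definition edc_of :: "'e ges \<Rightarrow> (nat, 'e) realisation ese" where
  "edc_of G =
     (let P' = ese_of G in
      ese_restrict P'
        {p \<in> events P'. \<forall>p1\<in>down P' p. \<forall>p2\<in>down P' p. (p1, p2) \<in> eqv P' \<longrightarrow> p1 = p2})"

end

theory Submission
  imports Defs
begin

text \<open>
  A realisation of the configurations of a general event structure is extremal iff
  (i) elements with the same label and the same strict causes are equal and
  (ii) the strict causes of no element can be replaced by a smaller down-closed set:
  otherwise one obtains a proper quotient, respectively a proper weakening of the order.
  Consequently maps out of an extremal realisation are projections onto down-closed subsets,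
  the events of \<open>edc_of G\<close> correspond to finite partial orders on labels with a top
  satisfying (ii), and their order is restriction to principal down-sets.

  In this picture (A) says that consistency only depends on labels, (B) and (C) are (i) and (ii),
  and (D1) follows by adding the new label on top of a minimal down-closed subset of the
  unambiguous configuration that enables it. Conversely, given (A)-(D1), let the equivalence classes
  of \<open>P\<close> be the events of \<open>G\<close>, consistent if they occur together in a configuration of \<open>P\<close>,
  with \<open>X\<close> enabling the class of \<open>p\<close> whenever \<open>X\<close> contains the classes of the strict causes
  of \<open>p\<close>. By (A) the finite configurations of \<open>G\<close> are exactly the images of those of \<open>P\<close>.
  Sending \<open>p\<close> to the order induced on the classes of its causes is then an isomorphism:
  (C) makes the result extremal, (B) gives injectivity, and (D1) with (A) surjectivity, by induction.
\<close>

section \<open>Extremal realisations\<close>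

text \<open>Closure under unions of subfamilies bounded by a common member is the property of
  configurations behind the analysis of extremality: it keeps an order with fewer causes a
  realisation. Maps of realisations send down-closed sets to down-closed sets but need not be
  monotone (weakening the order gives a map), so monotonicity has to be derived from (ii) by
  induction along the causes. Two choices in the definitions are removed before the axioms are
  discussed. Representatives over \<open>nat\<close> give way to the canonical relations in
  \<open>primes\<close>; isomorphisms, defined through configurations, become bijections preserving
  order, consistency and equivalence. In the converse direction, events realising given classes are
  picked independently of each other, and (A) is what makes such a collection consistent. Finite
  configurations of \<open>G\<close> suffice throughout, since prime realisations and consistent
  sets are finite.\<close>

definition bounded_complete :: "'e set set \<Rightarrow> bool" where
  "bounded_complete \<A> \<longleftrightarrow> (\<forall>S c. S \<subseteq> \<A> \<and> c \<in> \<A> \<and> \<Union>S \<subseteq> c \<longrightarrow> \<Union>S \<in> \<A>)"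

lemma bounded_complete_Un:
  assumes "bounded_complete \<A>" "a \<in> \<A>" "b \<in> \<A>" "c \<in> \<A>" "a \<union> b \<subseteq> c"
  shows "a \<union> b \<in> \<A>"
proof -
  have "\<Union>{a, b} \<in> \<A>"
    using assms unfolding bounded_complete_def by (metis Union_insert Union_empty Un_empty_right empty_subsetI insert_subset)
  then show ?thesis by simp
qed

definition rdown :: "('r, 'e) realisation \<Rightarrow> 'r \<Rightarrow> 'r set" where
  "rdown R r = {r' \<in> carr R. (r', r) \<in> ord R}"

abbreviation rclosed :: "('r, 'e) realisation \<Rightarrow> 'r set \<Rightarrow> bool" where
  "rclosed R \<equiv> down_closed (carr R) (ord R)"

text \<open>For a bounded complete family, tightness is the same as extremality; unlike extremality
  it does not quantify over realisations of a fixed carrier type.\<close>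

definition tight :: "'e set set \<Rightarrow> ('r, 'e) realisation \<Rightarrow> bool" where
  "tight \<A> R \<longleftrightarrow> realisation \<A> R \<and>
     (\<forall>r\<in>carr R. \<forall>r'\<in>carr R.
        rdown R r - {r} = rdown R r' - {r'} \<and> rho R r = rho R r' \<longrightarrow> r = r') \<and>
     (\<forall>r\<in>carr R. \<forall>x.
        rclosed R x \<and> x \<subseteq> rdown R r - {r} \<and> insert (rho R r) (rho R ` x) \<in> \<A> \<longrightarrow>
        x = rdown R r - {r})"

lemma realisation_order:
  assumes "realisation \<A> R"
  shows "ord R \<subseteq> carr R \<times> carr R"
    and "r \<in> carr R \<Longrightarrow> (r, r) \<in> ord R"
    and "(a, b) \<in> ord R \<Longrightarrow> (b, c) \<in> ord R \<Longrightarrow> (a, c) \<in> ord R"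
    and "(a, b) \<in> ord R \<Longrightarrow> (b, a) \<in> ord R \<Longrightarrow> a = b"
  using assms unfolding realisation_def partial_order_on_def preorder_on_def
  by (auto dest: refl_onD transD antisymD)

lemma partial_orderI:
  assumes "r \<subseteq> A \<times> A" "\<And>a. a \<in> A \<Longrightarrow> (a, a) \<in> r"
    and "\<And>a b c. (a, b) \<in> r \<Longrightarrow> (b, c) \<in> r \<Longrightarrow> (a, c) \<in> r"
    and "\<And>a b. (a, b) \<in> r \<Longrightarrow> (b, a) \<in> r \<Longrightarrow> a = b"
  shows "partial_order_on A r"
  unfolding partial_order_on_def preorder_on_def
  using assms by (auto intro!: refl_onI transI antisymI)

lemma finite_rdown: "realisation \<A> R \<Longrightarrow> r \<in> carr R \<Longrightarrow> finite (rdown R r)"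
  by (simp add: realisation_def rdown_def)

lemma rclosed_image_in: "realisation \<A> R \<Longrightarrow> rclosed R x \<Longrightarrow> rho R ` x \<in> \<A>"
  by (simp add: realisation_def)

lemma rclosed_rdown: "realisation \<A> R \<Longrightarrow> rclosed R (rdown R r)"
  unfolding down_closed_def rdown_def by (blast intro: realisation_order(3))

lemma rclosed_sdown: "realisation \<A> R \<Longrightarrow> rclosed R (rdown R r - {r})"
  unfolding down_closed_def rdown_def by (blast intro: realisation_order(3,4))

lemma rclosed_carr: "rclosed R (carr R)"
  by (auto simp: down_closed_def)

lemma rdown_mono: "realisation \<A> R \<Longrightarrow> u \<in> rdown R r \<Longrightarrow> rdown R u \<subseteq> rdown R r"
  unfolding rdown_def by (blast intro: realisation_order(3))

lemma rdown_psubset: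
  assumes R: "realisation \<A> R" and u: "u \<in> rdown R r - {r}"
  shows "rdown R u \<subset> rdown R r"
proof -
  have "(r, u) \<notin> ord R" "r \<in> rdown R r"
    using u realisation_order(1,2,4)[OF R] unfolding rdown_def by blast+
  then show ?thesis using rdown_mono[OF R, of u r] u by (auto simp: rdown_def)
qed

text \<open>Principal down-sets are finite, so the size of \<open>rdown R r\<close> is a measure
  that drops at every strict cause, and the order is well founded.\<close>

lemma rdown_induct [consumes 2, case_names less]:
  assumes R: "realisation \<A> R" and "r \<in> carr R"
    and step: "\<And>r. r \<in> carr R \<Longrightarrow> (\<And>u. u \<in> rdown R r - {r} \<Longrightarrow> Q u) \<Longrightarrow> Q r"
  shows "Q r"
  using \<open>r \<in> carr R\<close>
proof (induction "card (rdown R r)" arbitrary: r rule: less_induct)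
  case less
  show ?case
  proof (rule step[OF less.prems])
    fix u assume u: "u \<in> rdown R r - {r}"
    then have "u \<in> carr R" by (simp add: rdown_def)
    moreover have "card (rdown R u) < card (rdown R r)"
      by (intro psubset_card_mono finite_rdown[OF R less.prems] rdown_psubset[OF R u])
    ultimately show "Q u" using less.hyps by blast
  qed
qed

lemma ran_restrict_Some: "ran ((\<lambda>a. Some (f a)) |` A |` B) = f ` (A \<inter> B)"
  by (auto simp: ran_def restrict_map_def)

lemma ran_restrict_Some': "ran ((\<lambda>a. Some (f a)) |` A) = f ` A"
  by (auto simp: ran_def restrict_map_def)

lemma dom_restrict_Some: "dom ((\<lambda>a. Some (f a)) |` A) = A"
  by (auto simp: dom_def restrict_map_def)

lemma restrict_Some_iff: "((\<lambda>a. Some (f a)) |` A) a = Some b \<longleftrightarrow> a \<in> A \<and> b = f a"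
  by (auto simp: restrict_map_def)

lemma total_real_map_Some:
  assumes "f ` carr R = carr S"
    and "\<And>x. rclosed R x \<Longrightarrow> rclosed S (f ` x)"
    and "\<And>r. r \<in> carr R \<Longrightarrow> rho S (f r) = rho R r"
  shows "total_real_map R S ((\<lambda>r. Some (f r)) |` carr R)"
proof -
  have "carr R \<inter> x = x" if "rclosed R x" for x
    using that by (auto simp: down_closed_def)
  then show ?thesis
    using assms unfolding total_real_map_def real_map_def
    by (auto simp: ran_restrict_Some ran_restrict_Some' dom_restrict_Some restrict_Some_iff)
qed

lemma extremal_imp_eq:
  fixes R :: "('r, 'e) realisation"
  assumes ex: "extremal \<A> R" and r: "r \<in> carr R" "r' \<in> carr R"
    and eq: "rdown R r - {r} = rdown R r' - {r'}" and lab: "rho R r = rho R r'"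
  shows "r = r'"
proof (rule ccontr)
  assume ne: "r \<noteq> r'"
  from ex have R: "realisation \<A> R" by (simp add: extremal_def)
  note o = realisation_order[OF R]
  have below: "(u, r) \<in> ord R \<and> u \<noteq> r \<longleftrightarrow> (u, r') \<in> ord R \<and> u \<noteq> r'" for u
    using eq o(1) by (auto simp: rdown_def set_eq_iff)
  \<comment> \<open>Identifying \<open>r'\<close> with \<open>r\<close> yields a proper quotient of \<open>R\<close>.\<close>
  define f where "f u = (if u = r' then r else u)" for u
  define S where "S = \<lparr>carr = carr R - {r'},
     ord = {(s, t). s \<noteq> r' \<and> t \<noteq> r' \<and> ((s, t) \<in> ord R \<or> s = r \<and> (r', t) \<in> ord R)},
     rho = rho R\<rparr>"
  have S: "carr S = carr R - {r'}" "rho S = rho R"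
    "\<And>s t. (s, t) \<in> ord S \<longleftrightarrow>
      s \<noteq> r' \<and> t \<noteq> r' \<and> ((s, t) \<in> ord R \<or> s = r \<and> (r', t) \<in> ord R)"
    by (auto simp: S_def)
  \<comment> \<open>A strict cause of either one is a strict cause of the other, so comparability
    would make an element a strict cause of itself.\<close>
  have nr: "(r, r') \<notin> ord R" "(r', r) \<notin> ord R"
    using below[of r] below[of r'] o(2)[OF r(1)] o(2)[OF r(2)] ne by auto
  have mono: "(f u, f t) \<in> ord S" if "(u, t) \<in> ord R" for u t
    using that below[of u] o(1) o(2)[OF r(1)] ne unfolding S(3) f_def by auto
  have refl: "f ` carr R = carr S" using r ne by (auto simp: f_def S)
  have po: "partial_order_on (carr S) (ord S)"
  proof (rule partial_orderI)
    show "ord S \<subseteq> carr S \<times> carr S" using o(1) r by (auto simp: S)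
    show "(a, a) \<in> ord S" if "a \<in> carr S" for a using that o(2) by (auto simp: S)
    show "(a, c) \<in> ord S" if "(a, b) \<in> ord S" "(b, c) \<in> ord S" for a b c
      using that o(3) below nr unfolding S(3) by metis
    show "a = b" if "(a, b) \<in> ord S" "(b, a) \<in> ord S" for a b
      using that o(3,4) below nr unfolding S(3) by metis
  qed
  \<comment> \<open>Down-closed sets of the quotient pull back along \<open>f\<close> to down-closed
    sets of \<open>R\<close> carrying the same labels, so the membership in \<open>\<A>\<close>
    demanded of a realisation is inherited.\<close>
  have pre: "rclosed R {u \<in> carr R. f u \<in> z}" if "rclosed S z" for z
    using that mono refl unfolding down_closed_def by blast
  have preim: "f ` {u \<in> carr R. f u \<in> z} = z" if "rclosed S z" for z
    using that refl unfolding down_closed_def by auto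
  have rhof: "rho R (f u) = rho R u" for u using lab by (simp add: f_def)
  have rS: "realisation \<A> S"
    unfolding realisation_def
  proof (intro conjI ballI allI impI po)
    fix t assume t: "t \<in> carr S"
    have "{s \<in> carr S. (s, t) \<in> ord S} \<subseteq> insert r (rdown R t)"
      by (auto simp: S rdown_def)
    then show "finite {s \<in> carr S. (s, t) \<in> ord S}"
      using finite_rdown[OF R, of t] t by (auto simp: S intro: finite_subset)
  next
    fix z assume z: "rclosed S z"
    have "rho R ` {u \<in> carr R. f u \<in> z} = rho R ` f ` {u \<in> carr R. f u \<in> z}"
      by (simp add: image_image rhof)
    then show "rho S ` z \<in> \<A>"
      using rclosed_image_in[OF R pre[OF z]] preim[OF z] by (simp add: S)
  next
    show "rho S ` carr S \<subseteq> \<Union>\<A>"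
      using R by (auto simp: S realisation_def)
  qed
  have "total_real_map R S ((\<lambda>r. Some (f r)) |` carr R)"
  proof (rule total_real_map_Some[OF refl])
    show "rclosed S (f ` x)" if x: "rclosed R x" for x
      unfolding down_closed_def
    proof (intro conjI ballI impI)
      show "f ` x \<subseteq> carr S" using x refl by (auto simp: down_closed_def)
      fix t s assume t: "t \<in> f ` x" and s: "s \<in> carr S" "(s, t) \<in> ord S"
      from t obtain u where u: "u \<in> x" "t = f u" by blast
      have xd: "v \<in> x" if "(v, w) \<in> ord R" "w \<in> x" for v w
        using x that o(1) by (auto simp: down_closed_def)
      show "s \<in> f ` x"
      proof (cases "s = r \<and> r' \<in> x")
        case True then show ?thesis by (auto simp: f_def)
      next
        case False
        have "s \<in> x \<or> s = t"
          using False s(2) u xd below nr unfolding S(3) f_def by metis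
        moreover have "f s = s" using s by (auto simp: f_def S)
        ultimately show ?thesis using t by (metis imageI)
      qed
    qed
    show "rho S (f u) = rho R u" if "u \<in> carr R" for u using rhof by (simp add: S)
  qed
  then have "real_iso_map R S ((\<lambda>r. Some (f r)) |` carr R)"
    using ex rS by (auto simp: extremal_def)
  then have "inj_on (\<lambda>u. the (((\<lambda>r. Some (f r)) |` carr R) u)) (carr R)"
    by (auto simp: real_iso_map_def bij_betw_def)
  then show False using r ne by (auto simp: inj_on_def f_def restrict_map_def)
qed

lemma extremal_imp_minimal:
  fixes R :: "('r, 'e) realisation"
  assumes bc: "bounded_complete \<A>" and ex: "extremal \<A> R" and r: "r \<in> carr R"
    and x: "rclosed R x" "x \<subseteq> rdown R r - {r}" and xA: "insert (rho R r) (rho R ` x) \<in> \<A>"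
  shows "x = rdown R r - {r}"
proof (rule ccontr)
  assume "x \<noteq> rdown R r - {r}"
  then obtain w where w: "w \<in> rdown R r" "w \<noteq> r" "w \<notin> x" using x by auto
  from ex have R: "realisation \<A> R" by (simp add: extremal_def)
  note o = realisation_order[OF R]
  \<comment> \<open>Reducing the causes of \<open>r\<close> to \<open>x\<close> yields a realisation with strictly smaller order.\<close>
  define S where "S = R\<lparr>ord := {(s, t). (s, t) \<in> ord R \<and> (t = r \<longrightarrow> s = r \<or> s \<in> x)}\<rparr>"
  have S: "carr S = carr R" "rho S = rho R"
    "\<And>s t. (s, t) \<in> ord S \<longleftrightarrow> (s, t) \<in> ord R \<and> (t = r \<longrightarrow> s = r \<or> s \<in> x)"
    by (auto simp: S_def)
  have xd: "a \<in> x" if "(a, b) \<in> ord R" "b \<in> x" for a b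
    using x that o(1) by (auto simp: down_closed_def)
  have po: "partial_order_on (carr S) (ord S)"
  proof (rule partial_orderI)
    show "ord S \<subseteq> carr S \<times> carr S" using o(1) by (auto simp: S)
    show "(a, a) \<in> ord S" if "a \<in> carr S" for a using that o(2) by (auto simp: S)
    show "(a, c) \<in> ord S" if "(a, b) \<in> ord S" "(b, c) \<in> ord S" for a b c
      using that o(3) xd unfolding S(3) by metis
    show "a = b" if "(a, b) \<in> ord S" "(b, a) \<in> ord S" for a b
      using that o(4) unfolding S(3) by metis
  qed
  have rS: "realisation \<A> S"
    unfolding realisation_def
  proof (intro conjI ballI allI impI po)
    fix t assume t: "t \<in> carr S"
    have "{s \<in> carr S. (s, t) \<in> ord S} \<subseteq> rdown R t"
      by (auto simp: S rdown_def)
    then show "finite {s \<in> carr S. (s, t) \<in> ord S}"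
      using finite_rdown[OF R, of t] t by (auto simp: S intro: finite_subset)
  next
    show "rho S ` carr S \<subseteq> \<Union>\<A>"
      using R by (auto simp: S realisation_def)
  next
    fix z assume z: "rclosed S z"
    have zc: "z \<subseteq> carr R" using z by (auto simp: down_closed_def S)
    have zd: "s \<in> z" if "(s, t) \<in> ord S" "t \<in> z" for s t
      using z that o(1) by (auto simp: down_closed_def S)
    \<comment> \<open>A down-closed \<open>z\<close> of \<open>S\<close> can fail to be down-closed
      in \<open>R\<close> only if \<open>r\<close> is maximal in it, for anything strictly above
      \<open>r\<close> still brings in all causes of \<open>r\<close>. In that case the labels of
      \<open>z\<close> are those of \<open>z - {r}\<close> together with those of \<open>x\<close>
      and \<open>r\<close>, a union bounded by the labels of all of \<open>R\<close>; this is where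
      bounded completeness enters.\<close>
    show "rho S ` z \<in> \<A>"
    proof (cases "r \<in> z \<and> (\<forall>t\<in>z. (r, t) \<in> ord R \<longrightarrow> t = r)")
      case False
      have "rclosed R z"
        unfolding down_closed_def
      proof (intro conjI ballI impI zc)
        fix t s assume t: "t \<in> z" "s \<in> carr R" "(s, t) \<in> ord R"
        show "s \<in> z"
        proof (cases "t = r")
          case True
          then obtain u where "u \<in> z" "(r, u) \<in> ord R" "u \<noteq> r" using False t by auto
          then show ?thesis using t True o(3) zd[of s u] by (auto simp: S)
        qed (use t zd[of s t] in \<open>auto simp: S\<close>)
      qed
      then show ?thesis using rclosed_image_in[OF R] by (simp add: S)
    next
      case True
      have "rclosed R (z - {r})"
        unfolding down_closed_def
      proof (intro conjI ballI impI)
        show "z - {r} \<subseteq> carr R" using zc by auto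
        fix t s assume t: "t \<in> z - {r}" "s \<in> carr R" "(s, t) \<in> ord R"
        then show "s \<in> z - {r}" using True zd[of s t] by (auto simp: S)
      qed
      then have a: "rho R ` (z - {r}) \<in> \<A>" using rclosed_image_in[OF R] by blast
      have c: "rho R ` carr R \<in> \<A>" using rclosed_image_in[OF R rclosed_carr] .
      have xz: "x \<subseteq> z" using True x zd[of _ r] by (auto simp: S rdown_def)
      have "insert (rho R r) (rho R ` x) \<union> rho R ` (z - {r}) \<in> \<A>"
        by (rule bounded_complete_Un[OF bc xA a c]) (use r zc xz in auto)
      moreover have "insert (rho R r) (rho R ` x) \<union> rho R ` (z - {r}) = rho R ` z"
        using True xz by auto
      ultimately show ?thesis by (simp add: S)
    qed
  qed
  have "total_real_map R S ((\<lambda>r. Some (id r)) |` carr R)"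
    by (rule total_real_map_Some) (auto simp: S down_closed_def)
  then have iso: "real_iso_map R S ((\<lambda>r. Some r) |` carr R)"
    using ex rS by (auto simp: extremal_def)
  have inv: "inv_into (carr R) (\<lambda>u. the (((\<lambda>r. Some r) |` carr R) u)) s = s" if "s \<in> carr R" for s
    using that by (intro inv_into_f_eq) (auto simp: inj_on_def restrict_map_def)
  \<comment> \<open>\<open>insert r x\<close> is down-closed for the weakened order only: in
    \<open>R\<close> it would have to contain the discarded cause \<open>w\<close>. The inverse of
    the identity would nevertheless have to send it to a down-closed set of
    \<open>R\<close>.\<close>
  have cl: "rclosed S (insert r x)"
    using xd x r by (auto simp: down_closed_def S)
  then have "rclosed R (ran ((\<lambda>s. Some (inv_into (carr R) (\<lambda>u. the (((\<lambda>r. Some r) |` carr R) u)) s))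
      |` carr S |` insert r x))"
    using iso unfolding real_iso_map_def real_map_def by blast
  moreover have "ran ((\<lambda>s. Some (inv_into (carr R) (\<lambda>u. the (((\<lambda>r. Some r) |` carr R) u)) s))
      |` carr S |` insert r x) = insert r x"
    unfolding ran_restrict_Some using inv x(1) r by (force simp: S down_closed_def)
  ultimately show False using w by (auto simp: down_closed_def rdown_def)
qed

lemma extremal_imp_tight:
  assumes "bounded_complete \<A>" and "extremal \<A> R"
  shows "tight \<A> R"
  using assms(2) extremal_imp_eq[OF assms(2)] extremal_imp_minimal[OF assms]
  unfolding tight_def extremal_def by blast

section \<open>Maps out of tight realisations\<close>

text \<open>The strict causes of \<open>r\<close> that \<open>f\<close> sends below \<open>s\<close>
  form a down-closed set by the induction hypothesis, and with \<open>r\<close> they carry exactly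
  the labels of \<open>rdown S s\<close>, a member of \<open>\<A>\<close>. Minimality of causes then
  leaves no strict cause outside this set, which yields definedness and monotonicity
  together.\<close>

lemma real_map_rdown:
  assumes R: "tight \<A> R" and S: "realisation \<A> S" and f: "real_map R S f"
    and r: "f r = Some s"
  shows "rdown R r \<subseteq> dom f \<and> (\<lambda>u. the (f u)) ` rdown R r = rdown S s"
proof -
  have rR: "realisation \<A> R" using R by (simp add: tight_def)
  note oR = realisation_order[OF rR] and oS = realisation_order[OF S]
  have dom: "dom f \<subseteq> carr R" and ranS: "ran f = carr S"
    and lab: "\<And>r s. f r = Some s \<Longrightarrow> rho R r = rho S s"
    and dc: "\<And>x. rclosed R x \<Longrightarrow> rclosed S (ran (f |` x))"
    using f by (auto simp: real_map_def)
  \<comment> \<open>Preservation of down-closed sets, applied to \<open>rdown R r\<close>, already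
    lifts everything below \<open>s\<close> to something below \<open>r\<close>; the opposite
    inclusion is the one that needs tightness.\<close>
  have lift: "\<exists>u\<in>rdown R r. f u = Some v" if "f r = Some s" "v \<in> rdown S s" for r s v
  proof -
    have "r \<in> rdown R r" using that dom oR(2) by (auto simp: rdown_def)
    then have "s \<in> ran (f |` rdown R r)" using that by (auto simp: ran_def restrict_map_def)
    then have "v \<in> ran (f |` rdown R r)"
      using dc[OF rclosed_rdown[OF rR, of r]] that by (auto simp: down_closed_def rdown_def)
    then show ?thesis by (auto simp: ran_def restrict_map_def split: if_splits)
  qed
  have "r \<in> carr R" using r dom by auto
  from rR this r show ?thesis
  proof (induction arbitrary: s rule: rdown_induct)
    case (less r)
    note r = less.prems
    have sS: "s \<in> carr S" using r ranS by (auto simp: ran_def)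
    have sd: "rdown S v \<subseteq> rdown S s" if "v \<in> rdown S s" for v
      using rdown_mono[OF S that] .
    have rr: "r \<in> rdown R r" using less.hyps oR(2) by (auto simp: rdown_def)
    define x where "x = {u \<in> rdown R r - {r}. \<exists>v\<in>rdown S s. f u = Some v}"
    have "rclosed R x"
      unfolding down_closed_def
    proof (intro conjI ballI impI)
      show "x \<subseteq> carr R" by (auto simp: x_def rdown_def)
      fix u w assume u: "u \<in> x" and w: "w \<in> carr R" "(w, u) \<in> ord R"
      then obtain v where v: "v \<in> rdown S s" "f u = Some v" and ur: "u \<in> rdown R r - {r}"
        by (auto simp: x_def)
      have wu: "w \<in> rdown R u" using w by (simp add: rdown_def)
      have IH: "rdown R u \<subseteq> dom f" "(\<lambda>u. the (f u)) ` rdown R u = rdown S v"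
        using less.IH[OF ur v(2)] by auto
      obtain v' where v': "f w = Some v'" using IH wu by auto
      have "v' \<in> rdown S v" using IH wu v' by force
      moreover have "w \<in> rdown R r - {r}"
        using rdown_psubset[OF rR ur] wu rr rdown_mono[OF rR wu] by auto
      ultimately show "w \<in> x" using v' sd[OF v(1)] by (auto simp: x_def)
    qed
    moreover have "insert (rho R r) (rho R ` x) = rho S ` rdown S s"
    proof
      show "insert (rho R r) (rho R ` x) \<subseteq> rho S ` rdown S s"
        using lab r sS oS(2) by (auto simp: x_def rdown_def)
      show "rho S ` rdown S s \<subseteq> insert (rho R r) (rho R ` x)"
      proof
        fix e assume "e \<in> rho S ` rdown S s"
        then obtain v where v: "v \<in> rdown S s" and e: "e = rho S v" by blast
        obtain u where u: "u \<in> rdown R r" "f u = Some v" using lift[OF r v] by blast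
        then show "e \<in> insert (rho R r) (rho R ` x)"
          unfolding e using lab[OF u(2), symmetric] v by (cases "u = r") (auto simp: x_def)
      qed
    qed
    ultimately have "x = rdown R r - {r}"
      using R less.hyps rclosed_image_in[OF S rclosed_rdown[OF S]]
      unfolding tight_def by (metis (no_types, lifting) x_def mem_Collect_eq subsetI)
    then have *: "\<exists>v\<in>rdown S s. f u = Some v" if "u \<in> rdown R r" for u
      using that r sS oS(2) by (cases "u = r") (auto simp: x_def rdown_def)
    then have "(\<lambda>u. the (f u)) ` rdown R r \<subseteq> rdown S s" by force
    moreover have "rdown S s \<subseteq> (\<lambda>u. the (f u)) ` rdown R r" using lift[OF r] by force
    ultimately show ?case using * by blast
  qed
qed

text \<open>An element \<open>r\<close> cannot share its image with a strict cause \<open>u\<close>: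
  both would have one label, so the labels of \<open>rdown R u\<close> would show that the strict
  causes of \<open>u\<close> already suffice for \<open>r\<close>, although \<open>u\<close> itself
  is missing from them. Hence two elements with a common image have, by induction, the same strict
  causes; their labels agree as well, and tightness identifies them.\<close>

lemma real_map_inj:
  assumes R: "tight \<A> R" and S: "realisation \<A> S" and f: "real_map R S f"
  shows "f r1 = Some s \<Longrightarrow> f r2 = Some s \<Longrightarrow> r1 = r2"
proof -
  have rR: "realisation \<A> R" using R by (simp add: tight_def)
  note oR = realisation_order[OF rR]
  have dom: "dom f \<subseteq> carr R" and lab: "\<And>r s. f r = Some s \<Longrightarrow> rho R r = rho S s"
    using f by (auto simp: real_map_def)
  note down = real_map_rdown[OF R S f]
  have strict: "f u \<noteq> f r" if r: "r \<in> dom f" and u: "u \<in> rdown R r - {r}" for u r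
  proof
    assume eq: "f u = f r"
    then obtain s where s: "f r = Some s" "f u = Some s" using r by auto
    have "insert (rho R r) (rho R ` (rdown R u - {u})) = rho R ` rdown R u"
    proof -
      have "u \<in> rdown R u" using u oR(2) by (auto simp: rdown_def)
      then show ?thesis using lab[OF s(1)] lab[OF s(2)] by (metis image_insert insert_Diff)
    qed
    also have "\<dots> \<in> \<A>" using rclosed_image_in[OF rR rclosed_rdown[OF rR]] .
    finally have "insert (rho R r) (rho R ` (rdown R u - {u})) \<in> \<A>" .
    moreover have "rdown R u - {u} \<subseteq> rdown R r - {r}"
    proof -
      have "r \<notin> rdown R u" using u oR(4) by (auto simp: rdown_def)
      then show ?thesis using rdown_psubset[OF rR u] by auto
    qed
    moreover have "r \<in> carr R" using r dom by auto
    ultimately have "rdown R u - {u} = rdown R r - {r}"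
      using R rclosed_sdown[OF rR, of u] unfolding tight_def by blast
    then show False using u by auto
  qed
  show "r1 = r2" if r1: "f r1 = Some s" and r2: "f r2 = Some s"
  proof -
    have "r1 \<in> carr R" using r1 dom by auto
    from rR this r1 r2 show ?thesis
    proof (induction arbitrary: s r2 rule: rdown_induct)
      case (less r)
      note r = less.prems(1) and r2 = less.prems(2)
      have d: "rdown R r \<subseteq> dom f" "rdown R r2 \<subseteq> dom f"
        "(\<lambda>u. the (f u)) ` rdown R r = (\<lambda>u. the (f u)) ` rdown R r2"
        using down[OF r] down[OF r2] by auto
      have transfer: "\<exists>v\<in>rdown R b - {b}. f v = f u"
        if "(\<lambda>u. the (f u)) ` rdown R a = (\<lambda>u. the (f u)) ` rdown R b" "f a = Some s" "f b = Some s"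
          "rdown R a \<subseteq> dom f" "rdown R b \<subseteq> dom f"
          "u \<in> rdown R a - {a}" for a b u
      proof -
        have "the (f u) \<in> (\<lambda>u. the (f u)) ` rdown R b" using that by blast
        then obtain v where v: "v \<in> rdown R b" "the (f v) = the (f u)" by force
        then have fv: "f v = f u" using that by (metis DiffD1 domIff in_mono option.expand)
        moreover have "f u \<noteq> f a" using strict[of a u] that by auto
        ultimately have "v \<noteq> b" using that by metis
        then show ?thesis using v fv by blast
      qed
      have "rdown R r - {r} \<subseteq> rdown R r2 - {r2}"
      proof
        fix u assume u: "u \<in> rdown R r - {r}"
        then obtain v where v: "v \<in> rdown R r2 - {r2}" "f v = f u"
          using transfer[OF d(3) r r2 d(1,2) u] by blast
        obtain w where "f u = Some w" using d u by auto
        then have "u = v" using less.IH[OF u] v by metis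
        then show "u \<in> rdown R r2 - {r2}" using v by simp
      qed
      moreover have "rdown R r2 - {r2} \<subseteq> rdown R r - {r}"
      proof
        fix u assume u: "u \<in> rdown R r2 - {r2}"
        then obtain v where v: "v \<in> rdown R r - {r}" "f v = f u"
          using transfer[OF d(3)[symmetric] r2 r d(2,1) u] by blast
        obtain w where "f u = Some w" using d u by auto
        then have "v = u" using less.IH[OF v(1)] v by metis
        then show "u \<in> rdown R r - {r}" using v by simp
      qed
      ultimately have "rdown R r - {r} = rdown R r2 - {r2}" by blast
      moreover have "rho R r = rho R r2" using lab[OF r] lab[OF r2] by simp
      moreover have "r2 \<in> carr R" using r2 dom by auto
      ultimately show ?case using R less.hyps unfolding tight_def by blast
    qed
  qed
qed

section \<open>Isomorphisms of realisations as label-preserving order isomorphisms\<close>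

definition riso :: "('r \<Rightarrow> 's) \<Rightarrow> ('r, 'e) realisation \<Rightarrow> ('s, 'e) realisation \<Rightarrow> bool" where
  "riso h R S \<longleftrightarrow> bij_betw h (carr R) (carr S) \<and>
     (\<forall>a\<in>carr R. \<forall>b\<in>carr R. (a, b) \<in> ord R \<longleftrightarrow> (h a, h b) \<in> ord S) \<and>
     (\<forall>a\<in>carr R. rho S (h a) = rho R a)"

lemma riso_rclosed:
  assumes h: "riso h R S" and x: "x \<subseteq> carr R"
  shows "rclosed S (h ` x) \<longleftrightarrow> rclosed R x"
proof -
  have im: "h ` carr R = carr S" and inj: "inj_on h (carr R)"
    and ord: "\<And>a b. a \<in> carr R \<Longrightarrow> b \<in> carr R \<Longrightarrow> (a, b) \<in> ord R \<longleftrightarrow> (h a, h b) \<in> ord S"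
    using h by (auto simp: riso_def bij_betw_def)
  have "rclosed S (h ` x) \<longleftrightarrow> (\<forall>a\<in>x. \<forall>b\<in>carr R. (h b, h a) \<in> ord S \<longrightarrow> h b \<in> h ` x)"
    using x unfolding down_closed_def im[symmetric] by auto
  also have "\<dots> \<longleftrightarrow> (\<forall>a\<in>x. \<forall>b\<in>carr R. (b, a) \<in> ord R \<longrightarrow> b \<in> x)"
    using x inj ord by (auto simp: inj_on_image_mem_iff subset_iff)
  finally show ?thesis using x by (auto simp: down_closed_def)
qed

lemma riso_rdown:
  assumes h: "riso h R S" and r: "r \<in> carr R"
  shows "rdown S (h r) = h ` rdown R r"
proof -
  have "carr S = h ` carr R" using h by (auto simp: riso_def bij_betw_def)
  then show ?thesis using assms unfolding riso_def rdown_def by auto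
qed

lemma riso_id: "riso id R R"
  by (simp add: riso_def)

lemma riso_sym:
  assumes "riso h R S" shows "riso (inv_into (carr R) h) S R"
proof -
  have b: "bij_betw h (carr R) (carr S)" using assms by (simp add: riso_def)
  show ?thesis
    using assms bij_betw_inv_into[OF b] bij_betw_inv_into_right[OF b] inv_into_into[of _ h "carr R"]
    unfolding riso_def bij_betw_def by (metis (no_types, lifting))
qed

lemma riso_trans: "riso h R S \<Longrightarrow> riso g S T \<Longrightarrow> riso (g \<circ> h) R T"
  unfolding riso_def by (auto intro: bij_betw_trans simp: bij_betwE)

lemma riso_imp_real_map:
  assumes h: "riso h R S"
  shows "total_real_map R S ((\<lambda>r. Some (h r)) |` carr R)"
  using h by (intro total_real_map_Some) (auto simp: riso_def bij_betw_def riso_rclosed[OF h] down_closed_def[of "carr R" "ord R"])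

lemma riso_imp_real_iso:
  assumes h: "riso h R S"
  shows "real_iso R S"
proof -
  let ?f = "(\<lambda>r. Some (h r)) |` carr R"
  have eq: "the (?f r) = h r" if "r \<in> carr R" for r using that by simp
  have bij: "bij_betw (\<lambda>r. the (?f r)) (carr R) (carr S)"
    using h eq by (auto simp: riso_def cong: bij_betw_cong)
  have inv: "inv_into (carr R) (\<lambda>r. the (?f r)) s = inv_into (carr R) h s" for s
    unfolding inv_into_def using eq by (metis (mono_tags, lifting))
  have "real_iso_map R S ?f"
    using riso_imp_real_map[OF h] riso_imp_real_map[OF riso_sym[OF h]] bij
    by (simp add: real_iso_map_def total_real_map_def inv)
  then show ?thesis by (auto simp: real_iso_def)
qed

text \<open>A bijection sending down-closed sets to down-closed sets only reflects the order.
  Preservation needs the same property of the inverse; both times it is applied to a principal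
  down-set.\<close>

lemma real_iso_imp_riso:
  assumes R: "realisation \<A> R" and S: "realisation \<B> S" and iso: "real_iso R S"
  shows "\<exists>h. riso h R S"
proof -
  obtain f where f: "real_iso_map R S f" using iso by (auto simp: real_iso_def)
  define h where "h r = the (f r)" for r
  define g where "g = inv_into (carr R) h"
  have dom: "dom f = carr R" and fm: "real_map R S f" and bij: "bij_betw h (carr R) (carr S)"
    and gm: "real_map S R ((\<lambda>s. Some (g s)) |` carr S)"
    using f unfolding real_iso_map_def total_real_map_def g_def h_def[abs_def] by auto
  have fh: "f r = Some (h r)" if "r \<in> carr R" for r using that dom unfolding h_def by (metis domD option.sel)
  have ran: "ran (f |` rdown R r) = h ` rdown R r" for r
    using fh by (force simp: ran_def restrict_map_def rdown_def)
  have ran2: "ran ((\<lambda>s. Some (g s)) |` carr S |` rdown S s) = g ` rdown S s" for s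
    unfolding ran_restrict_Some by (auto simp: rdown_def)
  have gh: "g (h a) = a" if "a \<in> carr R" for a
    using bij that by (simp add: g_def bij_betw_inv_into_left)
  have hc: "h a \<in> carr S" if "a \<in> carr R" for a using bij that by (simp add: bij_betwE)
  have "(a, b) \<in> ord R \<longleftrightarrow> (h a, h b) \<in> ord S" if a: "a \<in> carr R" and b: "b \<in> carr R" for a b
  proof
    assume ab: "(a, b) \<in> ord R"
    have "rclosed R (g ` rdown S (h b))"
      using gm rclosed_rdown[OF S, of "h b"] unfolding real_map_def ran2[symmetric] by blast
    moreover have "b \<in> g ` rdown S (h b)"
      using gh[OF b] hc[OF b] realisation_order(2)[OF S] by (force simp: rdown_def)
    ultimately have "a \<in> g ` rdown S (h b)" using a ab by (auto simp: down_closed_def)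
    then obtain v where v: "v \<in> rdown S (h b)" "a = g v" by blast
    then have "h a = v" using bij by (auto simp: g_def rdown_def bij_betw_inv_into_right)
    then show "(h a, h b) \<in> ord S" using v by (simp add: rdown_def)
  next
    assume ab: "(h a, h b) \<in> ord S"
    have "rclosed S (h ` rdown R b)"
      using fm rclosed_rdown[OF R, of b] unfolding real_map_def ran[symmetric] by blast
    moreover have "h b \<in> h ` rdown R b"
      using b realisation_order(2)[OF R] by (auto simp: rdown_def)
    ultimately have "h a \<in> h ` rdown R b" using hc[OF a] ab by (auto simp: down_closed_def)
    then show "(a, b) \<in> ord R"
      using bij a by (auto simp: rdown_def bij_betw_def inj_on_def)
  qed
  moreover have "rho S (h a) = rho R a" if "a \<in> carr R" for a
    using fm fh[OF that] by (auto simp: real_map_def)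
  ultimately show ?thesis using bij unfolding riso_def by blast
qed

text \<open>By the two preceding results about maps, a total map is injective and sends principal
  down-sets onto principal down-sets. Being surjective as well, it is an order isomorphism.\<close>

lemma tight_imp_extremal:
  fixes R :: "('r, 'e) realisation"
  assumes R: "tight \<A> R"
  shows "extremal \<A> R"
  unfolding extremal_def
proof (intro conjI allI impI)
  show rR: "realisation \<A> R" using R by (simp add: tight_def)
  fix S :: "('r, 'e) realisation" and f
  assume "realisation \<A> S \<and> total_real_map R S f"
  then have S: "realisation \<A> S" and f: "real_map R S f" and dom: "dom f = carr R"
    and ft: "total_real_map R S f"
    by (auto simp: total_real_map_def)
  note down = real_map_rdown[OF R S f] and inj = real_map_inj[OF R S f]
  define h where "h r = the (f r)" for r
  have fh: "f r = Some (h r)" if "r \<in> carr R" for r using that dom unfolding h_def by (metis domD option.sel)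
  have f_eq: "f = (\<lambda>r. Some (h r)) |` carr R"
    using fh dom by (auto simp: restrict_map_def fun_eq_iff domIff)
  have inj_h: "inj_on h (carr R)" using fh inj by (metis inj_onI)
  have im: "h ` carr R = carr S"
    using f ran_restrict_Some'[of h "carr R"] by (simp add: real_map_def f_eq[symmetric])
  have hd: "h ` rdown R r = rdown S (h r)" if "r \<in> carr R" for r
    using down[OF fh[OF that]] by (simp add: h_def)
  have "(a, b) \<in> ord R \<longleftrightarrow> (h a, h b) \<in> ord S" if a: "a \<in> carr R" and b: "b \<in> carr R" for a b
  proof -
    have "(a, b) \<in> ord R \<longleftrightarrow> a \<in> rdown R b" using a by (simp add: rdown_def)
    also have "\<dots> \<longleftrightarrow> h a \<in> h ` rdown R b"
      using inj_h a by (auto simp: inj_on_def rdown_def)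
    also have "\<dots> \<longleftrightarrow> (h a, h b) \<in> ord S" using a im unfolding hd[OF b] by (auto simp: rdown_def)
    finally show ?thesis .
  qed
  moreover have "rho S (h a) = rho R a" if "a \<in> carr R" for a
    using f fh[OF that] by (auto simp: real_map_def)
  ultimately have iso: "riso h R S" using inj_h im by (auto simp: riso_def bij_betw_def)
  have eq: "the (f r) = h r" for r by (simp add: h_def)
  show "real_iso_map R S f"
    using ft riso_imp_real_map[OF riso_sym[OF iso]] iso
    by (simp add: real_iso_map_def total_real_map_def eq riso_def)
qed

text \<open>The partial order on \<open>S\<close> is assumed separately because \<open>riso\<close>
  constrains \<open>ord S\<close> only between elements of the carrier; all remaining clauses are
  transported along \<open>h\<close>.\<close>

lemma tight_riso:
  assumes h: "riso h R S" and R: "tight \<A> R"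
    and po: "partial_order_on (carr S) (ord S)"
  shows "tight \<A> S"
proof -
  have rR: "realisation \<A> R" using R by (simp add: tight_def)
  have im: "carr S = h ` carr R" and inj: "inj_on h (carr R)"
    and lab: "\<And>a. a \<in> carr R \<Longrightarrow> rho S (h a) = rho R a"
    using h by (auto simp: riso_def bij_betw_def)
  have sub: "\<exists>x. x \<subseteq> carr R \<and> z = h ` x" if "z \<subseteq> carr S" for z
    using that unfolding im by (rule subset_imageE) blast
  have img: "rho S ` h ` x = rho R ` x" if "x \<subseteq> carr R" for x
    using that lab by (force simp: image_image)
  have sd: "rdown S (h r) - {h r} = h ` (rdown R r - {r})" if "r \<in> carr R" for r
  proof -
    have "h ` (rdown R r - {r}) = h ` rdown R r - h ` {r}"
      using that by (intro inj_on_image_set_diff[OF inj]) (auto simp: rdown_def)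
    then show ?thesis using riso_rdown[OF h that] by simp
  qed
  have sdc: "rdown R r - {r} \<subseteq> carr R" for r by (auto simp: rdown_def)
  have "realisation \<A> S"
    unfolding realisation_def
  proof (intro conjI ballI allI impI po)
    fix s assume "s \<in> carr S"
    then obtain r where r: "r \<in> carr R" "s = h r" using im by auto
    then show "finite {r' \<in> carr S. (r', s) \<in> ord S}"
      using riso_rdown[OF h r(1)] finite_rdown[OF rR r(1)] unfolding rdown_def by simp
  next
    show "rho S ` carr S \<subseteq> \<Union>\<A>" using rR img[of "carr R"] by (auto simp: im realisation_def)
  next
    fix z assume z: "rclosed S z"
    then obtain x where x: "x \<subseteq> carr R" "z = h ` x" using sub unfolding down_closed_def by meson
    then show "rho S ` z \<in> \<A>"
      using z riso_rclosed[OF h x(1)] rclosed_image_in[OF rR] img[OF x(1)] by simp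
  qed
  moreover have "s = s'"
    if s: "s \<in> carr S" "s' \<in> carr S"
      and eq: "rdown S s - {s} = rdown S s' - {s'}" "rho S s = rho S s'" for s s'
  proof -
    obtain r r' where r: "r \<in> carr R" "s = h r" "r' \<in> carr R" "s' = h r'" using s im by auto
    then have "rdown R r - {r} = rdown R r' - {r'}"
      using eq(1) sd inj_on_image_eq_iff[OF inj sdc sdc] by simp
    moreover have "rho R r = rho R r'" using eq(2) r lab by simp
    ultimately show ?thesis using R r unfolding tight_def by blast
  qed
  moreover have "z = rdown S s - {s}"
    if s: "s \<in> carr S" and z: "rclosed S z" "z \<subseteq> rdown S s - {s}" "insert (rho S s) (rho S ` z) \<in> \<A>" for s z
  proof -
    obtain r where r: "r \<in> carr R" "s = h r" using s im by auto
    obtain x where x: "x \<subseteq> carr R" "z = h ` x" using z sub unfolding down_closed_def by meson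
    have "rclosed R x" using riso_rclosed[OF h x(1)] z x by simp
    moreover have "x \<subseteq> rdown R r - {r}"
    proof
      fix u assume u: "u \<in> x"
      then have "h u \<in> h ` (rdown R r - {r})" using z(2) x(2) r(2) sd[OF r(1)] by auto
      then show "u \<in> rdown R r - {r}"
        using inj_on_image_mem_iff[OF inj _ sdc] u x(1) by blast
    qed
    moreover have "insert (rho R r) (rho R ` x) \<in> \<A>"
      using z(3) r x img[OF x(1)] lab[OF r(1)] by simp
    ultimately have "x = rdown R r - {r}" using R r(1) unfolding tight_def by blast
    then show ?thesis using x r sd[OF r(1)] by simp
  qed
  ultimately show ?thesis unfolding tight_def by blast
qed

section \<open>Prime realisations as partial orders on labels\<close>

definition rrestr :: "('r, 'e) realisation \<Rightarrow> 'r \<Rightarrow> ('r, 'e) realisation" where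
  "rrestr R r = R\<lparr>carr := rdown R r, ord := ord R \<inter> rdown R r \<times> rdown R r\<rparr>"

lemma rrestr_simps [simp]:
  "carr (rrestr R r) = rdown R r" "rho (rrestr R r) = rho R"
  "ord (rrestr R r) = ord R \<inter> rdown R r \<times> rdown R r"
  by (auto simp: rrestr_def)

lemma rdown_rrestr:
  assumes "realisation \<A> R" "u \<in> rdown R r"
  shows "rdown (rrestr R r) u = rdown R u"
proof -
  have "rdown R r \<subseteq> carr R" by (auto simp: rdown_def)
  then show ?thesis
    using rdown_mono[OF assms] assms(2) by (auto simp: rdown_def[of "rrestr R r"] rdown_def[of R u])
qed

lemma rclosed_rrestr:
  assumes R: "realisation \<A> R"
  shows "rclosed (rrestr R r) x \<longleftrightarrow> rclosed R x \<and> x \<subseteq> rdown R r"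
  using realisation_order(1)[OF R] rclosed_rdown[OF R, of r] unfolding down_closed_def by auto

lemma is_top_rrestr:
  assumes "realisation \<A> R" "r \<in> carr R" shows "is_top (rrestr R r) r"
  using realisation_order(2)[OF assms] assms(2) by (auto simp: is_top_def rdown_def)

lemma tight_rrestr:
  assumes R: "tight \<A> R" and r: "r \<in> carr R"
  shows "tight \<A> (rrestr R r)"
proof -
  have rR: "realisation \<A> R" using R by (simp add: tight_def)
  note o = realisation_order[OF rR]
  have sub: "rdown R r \<subseteq> carr R" by (auto simp: rdown_def)
  have 1: "partial_order_on (rdown R r) (ord (rrestr R r))"
  proof (rule partial_orderI)
    show "(a, c) \<in> ord (rrestr R r)"
      if "(a, b) \<in> ord (rrestr R r)" "(b, c) \<in> ord (rrestr R r)" for a b c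
      using that o(3)[of a b c] by simp
    show "a = b" if "(a, b) \<in> ord (rrestr R r)" "(b, a) \<in> ord (rrestr R r)" for a b
      using that o(4)[of a b] by simp
  qed (use o(2) sub in auto)
  have 2: "finite {r' \<in> rdown R r. (r', a) \<in> ord (rrestr R r)}" for a
    by (rule finite_subset[OF _ finite_rdown[OF rR r]]) auto
  have 3: "rho R ` rdown R r \<subseteq> \<Union>\<A>" using rR sub unfolding realisation_def by blast
  have 4: "rho R ` x \<in> \<A>" if "rclosed (rrestr R r) x" for x
    using that rclosed_rrestr[OF rR] rclosed_image_in[OF rR] by blast
  have "realisation \<A> (rrestr R r)"
    unfolding realisation_def rrestr_simps(1,2)
    by (intro conjI ballI allI impI 1 2 3 4[unfolded rrestr_simps(1)])
  moreover have "a = b"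
    if "a \<in> rdown R r" "b \<in> rdown R r"
      "rdown (rrestr R r) a - {a} = rdown (rrestr R r) b - {b}" "rho R a = rho R b" for a b
    using that R sub unfolding tight_def rdown_rrestr[OF rR that(1)] rdown_rrestr[OF rR that(2)]
    by blast
  moreover have "x = rdown (rrestr R r) a - {a}"
    if "a \<in> rdown R r" "rclosed (rrestr R r) x" "x \<subseteq> rdown (rrestr R r) a - {a}"
      "insert (rho R a) (rho R ` x) \<in> \<A>" for a x
    using that R sub unfolding tight_def rdown_rrestr[OF rR that(1)] rclosed_rrestr[OF rR]
    by blast
  ultimately show ?thesis unfolding tight_def rrestr_simps(1,2) by blast
qed

lemma is_top_rdown: "is_top R t \<longleftrightarrow> t \<in> carr R \<and> rdown R t = carr R"
  by (auto simp: is_top_def rdown_def)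

lemma is_top_unique: "realisation \<A> R \<Longrightarrow> is_top R t \<Longrightarrow> is_top R t' \<Longrightarrow> t = t'"
  using realisation_order(4)[of \<A> R] by (auto simp: is_top_def)

lemma rmax_eq:
  assumes "realisation \<A> R" "is_top R t" shows "rmax R = rho R t"
  using is_top_unique[OF assms(1)] assms(2) unfolding rmax_def by (metis the_equality)

lemma is_top_riso: "riso h R S \<Longrightarrow> is_top R t \<Longrightarrow> is_top S (h t)"
  using riso_rdown[of h R S t] by (auto simp: is_top_rdown riso_def bij_betw_def)

lemma rmax_riso:
  assumes "riso h R S" "is_top R t" "realisation \<A> R" "realisation \<A> S"
  shows "rmax S = rmax R"
  using rmax_eq[OF assms(3,2)] rmax_eq[OF assms(4) is_top_riso[OF assms(1,2)]] assms(1,2)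
  by (auto simp: riso_def is_top_def)

lemma rmax_rrestr:
  assumes R: "tight \<A> R" and r: "r \<in> carr R"
  shows "rmax (rrestr R r) = rho R r"
proof -
  have "realisation \<A> R" "realisation \<A> (rrestr R r)"
    using R tight_rrestr[OF R r] by (auto simp: tight_def)
  then show ?thesis using rmax_eq is_top_rrestr r by (metis rrestr_simps(2))
qed

lemma finite_carr_top: "realisation \<A> R \<Longrightarrow> is_top R t \<Longrightarrow> finite (carr R)"
  using finite_rdown[of \<A> R t] by (simp add: is_top_rdown)

text \<open>In one direction take a preimage \<open>r\<close> of the top of \<open>S\<close>: its
  principal down-set is mapped bijectively onto the whole of \<open>S\<close>. In the other, an
  isomorphism onto \<open>rrestr R r\<close> inverts to a map that is undefined off
  \<open>rdown R r\<close>. Thus \<open>real_le\<close> becomes a statement about elements of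
  \<open>R\<close>.\<close>

lemma real_le_iff:
  assumes R: "tight \<A> R" and S: "realisation \<A> S" and top: "is_top S t"
  shows "real_le S R \<longleftrightarrow> (\<exists>r\<in>carr R. \<exists>h. riso h S (rrestr R r))"
proof
  have rR: "realisation \<A> R" using R by (simp add: tight_def)
  {
    assume "real_le S R"
    then obtain f where f: "real_map R S f" by (auto simp: real_le_def)
    note down = real_map_rdown[OF R S f] and inj = real_map_inj[OF R S f]
    have dom: "dom f \<subseteq> carr R" using f by (auto simp: real_map_def)
    have "t \<in> ran f" using f top by (auto simp: real_map_def is_top_def)
    then obtain r where r: "f r = Some t" by (auto simp: ran_def)
    then have rc: "r \<in> carr R" using dom by auto
    define h where "h u = the (f u)" for u
    have fh: "f u = Some (h u)" if "u \<in> rdown R r" for u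
      using down[OF r] that unfolding h_def by (metis domD option.sel subsetD)
    have im: "h ` rdown R r = carr S"
      using down[OF r] top by (simp add: h_def is_top_rdown)
    have inj_h: "inj_on h (rdown R r)" using fh inj by (metis inj_onI)
    have sub: "rdown R b \<subseteq> rdown R r" if "b \<in> rdown R r" for b using rdown_mono[OF rR that] .
    have hd: "h ` rdown R b = rdown S (h b)" if "b \<in> rdown R r" for b
      using down[OF fh[OF that]] by (simp add: h_def)
    have "(a, b) \<in> ord R \<longleftrightarrow> (h a, h b) \<in> ord S"
      if a: "a \<in> rdown R r" and b: "b \<in> rdown R r" for a b
    proof -
      have "(a, b) \<in> ord R \<longleftrightarrow> a \<in> rdown R b" using a by (simp add: rdown_def)
      also have "\<dots> \<longleftrightarrow> h a \<in> h ` rdown R b"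
        using inj_on_image_mem_iff[OF inj_h a sub[OF b]] by simp
      also have "\<dots> \<longleftrightarrow> (h a, h b) \<in> ord S" using a im unfolding hd[OF b] by (auto simp: rdown_def)
      finally show ?thesis .
    qed
    moreover have "rho S (h a) = rho R a" if "a \<in> rdown R r" for a
      using f fh[OF that] by (auto simp: real_map_def)
    ultimately have "riso h (rrestr R r) S"
      using inj_h im by (auto simp: riso_def bij_betw_def)
    then show "\<exists>r\<in>carr R. \<exists>h. riso h S (rrestr R r)" using riso_sym rc by blast
  }
  {
    assume "\<exists>r\<in>carr R. \<exists>h. riso h S (rrestr R r)"
    then obtain r g where r: "r \<in> carr R" and g: "riso g (rrestr R r) S" using riso_sym by blast
    have "rclosed S (g ` (rdown R r \<inter> x))" if x: "rclosed R x" for x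
    proof -
      have "rclosed (rrestr R r) (rdown R r \<inter> x)"
        using x rclosed_rdown[OF rR, of r] by (auto simp: rclosed_rrestr[OF rR] down_closed_def)
      then show ?thesis using riso_rclosed[OF g, of "rdown R r \<inter> x"] by simp
    qed
    moreover have "rdown R r \<subseteq> carr R" by (auto simp: rdown_def)
    moreover have "g ` rdown R r = carr S" "\<forall>u\<in>rdown R r. rho S (g u) = rho R u"
      using g by (auto simp: riso_def bij_betw_def)
    ultimately have "real_map R S ((\<lambda>u. Some (g u)) |` rdown R r)"
      unfolding real_map_def ran_restrict_Some ran_restrict_Some' restrict_Some_iff dom_restrict_Some
      by simp
    then show "real_le S R" by (auto simp: real_le_def)
  }
qed

lemma riso_rrestr:
  assumes h: "riso h R S" and u: "u \<in> carr R"
  shows "riso h (rrestr R u) (rrestr S (h u))"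
proof -
  have sub: "rdown R u \<subseteq> carr R" by (auto simp: rdown_def)
  have inj: "inj_on h (rdown R u)"
    using h sub by (auto simp: riso_def bij_betw_def intro: inj_on_subset)
  have "(a, b) \<in> ord R \<longleftrightarrow> (h a, h b) \<in> ord S" "rho S (h a) = rho R a"
    if "a \<in> rdown R u" "b \<in> rdown R u" for a b
    using h that sub unfolding riso_def by blast+
  then show ?thesis
    using inj unfolding riso_def bij_betw_def by (auto simp: riso_rdown[OF h u])
qed

lemma rrestr_rrestr:
  assumes R: "realisation \<A> R" and u: "u \<in> rdown R r"
  shows "rrestr (rrestr R r) u = rrestr R u"
proof -
  have "rdown R u \<subseteq> rdown R r" using rdown_mono[OF R u] .
  then have "Restr (Restr (ord R) (rdown R r)) (rdown R u) = Restr (ord R) (rdown R u)" by auto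
  then show ?thesis
    unfolding rrestr_def[of "rrestr R r"] rdown_rrestr[OF R u] by (simp add: rrestr_def)
qed

text \<open>By induction the isomorphism fixes every strict cause \<open>u\<close> of
  \<open>a\<close>, since it restricts to one between the principal down-sets of \<open>u\<close>
  and \<open>h u\<close>. So \<open>a\<close> and \<open>b\<close> have the same strict causes, and
  since tops go to tops they have the same label. Elements of a tight realisation may hence be
  identified with the isomorphism types of their down-sets.\<close>

lemma rrestr_iso_imp_eq:
  assumes R: "tight \<A> R" and "a \<in> carr R" "b \<in> carr R" "riso h (rrestr R a) (rrestr R b)"
  shows "a = b"
proof -
  have rR: "realisation \<A> R" using R by (simp add: tight_def)
  from rR assms(2-4) show ?thesis
  proof (induction arbitrary: b rule: rdown_induct)
    case (less a)
    note a = less.hyps and b = less.prems(1) and h = less.prems(2)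
    have real: "realisation \<A> (rrestr R b)" using tight_rrestr[OF R b] by (simp add: tight_def)
    have aa: "a \<in> rdown R a" using is_top_rrestr[OF rR a] by (simp add: is_top_def)
    have hab: "h a = b"
      using is_top_unique[OF real is_top_riso[OF h is_top_rrestr[OF rR a]] is_top_rrestr[OF rR b]] .
    have im: "h ` rdown R a = rdown R b" and inj: "inj_on h (rdown R a)"
      and lab: "\<And>u. u \<in> rdown R a \<Longrightarrow> rho R (h u) = rho R u"
      using h by (auto simp: riso_def bij_betw_def)
    have fixed: "h u = u" if u: "u \<in> rdown R a - {a}" for u
    proof -
      have hu: "h u \<in> rdown R b" using im u by auto
      have "riso h (rrestr R u) (rrestr R (h u))"
        using riso_rrestr[OF h, of u] u rrestr_rrestr[OF rR, of u a] rrestr_rrestr[OF rR hu] by simp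
      then show ?thesis using less.IH[OF u, of "h u"] hu by (auto simp: rdown_def)
    qed
    have "rdown R b - {b} = h ` (rdown R a - {a})"
      using inj_on_image_set_diff[OF inj, of "rdown R a" "{a}"] im hab aa by simp
    also have "\<dots> = rdown R a - {a}" using fixed by force
    finally have "rdown R a - {a} = rdown R b - {b}" by simp
    moreover have "rho R a = rho R b" using lab[OF aa] hab by simp
    ultimately show ?case using R a b unfolding tight_def by blast
  qed
qed

section \<open>Injectively labelled realisations as relations on labels\<close>

definition lrel :: "'e rel \<Rightarrow> ('e, 'e) realisation" where
  "lrel k = \<lparr>carr = Field k, ord = k, rho = id\<rparr>"

lemma lrel_simps [simp]: "carr (lrel k) = Field k" "ord (lrel k) = k" "rho (lrel k) = id"
  by (auto simp: lrel_def)

text \<open>A prime extremal realisation with injective labelling is determined up to isomorphism by the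
  partial order it induces on its labels, so \<open>primes \<A>\<close> is a set of canonical
  representatives of the unambiguous prime extremal realisations.\<close>

definition primes :: "'e set set \<Rightarrow> 'e rel set" where
  "primes \<A> = {k. tight \<A> (lrel k) \<and> (\<exists>t. is_top (lrel k) t)}"

definition below :: "'e rel \<Rightarrow> 'e \<Rightarrow> 'e rel" where
  "below k e = Restr k (under k e)"

definition ltop :: "'e rel \<Rightarrow> 'e" where
  "ltop k = rmax (lrel k)"

text \<open>A faithful copy of the order for injective labellings only: otherwise elements with
  equal labels are merged, which may destroy transitivity.\<close>

definition lab_rel :: "('r, 'e) realisation \<Rightarrow> 'e rel" where
  "lab_rel R = map_prod (rho R) (rho R) ` ord R"

lemma lab_rel_iff: "(x, y) \<in> lab_rel R \<longleftrightarrow> (\<exists>u v. (u, v) \<in> ord R \<and> x = rho R u \<and> y = rho R v)"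
  by (force simp: lab_rel_def)

lemma lab_rel_inj_iff:
  assumes R: "realisation \<A> R" and inj: "inj_on (rho R) (carr R)" and "a \<in> carr R" "b \<in> carr R"
  shows "(rho R a, rho R b) \<in> lab_rel R \<longleftrightarrow> (a, b) \<in> ord R"
proof
  assume "(rho R a, rho R b) \<in> lab_rel R"
  then obtain u v where uv: "(u, v) \<in> ord R" "rho R a = rho R u" "rho R b = rho R v"
    by (auto simp: lab_rel_iff)
  then have "u \<in> carr R" "v \<in> carr R" using realisation_order(1)[OF R] by auto
  then have "a = u" "b = v" using uv inj assms(3,4) by (auto dest: inj_onD)
  then show "(a, b) \<in> ord R" using uv by simp
qed (auto simp: lab_rel_iff)

lemma rdown_lrel: "rdown (lrel k) e = under k e"
  by (auto simp: rdown_def under_def Field_def)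

lemma rrestr_lrel:
  assumes "realisation \<A> (lrel k)"
  shows "rrestr (lrel k) e = lrel (below k e)"
proof -
  have "Field (below k e) = under k e"
    using realisation_order(2)[OF assms] by (force simp: below_def under_def Field_def)
  then show ?thesis by (simp add: rrestr_def lrel_def below_def rdown_lrel[unfolded lrel_def])
qed

lemma Field_below:
  assumes "realisation \<A> (lrel k)" shows "Field (below k e) = under k e"
  using rrestr_lrel[OF assms, of e] rdown_lrel[of k e] by (metis lrel_simps(1) rrestr_simps(1))

lemma Field_lab_rel:
  assumes "realisation \<A> R" shows "Field (lab_rel R) = rho R ` carr R"
  using realisation_order(1,2)[OF assms] by (force simp: lab_rel_def Field_def)

lemma riso_lab_rel:
  assumes R: "realisation \<A> R" and inj: "inj_on (rho R) (carr R)"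
  shows "riso (rho R) R (lrel (lab_rel R))"
  using inj by (simp add: riso_def bij_betw_def Field_lab_rel[OF R] lab_rel_inj_iff[OF assms])

lemma lab_rel_riso:
  assumes R: "realisation \<A> R" and S: "realisation \<A> S" and h: "riso h R S"
  shows "lab_rel S = lab_rel R"
proof -
  have im: "carr S = h ` carr R"
    and ord: "\<And>a b. a \<in> carr R \<Longrightarrow> b \<in> carr R \<Longrightarrow> (a, b) \<in> ord R \<longleftrightarrow> (h a, h b) \<in> ord S"
    and lab: "\<And>a. a \<in> carr R \<Longrightarrow> rho S (h a) = rho R a"
    using h by (auto simp: riso_def bij_betw_def)
  have "lab_rel S = {(rho S u, rho S v) |u v. u \<in> carr S \<and> v \<in> carr S \<and> (u, v) \<in> ord S}"
    using realisation_order(1)[OF S] by (simp add: set_eq_iff lab_rel_iff) blast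
  also have "\<dots> = {(rho R a, rho R b) |a b. a \<in> carr R \<and> b \<in> carr R \<and> (a, b) \<in> ord R}"
    unfolding im using ord lab by (simp add: set_eq_iff image_iff) metis
  also have "\<dots> = lab_rel R"
    using realisation_order(1)[OF R] by (simp add: set_eq_iff lab_rel_iff) blast
  finally show ?thesis .
qed

lemma lab_rel_lrel: "lab_rel (lrel k) = k"
  by (force simp: lab_rel_def)

lemma partial_order_lab_rel:
  assumes R: "realisation \<A> R" and inj: "inj_on (rho R) (carr R)"
  shows "partial_order_on (Field (lab_rel R)) (lab_rel R)"
proof (rule partial_orderI)
  note o = realisation_order[OF R] and F = Field_lab_rel[OF R]
  note ord = lab_rel_inj_iff[OF R inj]
  show sub: "lab_rel R \<subseteq> Field (lab_rel R) \<times> Field (lab_rel R)" by (auto simp: Field_def)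
  show "(a, a) \<in> lab_rel R" if "a \<in> Field (lab_rel R)" for a
    using that o(2) ord unfolding F by auto
  have dest: "\<exists>u v. a = rho R u \<and> b = rho R v \<and> u \<in> carr R \<and> v \<in> carr R"
    if "(a, b) \<in> lab_rel R" for a b
    using that sub unfolding F by blast
  show "(a, c) \<in> lab_rel R" if ab: "(a, b) \<in> lab_rel R" "(b, c) \<in> lab_rel R" for a b c
  proof -
    obtain u v w where "a = rho R u" "b = rho R v" "c = rho R w" "u \<in> carr R" "v \<in> carr R" "w \<in> carr R"
      using dest[OF ab(1)] dest[OF ab(2)] by blast
    then show ?thesis using ab ord o(3)[of u v w] by simp
  qed
  show "a = b" if ab: "(a, b) \<in> lab_rel R" "(b, a) \<in> lab_rel R" for a b
  proof -
    obtain u v where "a = rho R u" "b = rho R v" "u \<in> carr R" "v \<in> carr R"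
      using dest[OF ab(1)] by blast
    then show ?thesis using ab ord o(4)[of u v] by simp
  qed
qed

lemma lab_rel_in_primes:
  assumes R: "tight \<A> R" and inj: "inj_on (rho R) (carr R)" and top: "is_top R t"
  shows "lab_rel R \<in> primes \<A>"
proof -
  have rR: "realisation \<A> R" using R by (simp add: tight_def)
  note h = riso_lab_rel[OF rR inj]
  have "tight \<A> (lrel (lab_rel R))"
    using tight_riso[OF h R] partial_order_lab_rel[OF rR inj] by simp
  then show ?thesis using is_top_riso[OF h top] unfolding primes_def by blast
qed

lemma lab_rel_rrestr:
  assumes R: "realisation \<A> R" and inj: "inj_on (rho R) (carr R)" and r: "r \<in> carr R"
  shows "lab_rel (rrestr R r) = below (lab_rel R) (rho R r)" (is "?L = ?R")
proof -
  have un: "under (lab_rel R) (rho R r) = rho R ` rdown R r"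
    using riso_rdown[OF riso_lab_rel[OF R inj] r] by (simp add: rdown_lrel)
  have sub: "rdown R r \<subseteq> carr R" by (auto simp: rdown_def)
  show ?thesis
  proof (rule set_eqI)
    fix x :: "'a \<times> 'a"
    obtain e e' where x: "x = (e, e')" by (cases x)
    have "x \<in> ?L \<longleftrightarrow>
        (\<exists>u v. e = rho R u \<and> e' = rho R v \<and> u \<in> rdown R r \<and> v \<in> rdown R r \<and> (u, v) \<in> ord R)"
      unfolding x lab_rel_iff by auto
    also have "\<dots> \<longleftrightarrow>
        (\<exists>u v. e = rho R u \<and> e' = rho R v \<and> u \<in> rdown R r \<and> v \<in> rdown R r \<and> (e, e') \<in> lab_rel R)"
      using lab_rel_inj_iff[OF R inj] sub by blast
    also have "\<dots> \<longleftrightarrow> x \<in> ?R"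
      unfolding below_def un x by auto
    finally show "x \<in> ?L \<longleftrightarrow> x \<in> ?R" .
  qed
qed

lemma ltop_lab_rel:
  assumes R: "tight \<A> R" and inj: "inj_on (rho R) (carr R)" and top: "is_top R t"
  shows "ltop (lab_rel R) = rmax R"
proof -
  have rR: "realisation \<A> R" using R by (simp add: tight_def)
  have "realisation \<A> (lrel (lab_rel R))"
    using lab_rel_in_primes[OF assms] by (auto simp: primes_def tight_def)
  then show ?thesis unfolding ltop_def using rmax_riso[OF riso_lab_rel[OF rR inj] top rR] by simp
qed

text \<open>Both realisations are isomorphic to \<open>lrel\<close> of the common relation. Together
  with the invariance of \<open>lab_rel\<close> under isomorphism this makes it a complete invariant
  of injectively labelled realisations.\<close>

lemma riso_of_lab_rel_eq:
  assumes R: "realisation \<A> R" "inj_on (rho R) (carr R)"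
    and S: "realisation \<A> S" "inj_on (rho S) (carr S)" and eq: "lab_rel R = lab_rel S"
  shows "\<exists>h. riso h R S"
  using riso_trans[OF riso_lab_rel[OF R] riso_sym[OF riso_lab_rel[OF S, folded eq]]] by blast

text \<open>Representatives of isomorphism classes are taken over \<open>nat\<close>, so a relation
  on labels has to be copied there. Its field is the down-set of its top, hence finite, and embeds
  into \<open>nat\<close>; the inverse of the embedding serves as labelling.\<close>

lemma primes_nat_realisation:
  assumes k: "k \<in> primes \<A>"
  shows "\<exists>(R :: (nat, 'e) realisation) t. tight \<A> R \<and> is_top R t \<and> inj_on (rho R) (carr R) \<and>
    lab_rel R = (k :: 'e rel)"
proof -
  from k obtain t where t: "tight \<A> (lrel k)" "is_top (lrel k) t" by (auto simp: primes_def)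
  have rk: "realisation \<A> (lrel k)" using t by (simp add: tight_def)
  note o = realisation_order[OF rk, simplified]
  have "finite (Field k)" using finite_carr_top[OF rk t(2)] by simp
  then obtain g :: "'e \<Rightarrow> nat" where g: "inj_on g (Field k)"
    using finite_imp_inj_to_nat_seg by blast
  define R where "R = \<lparr>carr = g ` Field k, ord = map_prod g g ` k, rho = inv_into (Field k) g\<rparr>"
  have gk: "(a, b) \<in> k \<longleftrightarrow> (g a, g b) \<in> map_prod g g ` k" if "a \<in> Field k" "b \<in> Field k" for a b
  proof
    assume "(g a, g b) \<in> map_prod g g ` k"
    then obtain u v where uv: "(u, v) \<in> k" "g a = g u" "g b = g v" by auto
    then have "u \<in> Field k" "v \<in> Field k" by (auto simp: Field_def)
    then have "a = u" "b = v" using uv g that by (auto dest: inj_onD)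
    then show "(a, b) \<in> k" using uv by simp
  qed force
  have h: "riso g (lrel k) R"
    using g gk by (simp add: riso_def R_def bij_betw_def)
  have "partial_order_on (carr R) (ord R)"
  proof (rule partial_orderI)
    show "ord R \<subseteq> carr R \<times> carr R" by (auto simp: R_def Field_def)
    show "(a, a) \<in> ord R" if "a \<in> carr R" for a
      using that o(2) by (force simp: R_def)
    have dest: "\<exists>u v. a = g u \<and> b = g v \<and> (u, v) \<in> k \<and> u \<in> Field k \<and> v \<in> Field k"
      if "(a, b) \<in> ord R" for a b
      using that by (force simp: R_def Field_def)
    show "(a, c) \<in> ord R" if ab: "(a, b) \<in> ord R" "(b, c) \<in> ord R" for a b c
    proof -
      obtain u v w where *: "a = g u" "c = g w" "(u, v) \<in> k" "(v, w) \<in> k"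
        using dest[OF ab(1)] dest[OF ab(2)] g unfolding inj_on_def by metis
      then have "(u, w) \<in> k" using o(3) by blast
      then show ?thesis using * by (auto simp: R_def)
    qed
    show "a = b" if "(a, b) \<in> ord R" "(b, a) \<in> ord R" for a b
      using dest[OF that(1)] dest[OF that(2)] g o(4) unfolding inj_on_def by metis
  qed
  then have R: "tight \<A> R" using tight_riso[OF h t(1)] by blast
  then have "lab_rel R = k"
    using lab_rel_riso[OF rk _ h] by (simp add: lab_rel_lrel tight_def)
  moreover have "inj_on (rho R) (carr R)"
    by (simp add: R_def inj_on_inv_into)
  ultimately show ?thesis using R is_top_riso[OF h t(2)] by blast
qed

lemma primesD:
  assumes "k \<in> primes \<A>"
  shows "tight \<A> (lrel k)" "realisation \<A> (lrel k)" "is_top (lrel k) (ltop k)"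
proof -
  obtain t where t: "tight \<A> (lrel k)" "is_top (lrel k) t"
    using assms by (auto simp: primes_def)
  then show "tight \<A> (lrel k)" "realisation \<A> (lrel k)" by (auto simp: tight_def)
  then show "is_top (lrel k) (ltop k)"
    using rmax_eq[of \<A> "lrel k" t] t by (simp add: ltop_def)
qed

lemma primes_order:
  assumes "k \<in> primes \<A>"
  shows "e \<in> Field k \<Longrightarrow> (e, e) \<in> k"
    and "(a, b) \<in> k \<Longrightarrow> (b, c) \<in> k \<Longrightarrow> (a, c) \<in> k"
    and "(a, b) \<in> k \<Longrightarrow> (b, a) \<in> k \<Longrightarrow> a = b"
  using realisation_order(2-4)[OF primesD(2)[OF assms]] by simp_all

lemma primes_Field:
  assumes k: "k \<in> primes \<A>"
  shows "Field k \<in> \<A>" "finite (Field k)" "ltop k \<in> Field k" "under k (ltop k) = Field k"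
    "below k (ltop k) = k"
proof -
  note R = primesD(2)[OF k] and t = primesD(3)[OF k]
  show "Field k \<in> \<A>" using rclosed_image_in[OF R rclosed_carr] by simp
  show "finite (Field k)" using finite_carr_top[OF R t] by simp
  show "ltop k \<in> Field k" and u: "under k (ltop k) = Field k"
    using t by (auto simp: is_top_rdown rdown_lrel)
  show "below k (ltop k) = k" unfolding below_def u by (auto simp: Field_def)
qed

lemma primes_below:
  assumes k: "k \<in> primes \<A>" and e: "e \<in> Field k"
  shows "below k e \<in> primes \<A>" "ltop (below k e) = e" "Field (below k e) = under k e"
    "e' \<in> under k e \<Longrightarrow> below (below k e) e' = below k e'"
proof -
  note R = primesD(2)[OF k] and T = primesD(1)[OF k]
  have e': "e \<in> carr (lrel k)" using e by simp
  note rr = rrestr_lrel[OF R]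
  show "below k e \<in> primes \<A>"
    using tight_rrestr[OF T e'] is_top_rrestr[OF R e'] unfolding rr primes_def by blast
  show "ltop (below k e) = e"
    using rmax_rrestr[OF T e'] unfolding rr ltop_def by simp
  show F: "Field (below k e) = under k e" using Field_below[OF R] .
  have "realisation \<A> (lrel (below k e))"
    using tight_rrestr[OF T e'] unfolding rr by (simp add: tight_def)
  then show "below (below k e) e' = below k e'" if "e' \<in> under k e"
    using rrestr_rrestr[OF R, of e' e] that
    by (metis rr rrestr_lrel rdown_lrel lrel_simps(2))
qed

lemma primes_Field_subset:
  assumes "k \<in> primes \<A>" and "e \<in> Field k"
  shows "Field (below k e) \<subseteq> Field k"
  unfolding primes_below(3)[OF assms] by (auto simp: under_def Field_def)

section \<open>The ese formed by the canonical prime relations\<close>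

definition prime_ese :: "'e set set \<Rightarrow> 'e rel ese" where
  "prime_ese \<A> =
     \<lparr> events = primes \<A>,
       leq = {(k', k). k' \<in> primes \<A> \<and> k \<in> primes \<A> \<and> (\<exists>e\<in>Field k. k' = below k e)},
       con = {X. X \<subseteq> primes \<A> \<and> finite X \<and> \<Union>(Field ` X) \<in> \<A>},
       eqv = {(k, k'). k \<in> primes \<A> \<and> k' \<in> primes \<A> \<and> ltop k = ltop k'} \<rparr>"

lemma prime_ese_simps [simp]:
  "events (prime_ese \<A>) = primes \<A>"
  "leq (prime_ese \<A>) = {(k', k). k' \<in> primes \<A> \<and> k \<in> primes \<A> \<and> (\<exists>e\<in>Field k. k' = below k e)}"
  "con (prime_ese \<A>) = {X. X \<subseteq> primes \<A> \<and> finite X \<and> \<Union>(Field ` X) \<in> \<A>}"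
  "eqv (prime_ese \<A>) = {(k, k'). k \<in> primes \<A> \<and> k' \<in> primes \<A> \<and> ltop k = ltop k'}"
  by (simp_all add: prime_ese_def)

text \<open>Bounded completeness makes consistency closed under subsets: the fields of the relations
  in a smaller set are members of \<open>\<A>\<close>, bounded by the union of fields of the larger
  one. The ese axioms are transported from here to \<open>edc_of G\<close>, so that an isomorphism
  given through configurations can be unfolded into relations.\<close>

lemma ese_prime_ese:
  assumes bc: "bounded_complete \<A>" and empty: "{} \<in> \<A>"
  shows "ese (prime_ese \<A>)"
proof -
  have po: "partial_order_on (events (prime_ese \<A>)) (leq (prime_ese \<A>))"
  proof (rule partial_orderI)
    show "leq (prime_ese \<A>) \<subseteq> events (prime_ese \<A>) \<times> events (prime_ese \<A>)" by auto
    show "(k, k) \<in> leq (prime_ese \<A>)" if "k \<in> events (prime_ese \<A>)" for k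
      using that primes_Field(3,5)[of k \<A>] by auto
    show "(a, c) \<in> leq (prime_ese \<A>)"
      if ab: "(a, b) \<in> leq (prime_ese \<A>)" "(b, c) \<in> leq (prime_ese \<A>)" for a b c
    proof -
      obtain e e' where e: "e \<in> Field b" "a = below b e" "e' \<in> Field c" "b = below c e'"
        and c: "a \<in> primes \<A>" "c \<in> primes \<A>" using ab by auto
      have "e \<in> under c e'" using e primes_below(3)[OF c(2) e(3)] by simp
      then have "a = below c e" "e \<in> Field c"
        using e primes_below(4)[OF c(2) e(3)] by (auto simp: under_def Field_def)
      then show ?thesis using c by auto
    qed
    show "a = b" if ab: "(a, b) \<in> leq (prime_ese \<A>)" "(b, a) \<in> leq (prime_ese \<A>)" for a b
    proof -
      have p: "a \<in> primes \<A>" "b \<in> primes \<A>" using ab(1) by simp_all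
      obtain e where e: "e \<in> Field b" "a = below b e" using ab(1) by auto
      obtain e' where e': "e' \<in> Field a" "b = below a e'" using ab(2) by auto
      have "Field b \<subseteq> Field a" using primes_Field_subset[OF p(1) e'(1)] unfolding e'(2)[symmetric] .
      moreover have "Field a \<subseteq> Field b" using primes_Field_subset[OF p(2) e(1)] unfolding e(2)[symmetric] .
      \<comment> \<open>Mutual restriction makes the two fields equal, so \<open>e\<close> lies
        above everything in \<open>b\<close>, including its top; hence \<open>e\<close> is the top,
        and restricting to it changes nothing.\<close>
      moreover have "under b e = Field a" using primes_below(3)[OF p(2) e(1)] unfolding e(2)[symmetric] by simp
      ultimately have "under b e = Field b" by simp
      then have "(ltop b, e) \<in> b" using primes_Field(3)[OF p(2)] by (auto simp: under_def)
      moreover have "(e, ltop b) \<in> b" using primes_Field(4)[OF p(2)] e(1) by (auto simp: under_def)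
      ultimately have "e = ltop b" using primes_order(3)[OF p(2)] by blast
      then show ?thesis using e primes_Field(5)[OF p(2)] by simp
    qed
  qed
  have "finite (down (prime_ese \<A>) k)" if "k \<in> primes \<A>" for k
    by (rule finite_subset[of _ "below k ` Field k"])
      (use primes_Field(2)[OF that] in \<open>auto simp: down_def\<close>)
  moreover have "{k} \<in> con (prime_ese \<A>)" if "k \<in> primes \<A>" for k
    using that primes_Field(1) by auto
  moreover have "Y \<in> con (prime_ese \<A>)" if X: "X \<in> con (prime_ese \<A>)" and Y: "Y \<subseteq> X" for X Y
  proof -
    have "Field ` Y \<subseteq> \<A>" using X Y primes_Field(1) by auto
    moreover have "\<Union>(Field ` Y) \<subseteq> \<Union>(Field ` X)" using Y by blast
    ultimately have "\<Union>(Field ` Y) \<in> \<A>"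
      using X bc unfolding bounded_complete_def by auto
    then show ?thesis using X Y by (auto intro: finite_subset)
  qed
  moreover have "X \<union> {k} \<in> con (prime_ese \<A>)"
    if X: "X \<in> con (prime_ese \<A>)" and k: "k' \<in> X" "(k, k') \<in> leq (prime_ese \<A>)" for X k k'
  proof -
    obtain e where "e \<in> Field k'" "k = below k' e" "k' \<in> primes \<A>" using k(2) by auto
    then have "Field k \<subseteq> Field k'" using primes_Field_subset by metis
    then have "\<Union>(Field ` (X \<union> {k})) = \<Union>(Field ` X)" using k(1) by auto
    then show ?thesis using X k by auto
  qed
  moreover have "{} \<in> con (prime_ese \<A>)" using empty by simp
  moreover have "\<forall>X\<in>con (prime_ese \<A>). finite X \<and> X \<subseteq> events (prime_ese \<A>)" by simp
  ultimately have "prime_es (prime_ese \<A>)"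
    using po unfolding prime_es_def prime_ese_simps(1) by blast
  moreover have "equiv (events (prime_ese \<A>)) (eqv (prime_ese \<A>))"
    by (auto simp: equiv_def refl_on_def sym_def trans_def)
  ultimately show ?thesis by (simp add: ese_def)
qed

section \<open>Isomorphisms of ese's as relational isomorphisms\<close>

definition siso :: "('p \<Rightarrow> 'q) \<Rightarrow> 'p ese \<Rightarrow> 'q ese \<Rightarrow> bool" where
  "siso h P Q \<longleftrightarrow> bij_betw h (events P) (events Q) \<and>
     (\<forall>p\<in>events P. \<forall>q\<in>events P. (p, q) \<in> leq P \<longleftrightarrow> (h p, h q) \<in> leq Q) \<and>
     (\<forall>X. X \<subseteq> events P \<longrightarrow> (X \<in> con P \<longleftrightarrow> h ` X \<in> con Q)) \<and>
     (\<forall>p\<in>events P. \<forall>q\<in>events P. (p, q) \<in> eqv P \<longleftrightarrow> (h p, h q) \<in> eqv Q)"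

lemma siso_sym:
  assumes h: "siso h P Q" shows "siso (inv_into (events P) h) Q P"
proof -
  let ?g = "inv_into (events P) h"
  have b: "bij_betw h (events P) (events Q)" using h by (simp add: siso_def)
  have g: "?g q \<in> events P" "h (?g q) = q" if "q \<in> events Q" for q
    using b that by (auto simp: bij_betw_def inv_into_into f_inv_into_f)
  have "h ` ?g ` X = X" if "X \<subseteq> events Q" for X
    using g that by (force simp: image_image)
  moreover have "?g ` X \<subseteq> events P" if "X \<subseteq> events Q" for X using g that by auto
  ultimately show ?thesis
    using h g bij_betw_inv_into[OF b] unfolding siso_def by simp
qed

lemma siso_trans:
  assumes h: "siso h P Q" and g: "siso g Q R" shows "siso (g \<circ> h) P R"
proof -
  have "h ` events P = events Q" using h by (simp add: siso_def bij_betw_def)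
  then have *: "h p \<in> events Q" if "p \<in> events P" for p using that by auto
  have "X \<in> con P \<longleftrightarrow> (g \<circ> h) ` X \<in> con R" if X: "X \<subseteq> events P" for X
  proof -
    have "h ` X \<subseteq> events Q" using X * by auto
    then show ?thesis using h g X unfolding siso_def image_comp[symmetric] by simp
  qed
  moreover have "bij_betw (g \<circ> h) (events P) (events R)"
    using h g by (auto simp only: siso_def intro: bij_betw_trans)
  ultimately show ?thesis using h g * unfolding siso_def by simp
qed

text \<open>The inclusions for \<open>P\<close> are assumed because \<open>siso\<close> does not see
  pairs or sets that reach outside \<open>events P\<close>.\<close>

lemma siso_ese:
  assumes h: "siso h P Q" and Q: "ese Q"
    and P: "leq P \<subseteq> events P \<times> events P" "con P \<subseteq> Pow (events P)" "eqv P \<subseteq> events P \<times> events P"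
  shows "ese P"
proof -
  have bij: "h ` events P = events Q" "inj_on h (events P)"
    and leq: "\<And>p q. p \<in> events P \<Longrightarrow> q \<in> events P \<Longrightarrow> (p, q) \<in> leq P \<longleftrightarrow> (h p, h q) \<in> leq Q"
    and con: "\<And>X. X \<subseteq> events P \<Longrightarrow> X \<in> con P \<longleftrightarrow> h ` X \<in> con Q"
    and eqv: "\<And>p q. p \<in> events P \<Longrightarrow> q \<in> events P \<Longrightarrow> (p, q) \<in> eqv P \<longleftrightarrow> (h p, h q) \<in> eqv Q"
    using h by (auto simp: siso_def bij_betw_def)
  have hQ: "h p \<in> events Q" if "p \<in> events P" for p using bij that by auto
  have Qes: "partial_order_on (events Q) (leq Q)" "con Q \<noteq> {}"
    "\<And>X. X \<in> con Q \<Longrightarrow> finite X"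
    "\<And>p. p \<in> events Q \<Longrightarrow> finite (down Q p)"
    "\<And>p. p \<in> events Q \<Longrightarrow> {p} \<in> con Q"
    "\<And>X Y. X \<in> con Q \<Longrightarrow> Y \<subseteq> X \<Longrightarrow> Y \<in> con Q"
    "\<And>X p p'. X \<in> con Q \<Longrightarrow> p' \<in> X \<Longrightarrow> p \<in> events Q \<Longrightarrow> (p, p') \<in> leq Q \<Longrightarrow> X \<union> {p} \<in> con Q"
    and Qeq: "equiv (events Q) (eqv Q)"
    using Q unfolding ese_def prime_es_def by simp_all
  have conP: "X \<subseteq> events P" if "X \<in> con P" for X using P(2) that by auto
  have fin: "finite X" if "finite (h ` X)" "X \<subseteq> events P" for X
    using that bij(2) by (meson finite_imageD inj_on_subset)
  have po: "partial_order_on (events P) (leq P)"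
  proof (rule partial_orderI[OF P(1)])
    show "(a, a) \<in> leq P" if "a \<in> events P" for a
      using that leq hQ Qes(1) by (auto simp: partial_order_on_def preorder_on_def refl_on_def)
    show "(a, c) \<in> leq P" if "(a, b) \<in> leq P" "(b, c) \<in> leq P" for a b c
    proof -
      have "a \<in> events P" "b \<in> events P" "c \<in> events P" using that P(1) by auto
      then show ?thesis
        using that leq Qes(1) unfolding partial_order_on_def preorder_on_def by (meson transE)
    qed
    show "a = b" if "(a, b) \<in> leq P" "(b, a) \<in> leq P" for a b
    proof -
      have ab: "a \<in> events P" "b \<in> events P" using that P(1) by auto
      then have "h a = h b"
        using that leq Qes(1) unfolding partial_order_on_def by (meson antisymD)
      then show ?thesis using ab bij(2) by (meson inj_onD)
    qed
  qed
  have "prime_es P"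
    unfolding prime_es_def
  proof (intro conjI ballI allI impI po)
    have "{} \<in> con Q" using Qes(2,6) by blast
    then show "con P \<noteq> {}" using con[of "{}"] by auto
    show "finite X" "X \<subseteq> events P" if "X \<in> con P" for X
      using that conP con Qes(3) fin by (metis, metis)
    show "finite (down P p)" if p: "p \<in> events P" for p
    proof (rule fin)
      have "h ` down P p \<subseteq> down Q (h p)" using p leq hQ by (auto simp: down_def)
      then show "finite (h ` down P p)" using Qes(4)[OF hQ[OF p]] finite_subset by blast
    qed (auto simp: down_def)
    show "{p} \<in> con P" if "p \<in> events P" for p using that con[of "{p}"] Qes(5) hQ by simp
    show "Y \<in> con P" if "X \<in> con P" "Y \<subseteq> X" for X Y
      using that con conP Qes(6) by (meson image_mono order_trans)
    show "X \<union> {p} \<in> con P" if *: "X \<in> con P" "p' \<in> X" "p \<in> events P" "(p, p') \<in> leq P" for X p' p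
    proof -
      have "h ` X \<union> {h p} \<in> con Q"
      proof (rule Qes(7))
        show "h ` X \<in> con Q" using * con conP by blast
        show "h p' \<in> h ` X" using * by blast
        show "h p \<in> events Q" using * hQ by blast
        show "(h p, h p') \<in> leq Q" using *(3,4) leq conP[OF *(1)] *(2) by blast
      qed
      then show ?thesis using con[of "X \<union> {p}"] conP[OF *(1)] *(3) by simp
    qed
  qed
  moreover have "equiv (events P) (eqv P)"
  proof (rule equivI[OF P(3)])
    show "refl_on (events P) (eqv P)"
      using eqv hQ Qeq by (auto simp: refl_on_def equiv_def)
    show "sym (eqv P)"
      using eqv P(3) Qeq unfolding sym_def equiv_def by blast
    show "trans (eqv P)"
    proof (rule transI)
      fix a b c assume *: "(a, b) \<in> eqv P" "(b, c) \<in> eqv P"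
      then have "a \<in> events P" "b \<in> events P" "c \<in> events P" using P(3) by auto
      then show "(a, c) \<in> eqv P" using * eqv Qeq unfolding equiv_def by (meson transE)
    qed
  qed
  ultimately show ?thesis by (simp add: ese_def)
qed

section \<open>Down-sets and finite configurations of prime event structures\<close>

lemma prime_esD:
  assumes "prime_es P"
  shows "leq P \<subseteq> events P \<times> events P" "p \<in> events P \<Longrightarrow> (p, p) \<in> leq P"
    "(a, b) \<in> leq P \<Longrightarrow> (b, c) \<in> leq P \<Longrightarrow> (a, c) \<in> leq P"
    "(a, b) \<in> leq P \<Longrightarrow> (b, a) \<in> leq P \<Longrightarrow> a = b"
    "X \<in> con P \<Longrightarrow> finite X" "X \<in> con P \<Longrightarrow> X \<subseteq> events P" "p \<in> events P \<Longrightarrow> finite (down P p)"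
    "p \<in> events P \<Longrightarrow> {p} \<in> con P" "X \<in> con P \<Longrightarrow> Y \<subseteq> X \<Longrightarrow> Y \<in> con P"
    "X \<in> con P \<Longrightarrow> p' \<in> X \<Longrightarrow> (p, p') \<in> leq P \<Longrightarrow> X \<union> {p} \<in> con P"
    "{} \<in> con P"
proof -
  have *: "partial_order_on (events P) (leq P)" "con P \<noteq> {}"
    "\<forall>X\<in>con P. finite X \<and> X \<subseteq> events P" "\<forall>p\<in>events P. finite (down P p)"
    "\<forall>p\<in>events P. {p} \<in> con P" "\<forall>X\<in>con P. \<forall>Y. Y \<subseteq> X \<longrightarrow> Y \<in> con P"
    "\<forall>X\<in>con P. \<forall>p'\<in>X. \<forall>p\<in>events P. (p, p') \<in> leq P \<longrightarrow> X \<union> {p} \<in> con P"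
    using assms by (simp_all add: prime_es_def)
  show sub: "leq P \<subseteq> events P \<times> events P"
    using *(1) by (simp add: partial_order_on_def preorder_on_def)
  show "p \<in> events P \<Longrightarrow> (p, p) \<in> leq P"
    using *(1) by (simp add: partial_order_on_def preorder_on_def refl_on_def)
  show "(a, b) \<in> leq P \<Longrightarrow> (b, c) \<in> leq P \<Longrightarrow> (a, c) \<in> leq P"
    using *(1) unfolding partial_order_on_def preorder_on_def by (meson transE)
  show "(a, b) \<in> leq P \<Longrightarrow> (b, a) \<in> leq P \<Longrightarrow> a = b"
    using *(1) unfolding partial_order_on_def by (meson antisymD)
  show "X \<in> con P \<Longrightarrow> finite X" "X \<in> con P \<Longrightarrow> X \<subseteq> events P" "p \<in> events P \<Longrightarrow> finite (down P p)"
    "p \<in> events P \<Longrightarrow> {p} \<in> con P" "X \<in> con P \<Longrightarrow> Y \<subseteq> X \<Longrightarrow> Y \<in> con P"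
    using * by blast+
  show "{} \<in> con P" using *(2,6) by blast
  show "X \<in> con P \<Longrightarrow> p' \<in> X \<Longrightarrow> (p, p') \<in> leq P \<Longrightarrow> X \<union> {p} \<in> con P"
    using *(7) sub by blast
qed

lemma down_subset_events: "down P p \<subseteq> events P" and sdown_subset_down: "sdown P p \<subseteq> down P p"
  by (auto simp: down_def sdown_def)

lemma down_refl: "prime_es P \<Longrightarrow> p \<in> events P \<Longrightarrow> p \<in> down P p"
  using prime_esD(2)[of P p] by (simp add: down_def)

lemma down_subset:
  assumes "prime_es P" "p \<in> down P q" shows "down P p \<subseteq> down P q"
  using prime_esD(3)[OF assms(1), of _ p q] assms(2) by (auto simp: down_def)

lemma dclosed_down: "prime_es P \<Longrightarrow> dclosed P (down P p)"
  using prime_esD(3)[of P _ _ p] unfolding down_closed_def down_def by blast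

lemma con_Un_down:
  assumes P: "prime_es P" and X: "X \<in> con P" and "finite Y" "Y \<subseteq> (\<Union>p\<in>X. down P p)"
  shows "X \<union> Y \<in> con P"
  using assms(3,4)
proof (induction Y)
  case (insert y Y)
  then obtain p where p: "p \<in> X" "(y, p) \<in> leq P" by (auto simp: down_def)
  then have "(X \<union> Y) \<union> {y} \<in> con P"
    using prime_esD(10)[OF P, of "X \<union> Y" p y] insert by auto
  then show ?case by (simp add: Un_commute)
qed (use X in simp)

lemma down_closure_configuration:
  assumes P: "prime_es P" and X: "X \<in> con P"
  shows "(\<Union>p\<in>X. down P p) \<in> fin_configurations P"
proof -
  have "dclosed P (\<Union>p\<in>X. down P p)"
    using dclosed_down[OF P] unfolding down_closed_def by blast
  moreover have "Y \<in> con P" if "finite Y" "Y \<subseteq> (\<Union>p\<in>X. down P p)" for Y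
    using con_Un_down[OF P X that] prime_esD(9)[OF P] by blast
  moreover have "finite (\<Union>p\<in>X. down P p)"
    using prime_esD(5,6,7)[OF P] X by blast
  ultimately show ?thesis by (simp add: fin_configurations_def configurations_def)
qed

lemma fin_configuration_iff:
  assumes P: "prime_es P"
  shows "x \<in> fin_configurations P \<longleftrightarrow> dclosed P x \<and> x \<in> con P"
  using prime_esD(5)[OF P, of x] prime_esD(9)[OF P, of x]
  by (auto simp: fin_configurations_def configurations_def)

lemma down_fin_configuration:
  assumes "prime_es P" "p \<in> events P" shows "down P p \<in> fin_configurations P"
  using down_closure_configuration[OF assms(1) prime_esD(8)[OF assms]] by simp

text \<open>Order and consistency can be read off the configurations. A consistent set lies in a
  configuration, its down-closure, and finite subsets of configurations are consistent. The image of
  \<open>down P q\<close> is down-closed, so it contains \<open>f p\<close> whenever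
  \<open>f p\<close> lies below \<open>f q\<close>. Applied to \<open>f\<close> and to its inverse,
  the two implications become equivalences.\<close>

lemma configuration_image_imp:
  assumes P: "prime_es P" and Q: "prime_es Q" and bij: "bij_betw f (events P) (events Q)"
    and PQ: "\<forall>x\<in>configurations P. f ` x \<in> configurations Q"
  shows "X \<in> con P \<Longrightarrow> f ` X \<in> con Q"
    and "p \<in> events P \<Longrightarrow> q \<in> events P \<Longrightarrow> (f p, f q) \<in> leq Q \<Longrightarrow> (p, q) \<in> leq P"
proof -
  show "f ` X \<in> con Q" if X: "X \<in> con P"
  proof -
    have "f ` (\<Union>p\<in>X. down P p) \<in> configurations Q"
      using down_closure_configuration[OF P X] PQ by (simp add: fin_configurations_def)
    moreover have "X \<subseteq> (\<Union>p\<in>X. down P p)"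
      using prime_esD(2,6)[OF P] X by (auto simp: down_def)
    moreover have "finite X" using prime_esD(5)[OF P X] .
    ultimately show ?thesis
      unfolding configurations_def by (simp add: image_mono)
  qed
  show "(p, q) \<in> leq P" if p: "p \<in> events P" and q: "q \<in> events P" and le: "(f p, f q) \<in> leq Q"
  proof -
    have "f ` down P q \<in> configurations Q"
      using down_fin_configuration[OF P q] PQ by (simp add: fin_configurations_def)
    moreover have "f q \<in> f ` down P q" using q prime_esD(2)[OF P] by (auto simp: down_def)
    moreover have "f p \<in> events Q" using le prime_esD(1)[OF Q] by auto
    ultimately have "f p \<in> f ` down P q"
      using le unfolding configurations_def down_closed_def mem_Collect_eq by metis
    moreover have "down P q \<subseteq> events P" by (auto simp: down_def)
    ultimately have "p \<in> down P q"
      using inj_on_image_mem_iff[OF bij_betw_imp_inj_on[OF bij] p] by blast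
    then show ?thesis by (simp add: down_def)
  qed
qed

lemma ese_iso_imp_siso:
  assumes P: "ese P" and Q: "ese Q" and iso: "ese_iso P Q"
  shows "\<exists>h. siso h P Q"
proof -
  obtain f where bij: "bij_betw f (events P) (events Q)"
    and F: "ese_map P Q ((\<lambda>p. Some (f p)) |` events P)"
    and G: "ese_map Q P ((\<lambda>q. Some (inv_into (events P) f q)) |` events Q)"
    using iso by (auto simp: ese_iso_def)
  define g where "g = inv_into (events P) f"
  have pP: "prime_es P" and pQ: "prime_es Q" using P Q by (auto simp: ese_def)
  have sub: "events P \<inter> x = x" if "x \<in> configurations P" for x
    using that by (auto simp: configurations_def down_closed_def)
  have PQ: "f ` x \<in> configurations Q" if "x \<in> configurations P" for x
    using F that sub[OF that] unfolding ese_map_def by (metis ran_restrict_Some)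
  have sub': "events Q \<inter> x = x" if "x \<in> configurations Q" for x
    using that by (auto simp: configurations_def down_closed_def)
  have QP: "g ` x \<in> configurations P" if "x \<in> configurations Q" for x
    using G that sub'[OF that] unfolding ese_map_def g_def by (metis ran_restrict_Some)
  have gbij: "bij_betw g (events Q) (events P)" using bij_betw_inv_into[OF bij] by (simp add: g_def)
  have gf: "g (f p) = p" if "p \<in> events P" for p
    using bij that by (simp add: g_def bij_betw_inv_into_left)
  have fQ: "f p \<in> events Q" if "p \<in> events P" for p using bij that by (simp add: bij_betwE)
  have "\<forall>x\<in>configurations P. f ` x \<in> configurations Q" using PQ by blast
  note 1 = configuration_image_imp[OF pP pQ bij this]
  have "\<forall>x\<in>configurations Q. g ` x \<in> configurations P" using QP by blast
  note 2 = configuration_image_imp[OF pQ pP gbij this]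
  have "(p, q) \<in> leq P \<longleftrightarrow> (f p, f q) \<in> leq Q" if "p \<in> events P" "q \<in> events P" for p q
    using 1(2)[OF that] 2(2)[of "f p" "f q"] that gf fQ by auto
  moreover have "X \<in> con P \<longleftrightarrow> f ` X \<in> con Q" if X: "X \<subseteq> events P" for X
  proof -
    have "g ` f ` X = X" using X gf by (force simp: image_image)
    then show ?thesis using 1(1)[of X] 2(1)[of "f ` X"] by auto
  qed
  moreover have "(p, q) \<in> eqv P \<longleftrightarrow> (f p, f q) \<in> eqv Q" if pq: "p \<in> events P" "q \<in> events P" for p q
  proof
    assume "(p, q) \<in> eqv P"
    then show "(f p, f q) \<in> eqv Q"
      using F pq unfolding ese_map_def by (simp add: restrict_map_def)
  next
    assume "(f p, f q) \<in> eqv Q"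
    then have "(g (f p), g (f q)) \<in> eqv P"
      using G fQ[OF pq(1)] fQ[OF pq(2)] unfolding ese_map_def g_def[symmetric] by (simp add: restrict_map_def)
    then show "(p, q) \<in> eqv P" using gf pq by simp
  qed
  ultimately show ?thesis using bij unfolding siso_def by blast
qed

lemma siso_imp_ese_map:
  assumes h: "siso h P Q"
  shows "ese_map P Q ((\<lambda>p. Some (h p)) |` events P)"
proof -
  have bij: "h ` events P = events Q" "inj_on h (events P)"
    and leq: "\<And>p q. p \<in> events P \<Longrightarrow> q \<in> events P \<Longrightarrow> (p, q) \<in> leq P \<longleftrightarrow> (h p, h q) \<in> leq Q"
    and con: "\<And>X. X \<subseteq> events P \<Longrightarrow> X \<in> con P \<longleftrightarrow> h ` X \<in> con Q"
    and eqv: "\<And>p q. p \<in> events P \<Longrightarrow> q \<in> events P \<Longrightarrow> (p, q) \<in> eqv P \<longleftrightarrow> (h p, h q) \<in> eqv Q"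
    using h by (auto simp: siso_def bij_betw_def)
  have im: "h ` x \<in> configurations Q" if x: "x \<in> configurations P" for x
  proof -
    have xP: "x \<subseteq> events P" and xd: "\<And>p q. p \<in> x \<Longrightarrow> q \<in> events P \<Longrightarrow> (q, p) \<in> leq P \<Longrightarrow> q \<in> x"
      and xc: "\<And>Y. finite Y \<Longrightarrow> Y \<subseteq> x \<Longrightarrow> Y \<in> con P"
      using x by (auto simp: configurations_def down_closed_def)
    have "dclosed Q (h ` x)"
      unfolding down_closed_def bij(1)[symmetric]
    proof (intro conjI ballI impI)
      show "h ` x \<subseteq> h ` events P" using xP by blast
      fix a b assume "a \<in> h ` x" "b \<in> h ` events P" and le: "(b, a) \<in> leq Q"
      then obtain p q where "p \<in> x" "a = h p" "q \<in> events P" "b = h q" by blast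
      then show "b \<in> h ` x" using xd[of p q] leq[of q p] le xP by blast
    qed
    moreover have "Z \<in> con Q" if Z: "finite Z" "Z \<subseteq> h ` x" for Z
    proof -
      obtain Y where Y: "Y \<subseteq> x" "finite Y" "Z = h ` Y" using Z by (meson finite_subset_image)
      then show ?thesis using xc con[of Y] xP by auto
    qed
    ultimately show ?thesis by (simp add: configurations_def)
  qed
  have "events P \<inter> x = x" if "x \<in> configurations P" for x
    using that by (auto simp: configurations_def down_closed_def)
  then have "ran ((\<lambda>p. Some (h p)) |` events P |` x) \<in> configurations Q" "x \<subseteq> events P"
    if "x \<in> configurations P" for x
    using im that unfolding ran_restrict_Some by auto
  moreover have "ran ((\<lambda>p. Some (h p)) |` events P) \<subseteq> events Q"
    unfolding ran_restrict_Some' using bij by simp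
  ultimately show ?thesis
    unfolding ese_map_def dom_restrict_Some restrict_Some_iff using eqv by (simp add: subset_iff)
qed

lemma siso_imp_ese_iso:
  assumes h: "siso h P Q" shows "ese_iso P Q"
proof -
  have "bij_betw h (events P) (events Q)" using h by (simp add: siso_def)
  then show ?thesis
    using siso_imp_ese_map[OF h] siso_imp_ese_map[OF siso_sym[OF h]] unfolding ese_iso_def by blast
qed

section \<open>The edc of a general event structure\<close>

text \<open>Every finite subset of the union is consistent because it lies in the bound
  \<open>c\<close>, and a securing sequence inside one member of \<open>S\<close> remains one inside
  the union.\<close>

lemma bounded_complete_gconfigurations: "bounded_complete (gconfigurations G)"
  unfolding bounded_complete_def
proof (intro allI impI, elim conjE)
  fix S c assume S: "S \<subseteq> gconfigurations G" and c: "c \<in> gconfigurations G" and sub: "\<Union>S \<subseteq> c"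
  have "\<Union>S \<subseteq> gevents G" "\<forall>Y. finite Y \<and> Y \<subseteq> \<Union>S \<longrightarrow> Y \<in> gcon G"
    using c sub by (auto simp: gconfigurations_def)
  moreover have "\<exists>es. es \<noteq> [] \<and> set es \<subseteq> \<Union>S \<and> last es = e \<and>
      (\<forall>i<length es. (set (take i es), es ! i) \<in> enables G)" if e: "e \<in> \<Union>S" for e
  proof -
    obtain a where a: "a \<in> S" "e \<in> a" using e by blast
    then have "a \<in> gconfigurations G" using S by blast
    then have "\<forall>e\<in>a. \<exists>es. es \<noteq> [] \<and> set es \<subseteq> a \<and> last es = e \<and>
        (\<forall>i<length es. (set (take i es), es ! i) \<in> enables G)" by (simp add: gconfigurations_def)
    then obtain es where "es \<noteq> []" "set es \<subseteq> a" "last es = e"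
      "\<forall>i<length es. (set (take i es), es ! i) \<in> enables G"
      using a(2) by metis
    then show ?thesis using a(1) by (intro exI[of _ es]) auto
  qed
  ultimately show "\<Union>S \<in> gconfigurations G" by (simp add: gconfigurations_def)
qed

lemma empty_gconfiguration: "general_es G \<Longrightarrow> {} \<in> gconfigurations G"
  by (auto simp: gconfigurations_def general_es_def)

lemma prime_extremal_iff:
  assumes "bounded_complete \<A>"
  shows "prime_extremal \<A> R \<longleftrightarrow> tight \<A> R \<and> (\<exists>t. is_top R t)"
  using extremal_imp_tight[OF assms, of R] tight_imp_extremal[of \<A> R]
  by (auto simp: prime_extremal_def)

section \<open>Chosen representatives of prime extremal realisations\<close>

definition ireps :: "'e set set \<Rightarrow> (nat, 'e) realisation set" where
  "ireps \<A> = {p \<in> prime_extremal_reps \<A>. inj_on (rho p) (carr p)}"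

context
  fixes \<A> :: "'e set set"
  assumes bc: "bounded_complete \<A>"
begin

abbreviation "reps \<equiv> prime_extremal_reps \<A>"

lemma tight_real_iso_iff: "tight \<A> R \<Longrightarrow> tight \<A> S \<Longrightarrow> real_iso R S \<longleftrightarrow> (\<exists>h. riso h R S)"
  using riso_imp_real_iso[of _ R S] real_iso_imp_riso[of \<A> R \<A> S] by (auto simp: tight_def)

lemma equiv_real_iso:
  "equiv {R :: (nat, 'e) realisation. prime_extremal \<A> R}
     {(R, S). prime_extremal \<A> R \<and> prime_extremal \<A> S \<and> real_iso R S}" (is "equiv ?C ?r")
proof (rule equivI)
  have iso: "(R, S) \<in> ?r \<longleftrightarrow> prime_extremal \<A> R \<and> prime_extremal \<A> S \<and> (\<exists>h. riso h R S)" for R S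
    using tight_real_iso_iff prime_extremal_iff[OF bc] by blast
  show "?r \<subseteq> ?C \<times> ?C" by auto
  show "refl_on ?C ?r" unfolding refl_on_def iso using riso_id by blast
  show "sym ?r" unfolding sym_def iso using riso_sym by blast
  show "trans ?r" unfolding trans_def iso using riso_trans by blast
qed

lemma reps_prime_extremal: "R \<in> reps \<Longrightarrow> prime_extremal \<A> R"
proof -
  assume "R \<in> reps"
  then obtain C where C: "C \<in> {R. prime_extremal \<A> R} //
      {(R, S). prime_extremal \<A> R \<and> prime_extremal \<A> S \<and> real_iso R S}" and R: "R = (SOME R. R \<in> C)"
    unfolding prime_extremal_reps_def by blast
  have "C \<noteq> {}" "C \<subseteq> {R. prime_extremal \<A> R}"
    using C in_quotient_imp_non_empty[OF equiv_real_iso] in_quotient_imp_subset[OF equiv_real_iso]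
    by blast+
  then show ?thesis unfolding R by (metis mem_Collect_eq some_in_eq subsetD)
qed

lemma repsD:
  assumes "R \<in> reps"
  shows "tight \<A> R" "realisation \<A> R" "\<exists>t. is_top R t"
  using reps_prime_extremal[OF assms] prime_extremal_iff[OF bc] by (auto simp: tight_def)

lemma reps_exists:
  fixes S :: "(nat, 'e) realisation"
  assumes S: "tight \<A> S" "is_top S t"
  shows "\<exists>R\<in>reps. \<exists>h. riso h S R"
proof -
  let ?r = "{(R :: (nat, 'e) realisation, S :: (nat, 'e) realisation). prime_extremal \<A> R \<and> prime_extremal \<A> S \<and> real_iso R S}"
  have pS: "prime_extremal \<A> S" using S prime_extremal_iff[OF bc] by blast
  have C: "?r `` {S} \<in> {R. prime_extremal \<A> R} // ?r" using pS by (intro quotientI) simp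
  define R where "R = (SOME R. R \<in> ?r `` {S})"
  have "R \<in> ?r `` {S}"
    using in_quotient_imp_non_empty[OF equiv_real_iso C] unfolding R_def some_in_eq .
  then have "prime_extremal \<A> R" "real_iso S R" by auto
  moreover have "R \<in> reps" unfolding prime_extremal_reps_def R_def using C by (rule imageI)
  ultimately show ?thesis
    using tight_real_iso_iff[OF S(1), of R] prime_extremal_iff[OF bc, of R] by blast
qed

lemma reps_iso_eq:
  assumes R: "R \<in> reps" and S: "S \<in> reps" and h: "riso h R S"
  shows "R = S"
proof -
  let ?r = "{(R :: (nat, 'e) realisation, S :: (nat, 'e) realisation). prime_extremal \<A> R \<and> prime_extremal \<A> S \<and> real_iso R S}"
  have ex: "\<exists>C. C \<in> {R. prime_extremal \<A> R} // ?r \<and> R = (SOME R. R \<in> C) \<and> R \<in> C" if "R \<in> reps" for R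
  proof -
    obtain C where C: "C \<in> {R. prime_extremal \<A> R} // ?r" and R: "R = (SOME R. R \<in> C)"
      using \<open>R \<in> reps\<close> unfolding prime_extremal_reps_def by blast
    have "(SOME R. R \<in> C) \<in> C"
      using in_quotient_imp_non_empty[OF equiv_real_iso C] by (simp add: some_in_eq)
    then show ?thesis using C R by blast
  qed
  obtain C where C: "C \<in> {R. prime_extremal \<A> R} // ?r" "R = (SOME R. R \<in> C)" "R \<in> C"
    using ex[OF R] by blast
  obtain D where D: "D \<in> {R. prime_extremal \<A> R} // ?r" "S = (SOME R. R \<in> D)" "S \<in> D"
    using ex[OF S] by blast
  have "(R, S) \<in> ?r"
    using reps_prime_extremal[OF R] reps_prime_extremal[OF S] riso_imp_real_iso[OF h] by blast
  then have "C = D" using quotient_eqI[OF equiv_real_iso C(1) D(1) C(3) D(3)] by simp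
  then show ?thesis using C D by simp
qed

lemma reps_rrestr:
  assumes R: "R \<in> reps" and r: "r \<in> carr R"
  shows "\<exists>q\<in>reps. real_le q R \<and> rmax q = rho R r \<and> (\<exists>h. riso h q (rrestr R r))"
proof -
  note T = repsD(1)[OF R]
  note T' = tight_rrestr[OF T r]
  have top: "is_top (rrestr R r) r" using is_top_rrestr[OF repsD(2)[OF R] r] .
  obtain q h where q: "q \<in> reps" "riso h (rrestr R r) q" using reps_exists[OF T' top] by blast
  obtain t where t: "is_top q t" using repsD(3)[OF q(1)] by blast
  have "real_le q R"
    using real_le_iff[OF T repsD(2)[OF q(1)] t] riso_sym[OF q(2)] r by blast
  moreover have "rmax q = rho R r"
    using rmax_riso[OF q(2) top _ repsD(2)[OF q(1)]] rmax_rrestr[OF T r] T' by (simp add: tight_def)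
  ultimately show ?thesis using q riso_sym by blast
qed

lemma reps_le:
  assumes R: "R \<in> reps" and q: "q \<in> reps" and le: "real_le q R"
  shows "\<exists>r\<in>carr R. rmax q = rho R r \<and> (\<exists>h. riso h q (rrestr R r))"
proof -
  note T = repsD(1)[OF R]
  obtain t where t: "is_top q t" using repsD(3)[OF q] by blast
  obtain r h where r: "r \<in> carr R" "riso h q (rrestr R r)"
    using real_le_iff[OF T repsD(2)[OF q] t] le by blast
  have "realisation \<A> (rrestr R r)" using tight_rrestr[OF T r(1)] by (simp add: tight_def)
  then have "rmax q = rho R r"
    using rmax_riso[OF r(2) t repsD(2)[OF q]] rmax_rrestr[OF T r(1)] by simp
  then show ?thesis using r by blast
qed

lemma reps_rmax_image:
  assumes R: "R \<in> reps" shows "rmax ` {q \<in> reps. real_le q R} = rho R ` carr R"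
proof
  show "rmax ` {q \<in> reps. real_le q R} \<subseteq> rho R ` carr R" using reps_le[OF R] by blast
  show "rho R ` carr R \<subseteq> rmax ` {q \<in> reps. real_le q R}"
  proof
    fix e assume "e \<in> rho R ` carr R"
    then obtain r where r: "r \<in> carr R" "e = rho R r" by blast
    then obtain q where "q \<in> reps" "real_le q R" "rmax q = e" using reps_rrestr[OF R r(1)] by blast
    then show "e \<in> rmax ` {q \<in> reps. real_le q R}" by blast
  qed
qed

text \<open>Up to isomorphism, the representatives below \<open>p\<close> are the principal
  down-sets of elements of \<open>p\<close>, and \<open>rmax\<close> reads off the label of the
  element. Distinct elements have non-isomorphic down-sets, so distinct equivalent events below
  \<open>p\<close> exist exactly when two distinct elements share a label.\<close>

lemma reps_unambiguous_iff:
  assumes p: "p \<in> reps"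
  shows "(\<forall>p1\<in>reps. \<forall>p2\<in>reps. real_le p1 p \<and> real_le p2 p \<and> rmax p1 = rmax p2 \<longrightarrow> p1 = p2)
    \<longleftrightarrow> inj_on (rho p) (carr p)"
proof
  assume un: "\<forall>p1\<in>reps. \<forall>p2\<in>reps. real_le p1 p \<and> real_le p2 p \<and> rmax p1 = rmax p2 \<longrightarrow> p1 = p2"
  show "inj_on (rho p) (carr p)"
  proof (rule inj_onI)
    fix a b assume ab: "a \<in> carr p" "b \<in> carr p" and eq: "rho p a = rho p b"
    obtain p1 h1 where 1: "p1 \<in> reps" "real_le p1 p" "rmax p1 = rho p a" "riso h1 p1 (rrestr p a)"
      using reps_rrestr[OF p ab(1)] by blast
    obtain p2 h2 where 2: "p2 \<in> reps" "real_le p2 p" "rmax p2 = rho p b" "riso h2 p2 (rrestr p b)"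
      using reps_rrestr[OF p ab(2)] by blast
    have "p1 = p2" using un 1 2 eq by simp
    then have "riso (h2 \<circ> inv_into (carr p1) h1) (rrestr p a) (rrestr p b)"
      using riso_trans[OF riso_sym[OF 1(4)]] 2(4) by blast
    then show "a = b" using rrestr_iso_imp_eq[OF repsD(1)[OF p] ab] by blast
  qed
next
  assume inj: "inj_on (rho p) (carr p)"
  show "\<forall>p1\<in>reps. \<forall>p2\<in>reps. real_le p1 p \<and> real_le p2 p \<and> rmax p1 = rmax p2 \<longrightarrow> p1 = p2"
  proof (intro ballI impI, elim conjE)
    fix p1 p2 assume p12: "p1 \<in> reps" "p2 \<in> reps" "real_le p1 p" "real_le p2 p" "rmax p1 = rmax p2"
    obtain a h1 where a: "a \<in> carr p" "rmax p1 = rho p a" "riso h1 p1 (rrestr p a)"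
      using reps_le[OF p p12(1,3)] by blast
    obtain b h2 where b: "b \<in> carr p" "rmax p2 = rho p b" "riso h2 p2 (rrestr p b)"
      using reps_le[OF p p12(2,4)] by blast
    have "a = b" using a b p12(5) inj by (simp add: inj_on_def)
    then have "riso (inv_into (carr p2) h2 \<circ> h1) p1 p2"
      using riso_trans[OF a(3)] riso_sym[OF b(3)] by blast
    then show "p1 = p2" using reps_iso_eq p12 by blast
  qed
qed

lemma bij_betw_lab_rel: "bij_betw lab_rel (ireps \<A>) (primes \<A>)"
  unfolding bij_betw_def
proof
  show "inj_on lab_rel (ireps \<A>)"
  proof (rule inj_onI)
    fix p q assume "p \<in> ireps \<A>" "q \<in> ireps \<A>" "lab_rel p = lab_rel q"
    then have "\<exists>h. riso h p q"
      using riso_of_lab_rel_eq[of \<A> p q] repsD(2) by (simp add: ireps_def)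
    then show "p = q" using reps_iso_eq \<open>p \<in> ireps \<A>\<close> \<open>q \<in> ireps \<A>\<close> by (auto simp: ireps_def)
  qed
  show "lab_rel ` ireps \<A> = primes \<A>"
  proof
    show "lab_rel ` ireps \<A> \<subseteq> primes \<A>"
      using lab_rel_in_primes repsD by (fastforce simp: ireps_def)
    show "primes \<A> \<subseteq> lab_rel ` ireps \<A>"
    proof
      fix k assume "k \<in> primes \<A>"
      then obtain R :: "(nat, 'e) realisation" and t where R: "tight \<A> R" "is_top R t"
        "inj_on (rho R) (carr R)" "lab_rel R = k"
        using primes_nat_realisation by blast
      obtain p h where p: "p \<in> reps" "riso h R p" using reps_exists[OF R(1,2)] by blast
      have "realisation \<A> R" using R(1) by (simp add: tight_def)
      then have "lab_rel p = k" using lab_rel_riso[OF _ repsD(2)[OF p(1)] p(2)] R(4) by simp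
      moreover have "inj_on (rho p) (carr p)"
      proof (rule inj_onI)
        fix a b assume ab: "a \<in> carr p" "b \<in> carr p" "rho p a = rho p b"
        obtain u v where uv: "u \<in> carr R" "v \<in> carr R" "a = h u" "b = h v"
          using ab(1,2) p(2) unfolding riso_def bij_betw_def by blast
        then have "rho R u = rho R v" using ab(3) p(2) by (simp add: riso_def)
        then have "u = v" using uv R(3) by (simp add: inj_on_def)
        then show "a = b" using uv by simp
      qed
      ultimately show "k \<in> lab_rel ` ireps \<A>" using p(1) by (auto simp: ireps_def)
    qed
  qed
qed

lemma ireps_le_iff:
  assumes p: "p \<in> ireps \<A>" and q: "q \<in> ireps \<A>"
  shows "real_le p q \<longleftrightarrow> (\<exists>e\<in>Field (lab_rel q). lab_rel p = below (lab_rel q) e)"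
proof -
  have P: "p \<in> reps" "inj_on (rho p) (carr p)" and Q: "q \<in> reps" "inj_on (rho q) (carr q)"
    using p q by (auto simp: ireps_def)
  obtain t where t: "is_top p t" using repsD(3)[OF P(1)] by blast
  have "(\<exists>h. riso h p (rrestr q r)) \<longleftrightarrow> lab_rel p = below (lab_rel q) (rho q r)"
    if r: "r \<in> carr q" for r
  proof -
    have rr: "realisation \<A> (rrestr q r)"
      using tight_rrestr[OF repsD(1)[OF Q(1)] r] by (simp add: tight_def)
    have inj: "inj_on (rho (rrestr q r)) (carr (rrestr q r))"
      using Q(2) by (auto simp: rdown_def inj_on_def)
    have "(\<exists>h. riso h p (rrestr q r)) \<longleftrightarrow> lab_rel p = lab_rel (rrestr q r)"
      using riso_of_lab_rel_eq[OF repsD(2)[OF P(1)] P(2) rr inj]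
        lab_rel_riso[OF repsD(2)[OF P(1)] rr] by auto
    then show ?thesis using lab_rel_rrestr[OF repsD(2)[OF Q(1)] Q(2) r] by simp
  qed
  then show ?thesis
    unfolding real_le_iff[OF repsD(1)[OF Q(1)] repsD(2)[OF P(1)] t] Field_lab_rel[OF repsD(2)[OF Q(1)]]
    by blast
qed

end

text \<open>Restricting leaves consistency as computed in the unrestricted structure, so the
  down-closure in \<open>con\<close> ranges over all representatives and not just over
  \<open>ireps\<close>.\<close>

lemma edc_of_simps:
  fixes G :: "'e ges"
  defines "\<A> \<equiv> gconfigurations G"
  shows "events (edc_of G) = ireps \<A>"
    "leq (edc_of G) = {(p, q). p \<in> ireps \<A> \<and> q \<in> ireps \<A> \<and> real_le p q}"
    "con (edc_of G) = {X. X \<subseteq> ireps \<A> \<and> finite X \<and>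
       rmax ` {p \<in> prime_extremal_reps \<A>. \<exists>q\<in>X. real_le p q} \<in> \<A>}"
    "eqv (edc_of G) = {(p, q). p \<in> ireps \<A> \<and> q \<in> ireps \<A> \<and> rmax p = rmax q}"
proof -
  note bc = bounded_complete_gconfigurations[of G]
  let ?Q = "{p \<in> events (ese_of G). \<forall>p1\<in>down (ese_of G) p. \<forall>p2\<in>down (ese_of G) p.
     (p1, p2) \<in> eqv (ese_of G) \<longrightarrow> p1 = p2}"
  have E: "events (ese_of G) = prime_extremal_reps \<A>"
    "leq (ese_of G) = {(p, q). p \<in> prime_extremal_reps \<A> \<and> q \<in> prime_extremal_reps \<A> \<and> real_le p q}"
    "con (ese_of G) = {X. X \<subseteq> prime_extremal_reps \<A> \<and> finite X \<and>
                  rmax ` {p \<in> prime_extremal_reps \<A>. \<exists>q\<in>X. real_le p q} \<in> \<A>}"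
    "eqv (ese_of G) = {(p, q). p \<in> prime_extremal_reps \<A> \<and> q \<in> prime_extremal_reps \<A> \<and> rmax p = rmax q}"
    by (simp_all add: ese_of_def Let_def \<A>_def)
  have "p \<in> ?Q \<longleftrightarrow> p \<in> ireps \<A>" for p
  proof -
    have "p \<in> ?Q \<longleftrightarrow> p \<in> prime_extremal_reps \<A> \<and> (\<forall>p1\<in>prime_extremal_reps \<A>. \<forall>p2\<in>prime_extremal_reps \<A>.
        real_le p1 p \<and> real_le p2 p \<and> rmax p1 = rmax p2 \<longrightarrow> p1 = p2)"
      by (auto simp: E down_def)
    then show ?thesis
      using reps_unambiguous_iff[OF bc, folded \<A>_def, of p] ireps_def[of \<A>] by blast
  qed
  then have Q: "?Q = ireps \<A>" by blast
  have edc: "edc_of G = ese_restrict (ese_of G) (ireps \<A>)"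
    unfolding edc_of_def Let_def Q ..
  have sub: "ireps \<A> \<subseteq> prime_extremal_reps \<A>" using ireps_def[of \<A>] by blast
  show "events (edc_of G) = ireps \<A>"
    "leq (edc_of G) = {(p, q). p \<in> ireps \<A> \<and> q \<in> ireps \<A> \<and> real_le p q}"
    "con (edc_of G) = {X. X \<subseteq> ireps \<A> \<and> finite X \<and>
       rmax ` {p \<in> prime_extremal_reps \<A>. \<exists>q\<in>X. real_le p q} \<in> \<A>}"
    "eqv (edc_of G) = {(p, q). p \<in> ireps \<A> \<and> q \<in> ireps \<A> \<and> rmax p = rmax q}"
    unfolding edc ese_restrict_def using sub by (auto simp: E)
qed

text \<open>Consistency agrees because the maxima of the representatives below \<open>q\<close> are
  precisely the labels of \<open>q\<close>, so the maxima of a down-closure form the union of the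
  fields. For order and equivalence, restriction of a realisation to a down-set turns into
  \<open>below\<close>, and \<open>rmax\<close> into \<open>ltop\<close>.\<close>

lemma siso_edc_of:
  fixes G :: "'e ges"
  shows "siso lab_rel (edc_of G) (prime_ese (gconfigurations G))"
proof -
  define \<A> where "\<A> = gconfigurations G"
  have bc: "bounded_complete \<A>" unfolding \<A>_def by (rule bounded_complete_gconfigurations)
  note E = edc_of_simps[of G, folded \<A>_def]
  note bij = bij_betw_lab_rel[OF bc]
  have pr: "lab_rel p \<in> primes \<A>" if "p \<in> ireps \<A>" for p using bij that by (simp add: bij_betwE)
  have ir: "p \<in> prime_extremal_reps \<A>" "inj_on (rho p) (carr p)" if "p \<in> ireps \<A>" for p
    using that by (auto simp: ireps_def)
  have "X \<in> con (edc_of G) \<longleftrightarrow> lab_rel ` X \<in> con (prime_ese \<A>)" if X: "X \<subseteq> ireps \<A>" for X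
  proof -
    have "rmax ` {p \<in> prime_extremal_reps \<A>. \<exists>q\<in>X. real_le p q} =
        (\<Union>q\<in>X. rmax ` {p \<in> prime_extremal_reps \<A>. real_le p q})" by blast
    also have "\<dots> = (\<Union>q\<in>X. Field (lab_rel q))"
    proof (intro SUP_cong refl)
      fix q assume "q \<in> X"
      then have q: "q \<in> prime_extremal_reps \<A>" using X ir(1) by blast
      show "rmax ` {p \<in> prime_extremal_reps \<A>. real_le p q} = Field (lab_rel q)"
        using reps_rmax_image[OF bc q] Field_lab_rel[OF repsD(2)[OF bc q]] by simp
    qed
    finally have "rmax ` {p \<in> prime_extremal_reps \<A>. \<exists>q\<in>X. real_le p q} = \<Union>(Field ` lab_rel ` X)"
      by (simp add: image_image)
    moreover have "finite X \<longleftrightarrow> finite (lab_rel ` X)"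
      using X bij finite_image_iff inj_on_subset unfolding bij_betw_def by metis
    ultimately show ?thesis using X pr unfolding E by auto
  qed
  moreover have "(p, q) \<in> eqv (edc_of G) \<longleftrightarrow> (lab_rel p, lab_rel q) \<in> eqv (prime_ese \<A>)"
    if pq: "p \<in> ireps \<A>" "q \<in> ireps \<A>" for p q
  proof -
    have "ltop (lab_rel p) = rmax p" if "p \<in> ireps \<A>" for p
      using ltop_lab_rel[OF repsD(1)[OF bc ir(1)[OF that]] ir(2)[OF that]]
        repsD(3)[OF bc ir(1)[OF that]] by blast
    then show ?thesis using pq pr unfolding E by simp
  qed
  moreover have "(p, q) \<in> leq (edc_of G) \<longleftrightarrow> (lab_rel p, lab_rel q) \<in> leq (prime_ese \<A>)"
    if pq: "p \<in> ireps \<A>" "q \<in> ireps \<A>" for p q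
    using ireps_le_iff[OF bc pq] pr pq unfolding E by simp
  ultimately show ?thesis
    using bij unfolding siso_def \<A>_def[symmetric] E(1) prime_ese_simps(1) by blast
qed

theorem ese_iso_edc_of_iff:
  assumes P: "ese P" and G: "general_es G"
  shows "ese_iso P (edc_of G) \<longleftrightarrow> (\<exists>h. siso h P (prime_ese (gconfigurations G)))"
proof
  note E = edc_of_simps[of G]
  have Q: "ese (edc_of G)"
    using siso_ese[OF siso_edc_of ese_prime_ese[OF bounded_complete_gconfigurations empty_gconfiguration[OF G]]]
    unfolding E by blast
  show "\<exists>h. siso h P (prime_ese (gconfigurations G))" if "ese_iso P (edc_of G)"
    using ese_iso_imp_siso[OF P Q that] siso_trans[OF _ siso_edc_of] by blast
  show "ese_iso P (edc_of G)" if "\<exists>h. siso h P (prime_ese (gconfigurations G))"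
    using that siso_trans[OF _ siso_sym[OF siso_edc_of]] siso_imp_ese_iso by blast
qed

section \<open>Necessity of the axioms\<close>

lemma classes_subset_iff_image:
  assumes P: "ese P"
    and f: "\<And>p q. p \<in> events P \<Longrightarrow> q \<in> events P \<Longrightarrow> (p, q) \<in> eqv P \<longleftrightarrow> f p = f q"
    and X: "X \<subseteq> events P" and Y: "Y \<subseteq> events P"
  shows "classes P X \<subseteq> classes P Y \<longleftrightarrow> f ` X \<subseteq> f ` Y"
proof -
  have eq: "equiv (events P) (eqv P)" using P by (simp add: ese_def)
  have "classes P X \<subseteq> classes P Y \<longleftrightarrow> (\<forall>p\<in>X. \<exists>q\<in>Y. eqv P `` {p} = eqv P `` {q})"
    by (auto simp: classes_def quotient_def)
  also have "\<dots> \<longleftrightarrow> (\<forall>p\<in>X. \<exists>q\<in>Y. f p = f q)"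
    using f eq_equiv_class_iff[OF eq] X Y by (meson subsetD)
  also have "\<dots> \<longleftrightarrow> f ` X \<subseteq> f ` Y" by blast
  finally show ?thesis .
qed

lemma down_dclosed: "dclosed P X \<Longrightarrow> p \<in> X \<Longrightarrow> down P p \<subseteq> X"
  by (auto simp: down_closed_def down_def)

locale labelled_edc =
  fixes P :: "'p ese" and \<A> :: "'e set set" and h :: "'p \<Rightarrow> 'e rel"
  assumes ese: "ese P" and bc: "bounded_complete \<A>" and h: "siso h P (prime_ese \<A>)"
begin

definition lab :: "'p \<Rightarrow> 'e" where
  "lab p = ltop (h p)"

lemma pes: "prime_es P"
  using ese by (simp add: ese_def)

lemma h_bij: "h ` events P = primes \<A>" "inj_on h (events P)"
  using h by (auto simp: siso_def bij_betw_def)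

lemma h_primes: "p \<in> events P \<Longrightarrow> h p \<in> primes \<A>"
  using h_bij by auto

lemma leq_iff:
  "p \<in> events P \<Longrightarrow> q \<in> events P \<Longrightarrow> (p, q) \<in> leq P \<longleftrightarrow> (\<exists>e\<in>Field (h q). h p = below (h q) e)"
  using h h_primes by (simp add: siso_def)

lemma eqv_iff: "p \<in> events P \<Longrightarrow> q \<in> events P \<Longrightarrow> (p, q) \<in> eqv P \<longleftrightarrow> lab p = lab q"
  using h h_primes by (simp add: siso_def lab_def)

lemma con_iff:
  assumes "X \<subseteq> events P" shows "X \<in> con P \<longleftrightarrow> finite X \<and> \<Union>(Field ` h ` X) \<in> \<A>"
proof -
  have "X \<in> con P \<longleftrightarrow> h ` X \<in> con (prime_ese \<A>)" using h assms by (simp add: siso_def)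
  also have "\<dots> \<longleftrightarrow> finite (h ` X) \<and> \<Union>(Field ` h ` X) \<in> \<A>" using h_primes assms by auto
  also have "finite (h ` X) \<longleftrightarrow> finite X"
    using finite_image_iff inj_on_subset[OF h_bij(2) assms] by blast
  finally show ?thesis .
qed

lemmas down_self = down_refl[OF pes] and down_trans = down_subset[OF pes]
  and down_events = down_subset_events[where P = P]

lemma down_lab:
  assumes q: "q \<in> events P" and p: "p \<in> down P q"
  shows "lab p \<in> Field (h q)" "h p = below (h q) (lab p)"
proof -
  obtain e where e: "e \<in> Field (h q)" "h p = below (h q) e"
    using leq_iff[of p q] p q by (auto simp: down_def)
  then have "lab p = e" using primes_below(2)[OF h_primes[OF q] e(1)] by (simp add: lab_def)
  then show "lab p \<in> Field (h q)" "h p = below (h q) (lab p)" using e by auto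
qed

lemma lab_image_down:
  assumes q: "q \<in> events P" shows "lab ` down P q = Field (h q)"
proof
  show "lab ` down P q \<subseteq> Field (h q)" using down_lab[OF q] by auto
  show "Field (h q) \<subseteq> lab ` down P q"
  proof
    fix e assume e: "e \<in> Field (h q)"
    note b = primes_below[OF h_primes[OF q] e]
    obtain p where p: "p \<in> events P" "h p = below (h q) e" using b(1) h_bij(1) by (metis imageE)
    then have "p \<in> down P q" using leq_iff[OF p(1) q] e by (auto simp: down_def)
    moreover have "lab p = e" using b(2) p by (simp add: lab_def)
    ultimately show "e \<in> lab ` down P q" by blast
  qed
qed

lemma inj_on_lab_down:
  assumes q: "q \<in> events P" shows "inj_on lab (down P q)"
proof (rule inj_onI)
  fix a b assume ab: "a \<in> down P q" "b \<in> down P q" "lab a = lab b"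
  then have "h a = h b" using down_lab(2)[OF q] by metis
  then show "a = b" using ab h_bij(2) down_events by (meson inj_onD subsetD)
qed

lemma leq_lab_iff:
  assumes q: "q \<in> events P" and ab: "a \<in> down P q" "b \<in> down P q"
  shows "(a, b) \<in> leq P \<longleftrightarrow> (lab a, lab b) \<in> h q"
proof -
  have a: "a \<in> events P" and b: "b \<in> events P" using ab down_events by auto
  note hq = h_primes[OF q]
  have lb: "lab b \<in> Field (h q)" using down_lab(1)[OF q ab(2)] .
  have F: "Field (h b) = under (h q) (lab b)"
    using primes_below(3)[OF hq lb] down_lab(2)[OF q ab(2)] by simp
  show ?thesis
  proof
    assume "(a, b) \<in> leq P"
    then have "lab a \<in> Field (h b)" using down_lab(1)[OF b, of a] a by (simp add: down_def)
    then show "(lab a, lab b) \<in> h q" by (simp add: F under_def)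
  next
    assume "(lab a, lab b) \<in> h q"
    then have "lab a \<in> under (h q) (lab b)" by (simp add: under_def)
    then have "below (h b) (lab a) = h a" "lab a \<in> Field (h b)"
      using primes_below(4)[OF hq lb] down_lab(2)[OF q ab(2)] down_lab(2)[OF q ab(1)] F by simp_all
    then show "(a, b) \<in> leq P" using leq_iff[OF a b] by metis
  qed
qed

text \<open>The relation attached to \<open>q\<close> is the order of \<open>P\<close> on its
  causes, read through labels. This recovers \<open>h\<close> from \<open>P\<close>, so that
  equality of events can be proved by comparing causes and labels.\<close>

lemma h_eq:
  assumes q: "q \<in> events P"
  shows "h q = {(lab a, lab b) |a b. a \<in> down P q \<and> b \<in> down P q \<and> (a, b) \<in> leq P}"
proof (intro set_eqI)
  fix x :: "'e \<times> 'e"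
  obtain e e' where x: "x = (e, e')" by (cases x)
  have "x \<in> h q \<longleftrightarrow> (e, e') \<in> h q \<and> e \<in> lab ` down P q \<and> e' \<in> lab ` down P q"
    unfolding lab_image_down[OF q] x by (auto simp: Field_def)
  also have "\<dots> \<longleftrightarrow> (\<exists>a\<in>down P q. \<exists>b\<in>down P q. e = lab a \<and> e' = lab b \<and> (a, b) \<in> leq P)"
    using leq_lab_iff[OF q] by blast
  finally show "x \<in> h q \<longleftrightarrow>
      x \<in> {(lab a, lab b) |a b. a \<in> down P q \<and> b \<in> down P q \<and> (a, b) \<in> leq P}"
    unfolding x by blast
qed

text \<open>A down-closed set is the union of its principal down-sets, and the labels of
  \<open>down P p\<close> are the field of \<open>h p\<close>; so the consistency condition of
  \<open>prime_ese\<close> involves the labels of \<open>X\<close> only.\<close>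

lemma fin_configurations_lab:
  assumes X: "dclosed P X" and fin: "finite X"
  shows "X \<in> fin_configurations P \<longleftrightarrow> lab ` X \<in> \<A>"
proof -
  have XP: "X \<subseteq> events P" using X by (simp add: down_closed_def)
  have "X = (\<Union>p\<in>X. down P p)" using down_dclosed[OF X] down_self XP by blast
  then have "lab ` X = (\<Union>p\<in>X. lab ` down P p)" by blast
  also have "\<dots> = \<Union>(Field ` h ` X)" using XP lab_image_down by (simp add: subset_iff image_image)
  finally show ?thesis using con_iff[OF XP] fin X fin_configuration_iff[OF pes] by simp
qed

lemma classes_subset_iff:
  "X \<subseteq> events P \<Longrightarrow> Y \<subseteq> events P \<Longrightarrow> classes P X \<subseteq> classes P Y \<longleftrightarrow> lab ` X \<subseteq> lab ` Y"
  by (rule classes_subset_iff_image[OF ese]) (simp_all add: eqv_iff)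

lemma classes_eq_iff:
  "X \<subseteq> events P \<Longrightarrow> Y \<subseteq> events P \<Longrightarrow> classes P X = classes P Y \<longleftrightarrow> lab ` X = lab ` Y"
  using classes_subset_iff[of X Y] classes_subset_iff[of Y X] by blast

text \<open>On \<open>down P r\<close> the labelling is an order isomorphism onto
  \<open>h r\<close>, so the minimality clause of tightness at the top of \<open>h r\<close> can be
  restated for down-closed sets of \<open>P\<close>.\<close>

lemma lab_minimal:
  assumes r: "r \<in> events P" and X: "dclosed P X" "X \<subseteq> sdown P r"
    and A: "insert (lab r) (lab ` X) \<in> \<A>"
  shows "X = sdown P r"
proof -
  note hr = h_primes[OF r]
  have sd: "sdown P r \<subseteq> down P r" by (auto simp: sdown_def)
  have inj: "inj_on lab (down P r)" using inj_on_lab_down[OF r] .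
  have top: "rdown (lrel (h r)) (lab r) - {lab r} = lab ` sdown P r"
  proof -
    have "rdown (lrel (h r)) (lab r) = lab ` down P r"
      using primes_Field(4)[OF hr] lab_image_down[OF r] by (simp add: rdown_lrel lab_def)
    moreover have "lab ` sdown P r = lab ` down P r - lab ` {r}"
      unfolding sdown_def using inj_on_image_set_diff[OF inj, of "down P r" "{r}"] down_self[OF r] by auto
    ultimately show ?thesis by simp
  qed
  have "rclosed (lrel (h r)) (lab ` X)"
    unfolding down_closed_def lrel_simps
  proof (intro conjI ballI impI)
    show "lab ` X \<subseteq> Field (h r)" using X(2) sd lab_image_down[OF r] by blast
    fix e e' assume e: "e \<in> lab ` X" and e': "e' \<in> Field (h r)" and le: "(e', e) \<in> h r"
    obtain a where a: "a \<in> X" "e = lab a" using e by blast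
    obtain b where b: "b \<in> down P r" "e' = lab b" using e' lab_image_down[OF r] by blast
    have "(b, a) \<in> leq P" using leq_lab_iff[OF r b(1), of a] a b le X(2) sd by blast
    moreover have "b \<in> events P" using b(1) down_events by blast
    ultimately have "b \<in> X" using X(1) a(1) unfolding down_closed_def by blast
    then show "e' \<in> lab ` X" using b(2) by blast
  qed
  moreover have "lab ` X \<subseteq> rdown (lrel (h r)) (lab r) - {lab r}" using X(2) unfolding top by blast
  moreover have "lab r \<in> carr (lrel (h r))" using primes_Field(3)[OF hr] by (simp add: lab_def)
  moreover have "insert (rho (lrel (h r)) (lab r)) (rho (lrel (h r)) ` lab ` X) \<in> \<A>" using A by simp
  ultimately have "lab ` X = lab ` sdown P r"
    using primesD(1)[OF hr] unfolding top[symmetric] tight_def by blast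
  then show ?thesis using inj_on_image_eq_iff[OF inj _ sd] X(2) sd by auto
qed

lemma axiom_A:
  assumes "finite X" "dclosed P X" "y \<in> fin_configurations P" "classes P X = classes P y"
  shows "X \<in> fin_configurations P"
proof -
  have y: "dclosed P y" "finite y" using assms(3) by (auto simp: fin_configurations_def configurations_def)
  then have "lab ` X = lab ` y"
    using classes_eq_iff[of X y] assms(2,4) by (auto simp: down_closed_def)
  then show ?thesis using fin_configurations_lab y assms by simp
qed

text \<open>Among the shared strict causes both relations are induced by the order of
  \<open>P\<close>; the remaining pairs lead to the top, which has the same label on either side. By
  symmetry this settles (B).\<close>

lemma h_subset:
  assumes p: "p \<in> events P" and q: "q \<in> events P" and sd: "sdown P p = sdown P q" and eq: "lab p = lab q"
  shows "h p \<subseteq> h q"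
proof
  have dp: "down P p = insert p (sdown P p)" and dq: "down P q = insert q (sdown P q)"
    using down_self p q by (auto simp: sdown_def)
  have F: "Field (h p) = Field (h q)"
    unfolding lab_image_down[OF p, symmetric] lab_image_down[OF q, symmetric] dp dq sd by (simp add: eq)
  fix x assume x: "x \<in> h p"
  then obtain a b where ab: "x = (lab a, lab b)" "a \<in> down P p" "b \<in> down P p" "(a, b) \<in> leq P"
    unfolding h_eq[OF p] by blast
  show "x \<in> h q"
  proof (cases "b = p")
    case True
    have "lab a \<in> Field (h q)" using down_lab(1)[OF p ab(2)] F by simp
    then have "(lab a, lab q) \<in> h q"
      using primes_Field(4)[OF h_primes[OF q]] by (auto simp: under_def lab_def)
    then show ?thesis using ab True eq by simp
  next
    case False
    then have "b \<in> down P q" using ab dp dq sd by auto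
    moreover have "a \<in> down P q"
      using down_trans[OF \<open>b \<in> down P q\<close>] ab down_events by (auto simp: down_def)
    ultimately show ?thesis unfolding h_eq[OF q] using ab by blast
  qed
qed

lemma axiom_B:
  assumes "p \<in> events P" "q \<in> events P" "sdown P p = sdown P q" "(p, q) \<in> eqv P"
  shows "p = q"
proof -
  have "lab p = lab q" using assms eqv_iff by simp
  then have "h p = h q" using h_subset[of p q] h_subset[of q p] assms by simp
  then show ?thesis using h_bij(2) assms by (meson inj_onD)
qed

lemma axiom_C:
  assumes p: "p \<in> events P" and q: "q \<in> events P" and X: "dclosed P X" "X \<subseteq> sdown P p"
    and eq: "(p, q) \<in> eqv P" and cl: "classes P (sdown P q) \<subseteq> classes P X"
  shows "X = sdown P p"
proof (rule lab_minimal[OF p X])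
  have sd: "sdown P r \<subseteq> down P r" for r by (auto simp: sdown_def)
  have XP: "X \<subseteq> events P" using X(1) by (simp add: down_closed_def)
  have lab: "lab p = lab q" using eqv_iff[OF p q] eq by simp
  have "lab ` sdown P q \<subseteq> lab ` X"
    using cl classes_subset_iff[OF order_trans[OF sd down_events] XP] by simp
  moreover have "down P q = insert q (sdown P q)" using down_self[OF q] by (auto simp: sdown_def)
  \<comment> \<open>As \<open>q\<close> has the label of \<open>p\<close> and its strict causes are
    covered by \<open>X\<close> up to labels, adding the label of \<open>p\<close> to those of
    \<open>X\<close> is the same as adding all of \<open>Field (h q)\<close>. This is a union of two
    members of \<open>\<A>\<close> bounded by \<open>Field (h p)\<close>, as required for minimality
    at \<open>p\<close>.\<close>
  ultimately have *: "insert (lab p) (lab ` X) = lab ` X \<union> Field (h q)"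
    unfolding lab_image_down[OF q, symmetric] lab by auto
  have Xd: "X \<subseteq> down P p" using X(2) sd by blast
  then have "finite X" using prime_esD(7)[OF pes p] finite_subset by blast
  moreover have "X \<in> con P"
    using down_fin_configuration[OF pes p] Xd prime_esD(9)[OF pes] fin_configuration_iff[OF pes] by blast
  ultimately have "lab ` X \<in> \<A>"
    using fin_configurations_lab[OF X(1)] X(1) fin_configuration_iff[OF pes] by blast
  then show "insert (lab p) (lab ` X) \<in> \<A>"
    unfolding * using primes_Field(1)[OF h_primes[OF q]] primes_Field(1)[OF h_primes[OF p]]
  proof (rule bounded_complete_Un[OF bc])
    show "lab ` X \<union> Field (h q) \<subseteq> Field (h p)"
      unfolding *[symmetric] lab_image_down[OF p, symmetric] using Xd down_self[OF p] by blast
  qed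
qed

text \<open>The minimality assumed of \<open>d\<close> is exactly the tightness condition at the new
  top; below it \<open>lab_minimal\<close> applies, and distinct elements have distinct labels. So
  \<open>d\<close> with a top is a prime realisation and is attached to some event of
  \<open>P\<close>, whose strict causes are located in \<open>d\<close> by comparing
  relations.\<close>

lemma extension_prime:
  assumes d: "dclosed P d" "d \<in> con P" and inj: "inj_on lab d"
    and t: "lab t \<notin> lab ` d" "insert (lab t) (lab ` d) \<in> \<A>"
    and min: "\<And>d'. dclosed P d' \<Longrightarrow> d' \<subseteq> d \<Longrightarrow> insert (lab t) (lab ` d') \<in> \<A> \<Longrightarrow> d' = d"
  shows "\<exists>p\<in>events P. lab p = lab t \<and> sdown P p \<subseteq> d"
proof -
  have dP: "d \<subseteq> events P" using d by (simp add: down_closed_def)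
  have fin: "finite d" using prime_esD(5)[OF pes d(2)] .
  have td: "t \<notin> d" using t(1) by blast
  \<comment> \<open>The event \<open>t\<close> only serves as a fresh top element carrying the right label; its causes in
    \<open>P\<close> are irrelevant.\<close>
  define R where "R = \<lparr>carr = insert t d,
    ord = {(a, b). a \<in> d \<and> b \<in> d \<and> (a, b) \<in> leq P} \<union> insert t d \<times> {t}, rho = lab\<rparr>"
  have R: "carr R = insert t d" "rho R = lab"
    "\<And>a b. (a, b) \<in> ord R \<longleftrightarrow> a \<in> d \<and> b \<in> d \<and> (a, b) \<in> leq P \<or> a \<in> insert t d \<and> b = t"
    by (auto simp: R_def)
  have po: "partial_order_on (carr R) (ord R)"
  proof (rule partial_orderI)
    show "ord R \<subseteq> carr R \<times> carr R" by (auto simp: R)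
    show "(a, a) \<in> ord R" if "a \<in> carr R" for a using that prime_esD(2)[OF pes] dP by (auto simp: R)
    show "(a, c) \<in> ord R" if "(a, b) \<in> ord R" "(b, c) \<in> ord R" for a b c
      using that td prime_esD(3)[OF pes, of a b c] unfolding R(3) by blast
    show "a = b" if "(a, b) \<in> ord R" "(b, a) \<in> ord R" for a b
      using that td prime_esD(4)[OF pes, of a b] unfolding R(3) by blast
  qed
  have dc: "dclosed P z" if z: "rclosed R z" "t \<notin> z" for z
    unfolding down_closed_def
  proof (intro conjI ballI impI)
    have zd: "z \<subseteq> d" using z unfolding down_closed_def R(1) by blast
    then show "z \<subseteq> events P" using dP by blast
    fix a b assume a: "a \<in> z" and b: "b \<in> events P" "(b, a) \<in> leq P"
    have "b \<in> d" using d(1) zd a b unfolding down_closed_def by blast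
    then have "(b, a) \<in> ord R" "b \<in> carr R" using a b zd by (auto simp: R)
    then show "b \<in> z" using z(1) a unfolding down_closed_def by blast
  qed
  have inA: "rho R ` z \<in> \<A>" if z: "rclosed R z" for z
  proof (cases "t \<in> z")
    case True
    have "z = insert t d"
    proof
      show "z \<subseteq> insert t d" using z unfolding down_closed_def R(1) by blast
      have "(a, t) \<in> ord R" "a \<in> carr R" if "a \<in> insert t d" for a using that unfolding R by blast+
      then show "insert t d \<subseteq> z" using z True unfolding down_closed_def by blast
    qed
    then show ?thesis using t(2) by (simp add: R)
  next
    case False
    have "z \<subseteq> d" using z False unfolding down_closed_def R(1) by blast
    then have "z \<in> con P" "finite z" using prime_esD(9)[OF pes d(2)] fin finite_subset by blast+
    then show ?thesis
      using fin_configurations_lab[OF dc[OF z False]] fin_configuration_iff[OF pes] dc[OF z False]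
      by (simp add: R)
  qed
  have real: "realisation \<A> R"
    unfolding realisation_def
  proof (intro conjI ballI allI impI po inA)
    show "finite {r' \<in> carr R. (r', r) \<in> ord R}" for r using fin by (simp add: R)
    show "rho R ` carr R \<subseteq> \<Union>\<A>" using t(2) by (auto simp: R)
  qed
  have injR: "inj_on (rho R) (carr R)" using inj t(1) by (auto simp: R)
  have top: "is_top R t" by (auto simp: is_top_def R)
  have down_t: "rdown R t - {t} = d" using td by (auto simp: rdown_def R)
  have down_d: "rdown R r = down P r" if "r \<in> d" for r
    using that td down_dclosed[OF d(1) that] dP by (auto simp: rdown_def R down_def)
  have "tight \<A> R"
    unfolding tight_def
  proof (intro conjI ballI allI impI real, elim conjE)
    show "r = r'" if "r \<in> carr R" "r' \<in> carr R" "rho R r = rho R r'" for r r'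
      using that injR by (simp add: inj_on_def)
    fix r x assume r: "r \<in> carr R"
      and x: "rclosed R x \<and> x \<subseteq> rdown R r - {r} \<and> insert (rho R r) (rho R ` x) \<in> \<A>"
    show "x = rdown R r - {r}"
    proof (cases "r = t")
      case True
      then have xd: "x \<subseteq> d" using x down_t by simp
      then have "dclosed P x" using dc[of x] x td by blast
      then show ?thesis using min[OF _ xd] x True down_t by (simp add: R)
    next
      case False
      then have rd: "r \<in> d" using r by (simp add: R)
      then have "x \<subseteq> sdown P r" using x down_d[OF rd] by (simp add: sdown_def)
      moreover have "t \<notin> x" using x down_d[OF rd] down_dclosed[OF d(1) rd] td by blast
      then have "dclosed P x" using dc x by blast
      ultimately have "x = sdown P r"
        using lab_minimal[of r x] rd dP x by (auto simp: R)
      then show ?thesis using down_d[OF rd] by (simp add: sdown_def)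
    qed
  qed
  then have k: "lab_rel R \<in> primes \<A>" "ltop (lab_rel R) = rmax R"
    using lab_rel_in_primes[OF _ injR top] ltop_lab_rel[OF _ injR top] by auto
  obtain p where p: "p \<in> events P" "h p = lab_rel R" using k(1) h_bij(1) by (metis imageE)
  have lp: "lab p = lab t" using k(2) p rmax_eq[OF real top] by (simp add: lab_def R)
  have "sdown P p \<subseteq> d"
  proof
    fix a assume a: "a \<in> sdown P p"
    then have ap: "a \<in> down P p" "a \<noteq> p" by (auto simp: sdown_def)
    have "lab a \<noteq> lab p" using inj_on_lab_down[OF p(1)] ap down_self[OF p(1)] by (meson inj_onD)
    moreover have "lab a \<in> lab ` insert t d"
      using down_lab(1)[OF p(1) ap(1)] Field_lab_rel[OF real] p(2) by (simp add: R)
    ultimately obtain b where b: "b \<in> d" "lab a = lab b" using lp by auto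
    have bP: "b \<in> events P" using b dP by blast
    \<comment> \<open>The relations of \<open>a\<close> and of \<open>b\<close> are both the part of
      \<open>lab_rel R\<close> below the same label, so injectivity of \<open>h\<close> identifies
      the cause \<open>a\<close> of \<open>p\<close> with the element \<open>b\<close> of
      \<open>d\<close>.\<close>
    have "h a = lab_rel (rrestr R b)"
      using down_lab(2)[OF p(1) ap(1)] lab_rel_rrestr[OF real injR, of b] b p(2) by (simp add: R)
    also have "\<dots> = h b"
    proof -
      have "ord (rrestr R b) = {(u, v). u \<in> down P b \<and> v \<in> down P b \<and> (u, v) \<in> leq P}"
        using down_d[OF b(1)] down_dclosed[OF d(1) b(1)] td by (auto simp: R)
      then show ?thesis
        unfolding h_eq[OF bP] set_eq_iff by (auto simp: lab_rel_iff R)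
    qed
    finally have "a = b" using h_bij(2) ap(1) down_events bP by (meson inj_onD subsetD)
    then show "a \<in> d" using b by simp
  qed
  then show ?thesis using p(1) lp by blast
qed

text \<open>The condition on classes says that, up to labels, \<open>down P t\<close> adds only the
  label of \<open>t\<close> to \<open>x\<close>. Thus adjoining this label to those of
  \<open>x\<close> stays in \<open>\<A>\<close>, although the causes of \<open>t\<close> itself may
  be other members of the same classes; a minimal suitable subset of \<open>x\<close> provides
  causes that do lie in \<open>x\<close>.\<close>

lemma axiom_D1:
  assumes x: "x \<in> fin_configurations P" and t: "t \<in> events P" and un: "unambiguous P x"
    and xt: "x \<union> down P t \<in> fin_configurations P"
    and cl: "classes P (x \<union> down P t) = classes P x \<union> {eqv P `` {t}}"
  shows "\<exists>p\<in>events P. (p, t) \<in> eqv P \<and> x \<union> {p} \<in> fin_configurations P"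
proof -
  have xd: "dclosed P x" "x \<in> con P" using x fin_configuration_iff[OF pes] by auto
  have xP: "x \<subseteq> events P" using xd by (simp add: down_closed_def)
  have fin: "finite x" using prime_esD(5)[OF pes xd(2)] .
  have inj: "inj_on lab x"
    using un xP eqv_iff unfolding unambiguous_def inj_on_def by blast
  have "classes P x \<union> {eqv P `` {t}} = classes P (insert t x)"
    by (auto simp: classes_def quotient_def)
  then have lab: "lab ` (x \<union> down P t) = insert (lab t) (lab ` x)"
    using cl classes_eq_iff[of "x \<union> down P t" "insert t x"] xP t down_events by auto
  have "finite (x \<union> down P t)" "dclosed P (x \<union> down P t)"
    using xt by (auto simp: fin_configurations_def configurations_def)
  then have xtA: "insert (lab t) (lab ` x) \<in> \<A>"
    using fin_configurations_lab xt lab by metis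
  show ?thesis
  proof (cases "lab t \<in> lab ` x")
    case True
    then obtain p where "p \<in> x" "lab p = lab t" by (metis imageE)
    then show ?thesis using eqv_iff[of p t] xP t x by (intro bexI[of _ p]) (auto simp: insert_absorb)
  next
    case False
    define D where "D = {d. dclosed P d \<and> d \<subseteq> x \<and> insert (lab t) (lab ` d) \<in> \<A>}"
    have "finite D" by (rule finite_subset[of _ "Pow x"]) (use fin in \<open>auto simp: D_def\<close>)
    moreover have "x \<in> D" using xd xtA by (simp add: D_def)
    ultimately obtain d where d: "d \<in> D" and min: "\<And>d'. d' \<in> D \<Longrightarrow> d' \<subseteq> d \<Longrightarrow> d' = d"
      using finite_has_minimal[of D] by blast
    have dx: "d \<subseteq> x" using d by (simp add: D_def)
    have "\<exists>p\<in>events P. lab p = lab t \<and> sdown P p \<subseteq> d"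
    proof (rule extension_prime)
      show "dclosed P d" "insert (lab t) (lab ` d) \<in> \<A>" using d by (auto simp: D_def)
      show "d \<in> con P" using prime_esD(9)[OF pes xd(2) dx] .
      show "inj_on lab d" using inj_on_subset[OF inj dx] .
      show "lab t \<notin> lab ` d" using False dx by blast
      show "d' = d" if "dclosed P d'" "d' \<subseteq> d" "insert (lab t) (lab ` d') \<in> \<A>" for d'
        using min[of d'] that dx by (auto simp: D_def)
    qed
    then obtain p where p: "p \<in> events P" "lab p = lab t" "sdown P p \<subseteq> x" using dx by blast
    have "dclosed P (x \<union> {p})"
      using xd(1) p unfolding down_closed_def sdown_def down_def by blast
    moreover have "lab ` (x \<union> {p}) \<in> \<A>" using xtA p(2) by simp
    ultimately have "x \<union> {p} \<in> fin_configurations P" using fin_configurations_lab fin by simp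
    then show ?thesis using p eqv_iff[OF p(1) t] by blast
  qed
qed

end

section \<open>Sufficiency of the axioms\<close>

locale realisable_edc =
  fixes P :: "'p ese"
  assumes edc: "edc P"
    and axA: "\<And>X y. finite X \<Longrightarrow> dclosed P X \<Longrightarrow> y \<in> fin_configurations P \<Longrightarrow>
      classes P X = classes P y \<Longrightarrow> X \<in> fin_configurations P"
    and axB: "\<And>p q. p \<in> events P \<Longrightarrow> q \<in> events P \<Longrightarrow> sdown P p = sdown P q \<Longrightarrow>
      (p, q) \<in> eqv P \<Longrightarrow> p = q"
    and axC: "\<And>X p q. p \<in> events P \<Longrightarrow> q \<in> events P \<Longrightarrow> dclosed P X \<Longrightarrow> (p, q) \<in> eqv P \<Longrightarrow>
      X \<subseteq> sdown P p \<Longrightarrow> classes P (sdown P q) \<subseteq> classes P X \<Longrightarrow> X = sdown P p"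
    and axD1: "\<And>x t. x \<in> fin_configurations P \<Longrightarrow> t \<in> events P \<Longrightarrow> unambiguous P x \<Longrightarrow>
      x \<union> down P t \<in> fin_configurations P \<Longrightarrow>
      classes P (x \<union> down P t) = classes P x \<union> {eqv P `` {t}} \<Longrightarrow>
      \<exists>p\<in>events P. (p, t) \<in> eqv P \<and> x \<union> {p} \<in> fin_configurations P"
begin

text \<open>Equivalence classes are the events of the general event structure; they are represented by
  chosen members in order to stay in the type \<open>'p\<close>.\<close>

definition c :: "'p \<Rightarrow> 'p" where
  "c p = (SOME q. q \<in> eqv P `` {p})"

lemma ese: "ese P" and pes: "prime_es P" and eqv: "equiv (events P) (eqv P)"
  using edc by (auto simp: edc_def ese_def)

lemma c_rel: "p \<in> events P \<Longrightarrow> (p, c p) \<in> eqv P"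
  using eqv equiv_class_self[OF eqv] unfolding c_def by (metis Image_singleton_iff someI)

lemma eqv_iff:
  assumes "p \<in> events P" "q \<in> events P"
  shows "(p, q) \<in> eqv P \<longleftrightarrow> c p = c q"
proof
  show "c p = c q" if "(p, q) \<in> eqv P"
    using equiv_class_eq[OF eqv that] by (simp add: c_def)
  show "(p, q) \<in> eqv P" if "c p = c q"
    using c_rel[OF assms(1)] c_rel[OF assms(2)] that eqv by (metis equivE symD transD)
qed

lemma classes_subset_iff:
  "X \<subseteq> events P \<Longrightarrow> Y \<subseteq> events P \<Longrightarrow> classes P X \<subseteq> classes P Y \<longleftrightarrow> c ` X \<subseteq> c ` Y"
  by (rule classes_subset_iff_image[OF ese]) (simp_all add: eqv_iff)

lemma classes_eq_iff:
  "X \<subseteq> events P \<Longrightarrow> Y \<subseteq> events P \<Longrightarrow> classes P X = classes P Y \<longleftrightarrow> c ` X = c ` Y"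
  using classes_subset_iff[of X Y] classes_subset_iff[of Y X] by blast

lemmas down_self = down_refl[OF pes] and down_trans = down_subset[OF pes]
  and down_events = down_subset_events[where P = P] and sdown_down = sdown_subset_down[where P = P]

lemma down_eq: "p \<in> events P \<Longrightarrow> down P p = insert p (sdown P p)"
  using down_self by (auto simp: sdown_def)

lemma inj_on_c_down: "p \<in> events P \<Longrightarrow> inj_on c (down P p)"
  using edc eqv_iff down_events unfolding edc_def inj_on_def by blast

lemma c_sdown: "p \<in> events P \<Longrightarrow> c p \<notin> c ` sdown P p"
  using inj_on_c_down[of p] down_self[of p] by (auto simp: sdown_def inj_on_def)

lemma dclosed_sdown: "dclosed P (sdown P p)"
proof -
  have "b \<noteq> p" if "(b, a) \<in> leq P" "(a, p) \<in> leq P" "a \<noteq> p" for a b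
    using that prime_esD(4)[OF pes, of a p] by blast
  then show ?thesis
    using dclosed_down[OF pes, of p] unfolding down_closed_def sdown_def down_def by blast
qed

lemma fin_configuration_subset:
  "y \<in> fin_configurations P \<Longrightarrow> dclosed P x \<Longrightarrow> x \<subseteq> y \<Longrightarrow> x \<in> fin_configurations P"
  using prime_esD(9)[OF pes] fin_configuration_iff[OF pes] by blast

lemma sdown_fin_configuration: "p \<in> events P \<Longrightarrow> sdown P p \<in> fin_configurations P"
  using fin_configuration_subset[OF down_fin_configuration[OF pes] dclosed_sdown sdown_down] .

section \<open>The general event structure on equivalence classes\<close>

definition G :: "'p ges" where
  "G = \<lparr>gevents = c ` events P,
        gcon = {X. \<exists>y\<in>fin_configurations P. X \<subseteq> c ` y},
        enables = {(X, e). (\<exists>y\<in>fin_configurations P. X \<subseteq> c ` y) \<and>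
                           (\<exists>p\<in>events P. c p = e \<and> c ` sdown P p \<subseteq> X)}\<rparr>"

abbreviation "\<A> \<equiv> gconfigurations G"

lemma G_simps: "gevents G = c ` events P" "X \<in> gcon G \<longleftrightarrow> (\<exists>y\<in>fin_configurations P. X \<subseteq> c ` y)"
  "(X, e) \<in> enables G \<longleftrightarrow> X \<in> gcon G \<and> (\<exists>p\<in>events P. c p = e \<and> c ` sdown P p \<subseteq> X)"
  by (auto simp: G_def)

lemma fin_configurationD:
  assumes "y \<in> fin_configurations P"
  shows "finite y" "y \<subseteq> events P" "dclosed P y"
  using assms by (auto simp: fin_configurations_def configurations_def down_closed_def)

lemma general_es_G: "general_es G"
proof -
  have "{} \<in> fin_configurations P"
    using fin_configuration_iff[OF pes] prime_esD(11)[OF pes] by (simp add: down_closed_def)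
  then have "{} \<in> gcon G" unfolding G_simps by blast
  then have 1: "gcon G \<noteq> {}" by blast
  have 2: "finite X \<and> X \<subseteq> gevents G" if "X \<in> gcon G" for X
  proof -
    obtain y where "y \<in> fin_configurations P" "X \<subseteq> c ` y" using \<open>X \<in> gcon G\<close> unfolding G_simps by blast
    then show ?thesis using fin_configurationD[of y] by (auto simp: G_simps intro: finite_subset)
  qed
  have 3: "Y \<in> gcon G" if "X \<in> gcon G" "Y \<subseteq> X" for X Y
    using that unfolding G_simps by blast
  have 4: "enables G \<subseteq> gcon G \<times> gevents G" by (auto simp: G_simps)
  have 5: "(Y, e) \<in> enables G" if "(X, e) \<in> enables G" "X \<subseteq> Y" "Y \<in> gcon G" for X Y e
    using that unfolding G_simps(3) by blast
  show ?thesis unfolding general_es_def using 1 2 3 4 5 by (intro conjI) metis+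
qed

lemma secured_snoc:
  assumes "\<forall>i<length es. (set (take i es), es ! i) \<in> enables G" "(set es, e) \<in> enables G"
  shows "\<forall>i<length (es @ [e]). (set (take i (es @ [e])), (es @ [e]) ! i) \<in> enables G"
  using assms by (auto simp: nth_append less_Suc_eq)

text \<open>Peel off a maximal event \<open>m\<close> of \<open>y\<close> and list its class last:
  its strict causes have been listed before, so their classes enable it. When \<open>y\<close> is
  ambiguous a class may be listed more than once, which is harmless.\<close>

lemma secured_enumeration:
  assumes "y \<in> fin_configurations P"
  shows "\<exists>es. set es = c ` y \<and> (\<forall>i<length es. (set (take i es), es ! i) \<in> enables G)"
  using assms
proof (induction "card y" arbitrary: y rule: less_induct)
  case less
  note y = fin_configurationD[OF less.prems]
  show ?case
  proof (cases "y = {}")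
    case True then show ?thesis by (intro exI[of _ "[]"]) simp
  next
    case False
    \<comment> \<open>An event with the largest down-set is maximal, since a strictly larger event
      would have strictly more causes.\<close>
    obtain m where m: "m \<in> y" and max: "Max ((\<lambda>a. card (down P a)) ` y) = card (down P m)"
      using obtains_MAX[OF y(1) False] by metis
    have maximal: "a = m" if a: "a \<in> y" "(m, a) \<in> leq P" for a
    proof (rule ccontr)
      assume ne: "a \<noteq> m"
      have aP: "a \<in> events P" using a y by blast
      have "a \<notin> down P m" using ne a prime_esD(4)[OF pes, of a m] by (auto simp: down_def)
      moreover have "down P m \<subseteq> down P a"
        using prime_esD(3)[OF pes, of _ m a] a by (auto simp: down_def)
      ultimately have "down P m \<subset> down P a" using down_self[OF aP] by blast
      then have "card (down P m) < card (down P a)"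
        using psubset_card_mono prime_esD(7)[OF pes aP] by blast
      moreover have "card (down P a) \<le> card (down P m)"
        using y(1) a(1) by (simp add: max[symmetric])
      ultimately show False by simp
    qed
    have "dclosed P (y - {m})"
      using y(3) maximal unfolding down_closed_def by blast
    then have y': "y - {m} \<in> fin_configurations P"
      using fin_configuration_subset[OF less.prems] by blast
    moreover have "card (y - {m}) < card y" using m y(1) by (simp add: card_gt_0_iff False)
    ultimately obtain es where es: "set es = c ` (y - {m})"
      "\<forall>i<length es. (set (take i es), es ! i) \<in> enables G"
      using less.hyps by blast
    have mP: "m \<in> events P" using m y by blast
    have "sdown P m \<subseteq> y - {m}" using down_dclosed[OF y(3) m] by (auto simp: sdown_def)
    then have "(set es, c m) \<in> enables G"
      unfolding G_simps es(1) using y' mP by blast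
    then have "\<forall>i<length (es @ [c m]). (set (take i (es @ [c m])), (es @ [c m]) ! i) \<in> enables G"
      using secured_snoc[OF es(2)] by blast
    moreover have "set (es @ [c m]) = c ` y" using es(1) m by auto
    ultimately show ?thesis by blast
  qed
qed

lemma c_image_in:
  assumes y: "y \<in> fin_configurations P" shows "c ` y \<in> \<A>"
proof -
  note yD = fin_configurationD[OF y]
  have "\<exists>es. es \<noteq> [] \<and> set es \<subseteq> c ` y \<and> last es = e \<and>
      (\<forall>i<length es. (set (take i es), es ! i) \<in> enables G)" if e: "e \<in> c ` y" for e
  proof -
    obtain p where p: "p \<in> y" "e = c p" using e by blast
    have pP: "p \<in> events P" using p yD by blast
    note s = sdown_fin_configuration[OF pP]
    obtain es where es: "set es = c ` sdown P p"
      "\<forall>i<length es. (set (take i es), es ! i) \<in> enables G"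
      using secured_enumeration[OF s] by blast
    have "(set es, c p) \<in> enables G"
      unfolding G_simps es(1) using s pP by blast
    then have "\<forall>i<length (es @ [c p]). (set (take i (es @ [c p])), (es @ [c p]) ! i) \<in> enables G"
      using secured_snoc[OF es(2)] by blast
    moreover have "set (es @ [c p]) \<subseteq> c ` y"
      using es(1) down_dclosed[OF yD(3) p(1)] sdown_down[of p] p(1) by auto
    ultimately show ?thesis using p(2) by (intro exI[of _ "es @ [c p]"]) simp
  qed
  moreover have "c ` y \<subseteq> gevents G" using yD by (auto simp: G_simps)
  moreover have "Y \<in> gcon G" if "Y \<subseteq> c ` y" for Y using that y unfolding G_simps by blast
  ultimately show ?thesis unfolding gconfigurations_def by blast
qed

text \<open>The last step of a securing sequence for \<open>e\<close> yields an event of class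
  \<open>e\<close> whose causes have classes in \<open>x\<close>. The union \<open>Y\<close> of the
  down-sets of such events has exactly the classes \<open>x\<close>, but the events are picked
  independently, so its consistency has to come from (A).\<close>

lemma finite_gconfiguration:
  assumes x: "x \<in> \<A>" and fin: "finite x"
  shows "\<exists>y\<in>fin_configurations P. x = c ` y"
proof -
  have "x \<in> gcon G" using x fin by (simp add: gconfigurations_def)
  then obtain y where y: "y \<in> fin_configurations P" "x \<subseteq> c ` y" unfolding G_simps by blast
  note yD = fin_configurationD[OF y(1)]
  have "\<exists>p\<in>events P. c p = e \<and> c ` down P p \<subseteq> x" if e: "e \<in> x" for e
  proof -
    have "\<forall>e\<in>x. \<exists>es. es \<noteq> [] \<and> set es \<subseteq> x \<and> last es = e \<and>
        (\<forall>i<length es. (set (take i es), es ! i) \<in> enables G)"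
      using x by (simp add: gconfigurations_def)
    then obtain es where es: "es \<noteq> []" "set es \<subseteq> x" "last es = e"
      "\<forall>i<length es. (set (take i es), es ! i) \<in> enables G" using e by metis
    define i where "i = length es - 1"
    have "(set (take i es), e) \<in> enables G"
    proof -
      have "i < length es" "es ! i = e" using es(1,3) by (auto simp: i_def last_conv_nth)
      then show ?thesis using es(4) by metis
    qed
    then obtain p where p: "p \<in> events P" "c p = e" "c ` sdown P p \<subseteq> set (take i es)"
      unfolding G_simps by blast
    have "set (take i es) \<subseteq> x" using es(2) set_take_subset[of i es] by blast
    then have "c ` down P p \<subseteq> x" using p e unfolding down_eq[OF p(1)] by auto
    then show ?thesis using p by blast
  qed
  then obtain g where g: "\<And>e. e \<in> x \<Longrightarrow> g e \<in> events P \<and> c (g e) = e \<and> c ` down P (g e) \<subseteq> x"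
    by metis
  define Y where "Y = (\<Union>e\<in>x. down P (g e))"
  have Yd: "dclosed P Y"
    using dclosed_down[OF pes] unfolding Y_def down_closed_def by blast
  have Yf: "finite Y" unfolding Y_def using fin g prime_esD(7)[OF pes] by blast
  have cY: "c ` Y = x"
  proof
    show "c ` Y \<subseteq> x" using g unfolding Y_def by blast
    show "x \<subseteq> c ` Y"
    proof
      fix e assume e: "e \<in> x"
      then have "g e \<in> Y" unfolding Y_def using g[OF e] down_self by blast
      then show "e \<in> c ` Y" using g[OF e] by (metis imageI)
    qed
  qed
  have dY: "dclosed P (Y \<union> y)" using Yd yD(3) unfolding down_closed_def by blast
  then have YP: "Y \<union> y \<subseteq> events P" by (simp add: down_closed_def)
  \<comment> \<open>(A) requires equality of classes, while \<open>x\<close> is only known to be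
    contained in the classes of the configuration \<open>y\<close>. Adding \<open>y\<close> to
    \<open>Y\<close> gives a set with precisely the classes of \<open>y\<close>; the consistency of
    \<open>Y\<close> then follows by restriction.\<close>
  have "c ` (Y \<union> y) = c ` y" using cY y(2) by (auto simp: image_Un)
  then have "classes P (Y \<union> y) = classes P y" using classes_eq_iff[OF YP yD(2)] by simp
  then have "Y \<union> y \<in> fin_configurations P" using axA[OF _ dY y(1)] Yf yD(1) by simp
  then have "Y \<in> fin_configurations P" using fin_configuration_subset[OF _ Yd] by blast
  then show ?thesis using cY by blast
qed

lemma fin_configuration_c_iff:
  assumes X: "dclosed P X" "finite X"
  shows "X \<in> fin_configurations P \<longleftrightarrow> c ` X \<in> \<A>"
proof
  assume "c ` X \<in> \<A>"
  then obtain y where y: "y \<in> fin_configurations P" "c ` X = c ` y"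
    using finite_gconfiguration X(2) by blast
  have "classes P X = classes P y"
    using classes_eq_iff y fin_configurationD(2)[OF y(1)] X(1) by (simp add: down_closed_def)
  then show "X \<in> fin_configurations P" using axA X y(1) by blast
qed (rule c_image_in)

text \<open>Realise the enlarged set of classes by a configuration and pick in it an event
  \<open>q\<close> of the class of \<open>r\<close>. No strict cause of \<open>q\<close> is
  equivalent to \<open>q\<close>, so their classes all come from \<open>X\<close>, and (C) applies
  to \<open>r\<close>, \<open>q\<close> and \<open>X\<close>.\<close>

lemma c_minimal:
  assumes r: "r \<in> events P" and X: "dclosed P X" "X \<subseteq> sdown P r"
    and A: "insert (c r) (c ` X) \<in> \<A>"
  shows "X = sdown P r"
proof -
  have XP: "X \<subseteq> events P" using X(1) by (simp add: down_closed_def)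
  have "finite X"
    using X(2) sdown_down[of r] prime_esD(7)[OF pes r] finite_subset by (metis order_trans)
  then obtain y where y: "y \<in> fin_configurations P" "insert (c r) (c ` X) = c ` y"
    using finite_gconfiguration[OF A] by auto
  obtain q where q: "q \<in> y" "c q = c r" using y(2) by (metis imageE insertI1)
  have qP: "q \<in> events P" using q fin_configurationD[OF y(1)] by blast
  have "c ` sdown P q \<subseteq> insert (c r) (c ` X)"
    using down_dclosed[OF fin_configurationD(3)[OF y(1)] q(1)] sdown_down[of q] y(2) by blast
  moreover have "c r \<notin> c ` sdown P q" using c_sdown[OF qP] q(2) by simp
  ultimately have "c ` sdown P q \<subseteq> c ` X" by (simp add: subset_insert)
  then have "classes P (sdown P q) \<subseteq> classes P X"
    using classes_subset_iff[OF order_trans[OF sdown_down down_events] XP] by simp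
  moreover have "(r, q) \<in> eqv P" using eqv_iff[OF r qP] q(2) by simp
  ultimately show ?thesis using axC[OF r qP X(1)] X(2) by blast
qed

section \<open>Events of \<open>P\<close> as prime realisations\<close>

definition dreal :: "'p \<Rightarrow> ('p, 'p) realisation" where
  "dreal p = \<lparr>carr = down P p, ord = leq P \<inter> down P p \<times> down P p, rho = c\<rparr>"

lemma dreal_simps [simp]:
  "carr (dreal p) = down P p" "ord (dreal p) = leq P \<inter> down P p \<times> down P p" "rho (dreal p) = c"
  by (simp_all add: dreal_def)

lemma rdown_dreal:
  assumes "r \<in> down P p" shows "rdown (dreal p) r = down P r"
  using down_trans[OF assms] down_events[of p] assms unfolding rdown_def dreal_simps down_def[of P r] by blast

lemma rclosed_dreal: "rclosed (dreal p) z \<Longrightarrow> dclosed P z"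
proof -
  assume z: "rclosed (dreal p) z"
  have zp: "z \<subseteq> down P p" using z unfolding down_closed_def by simp
  show "dclosed P z"
    unfolding down_closed_def
  proof (intro conjI ballI impI)
    show "z \<subseteq> events P" using zp down_events by blast
    fix a b assume a: "a \<in> z" and b: "b \<in> events P" "(b, a) \<in> leq P"
    have "b \<in> down P p" using down_trans[of a p] zp a b by (auto simp: down_def)
    then show "b \<in> z" using z a b zp unfolding down_closed_def dreal_simps by blast
  qed
qed

text \<open>Elements of \<open>down P p\<close> are told apart by their classes because
  \<open>P\<close> is an edc; the minimality clause is (C) in the form of
  \<open>c_minimal\<close>.\<close>

lemma tight_dreal:
  assumes p: "p \<in> events P" shows "tight \<A> (dreal p)"
proof -
  have fin: "finite (down P p)" using prime_esD(7)[OF pes p] .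
  have po: "partial_order_on (carr (dreal p)) (ord (dreal p))"
  proof (rule partial_orderI)
    show "(a, a) \<in> ord (dreal p)" if "a \<in> carr (dreal p)" for a
      using that prime_esD(2)[OF pes] down_events[of p] by auto
    show "(a, c) \<in> ord (dreal p)" if "(a, b) \<in> ord (dreal p)" "(b, c) \<in> ord (dreal p)" for a b c
      using that prime_esD(3)[OF pes, of a b c] by simp
    show "a = b" if "(a, b) \<in> ord (dreal p)" "(b, a) \<in> ord (dreal p)" for a b
      using that prime_esD(4)[OF pes, of a b] by simp
  qed simp
  have inA: "rho (dreal p) ` z \<in> \<A>" if z: "rclosed (dreal p) z" for z
  proof -
    have "z \<subseteq> down P p" using z unfolding down_closed_def by simp
    then have "z \<in> fin_configurations P"
      using fin_configuration_subset[OF down_fin_configuration[OF pes p] rclosed_dreal[OF z]] by blast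
    then show ?thesis using c_image_in by simp
  qed
  have real: "realisation \<A> (dreal p)"
    unfolding realisation_def
  proof (intro conjI ballI allI impI po inA)
    show "finite {r' \<in> carr (dreal p). (r', r) \<in> ord (dreal p)}" for r using fin by simp
    show "rho (dreal p) ` carr (dreal p) \<subseteq> \<Union>\<A>"
      using inA[OF rclosed_carr] by blast
  qed
  show ?thesis
    unfolding tight_def
  proof (intro conjI ballI allI impI real)
    show "r = r'" if "r \<in> carr (dreal p)" "r' \<in> carr (dreal p)"
      "rdown (dreal p) r - {r} = rdown (dreal p) r' - {r'} \<and> rho (dreal p) r = rho (dreal p) r'" for r r'
      using that inj_on_c_down[OF p] by (simp add: inj_on_def)
    fix r x assume r: "r \<in> carr (dreal p)"
      and x: "rclosed (dreal p) x \<and> x \<subseteq> rdown (dreal p) r - {r} \<and>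
        insert (rho (dreal p) r) (rho (dreal p) ` x) \<in> \<A>"
    have rp: "r \<in> down P p" using r by simp
    have "rdown (dreal p) r - {r} = sdown P r" using rdown_dreal[OF rp] by (simp add: sdown_def)
    then show "x = rdown (dreal p) r - {r}"
      using c_minimal[of r x] rp down_events[of p] x rclosed_dreal[of p x] by auto
  qed
qed

lemma inj_dreal: "p \<in> events P \<Longrightarrow> inj_on (rho (dreal p)) (carr (dreal p))"
  using inj_on_c_down by simp

lemma is_top_dreal: "p \<in> events P \<Longrightarrow> is_top (dreal p) p"
  using down_self by (auto simp: is_top_def down_def)

definition \<phi> :: "'p \<Rightarrow> 'p rel" where
  "\<phi> p = lab_rel (dreal p)"

lemma \<phi>_simps:
  assumes p: "p \<in> events P"
  shows "\<phi> p \<in> primes \<A>" "Field (\<phi> p) = c ` down P p" "ltop (\<phi> p) = c p"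
    "r \<in> down P p \<Longrightarrow> below (\<phi> p) (c r) = \<phi> r"
proof -
  note T = tight_dreal[OF p] and I = inj_dreal[OF p] and top = is_top_dreal[OF p]
  have R: "realisation \<A> (dreal p)" using T by (simp add: tight_def)
  show "\<phi> p \<in> primes \<A>" unfolding \<phi>_def by (rule lab_rel_in_primes[OF T I top])
  show "Field (\<phi> p) = c ` down P p" unfolding \<phi>_def using Field_lab_rel[OF R] by simp
  show "ltop (\<phi> p) = c p"
    unfolding \<phi>_def using ltop_lab_rel[OF T I top] rmax_eq[OF R top] by simp
  show "below (\<phi> p) (c r) = \<phi> r" if r: "r \<in> down P p"
  proof -
    have "Restr (leq P \<inter> down P p \<times> down P p) (down P r) = leq P \<inter> down P r \<times> down P r"
      using down_trans[OF r] by blast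
    then have "rrestr (dreal p) r = dreal r"
      unfolding rrestr_def rdown_dreal[OF r] by (simp add: dreal_def)
    then show ?thesis using lab_rel_rrestr[OF R I, of r] r by (simp add: \<phi>_def)
  qed
qed

text \<open>A strict cause of \<open>p\<close> and a cause of \<open>q\<close> of the same class
  have the same relation, namely the part of the common relation below that class, and are equal by
  induction. Hence \<open>p\<close> and \<open>q\<close> have the same strict causes and the same
  class, and (B) identifies them.\<close>

lemma \<phi>_inj: "p \<in> events P \<Longrightarrow> q \<in> events P \<Longrightarrow> \<phi> p = \<phi> q \<Longrightarrow> p = q"
proof (induction "card (down P p)" arbitrary: p q rule: less_induct)
  case less
  note p = less.prems(1) and q = less.prems(2) and eq = less.prems(3)
  have F: "c ` down P p = c ` down P q" using \<phi>_simps(2)[OF p] \<phi>_simps(2)[OF q] eq by simp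
  have cpq: "c p = c q" using \<phi>_simps(3)[OF p] \<phi>_simps(3)[OF q] eq by simp
  have key: "a = b" if a: "a \<in> sdown P p" and b: "b \<in> down P q" and ab: "c a = c b" for a b
  proof -
    have ap: "a \<in> down P p" using a sdown_down by blast
    have aP: "a \<in> events P" and bP: "b \<in> events P" using ap b down_events by blast+
    have "p \<notin> down P a"
      using a prime_esD(4)[OF pes, of a p] by (auto simp: sdown_def down_def)
    then have "down P a \<subset> down P p" using down_trans[OF ap] down_self[OF p] by blast
    then have "card (down P a) < card (down P p)" using prime_esD(7)[OF pes p] psubset_card_mono by blast
    moreover have "\<phi> a = \<phi> b" using \<phi>_simps(4)[OF p ap] \<phi>_simps(4)[OF q b] eq ab by simp
    ultimately show ?thesis using less.hyps aP bP by blast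
  qed
  have "sdown P p \<subseteq> sdown P q"
  proof
    fix a assume a: "a \<in> sdown P p"
    then have "c a \<in> c ` down P q" using F sdown_down by blast
    then obtain b where b: "b \<in> down P q" "c a = c b" by blast
    have "c a \<noteq> c q" using c_sdown[OF p] a cpq by (metis imageI)
    then show "a \<in> sdown P q" using key[OF a b] b by (auto simp: sdown_def)
  qed
  moreover have "sdown P q \<subseteq> sdown P p"
  proof
    fix b assume b: "b \<in> sdown P q"
    then have bq: "b \<in> down P q" using sdown_down by blast
    then obtain a where a: "a \<in> down P p" "c a = c b" using F by (metis imageE imageI)
    have "c b \<noteq> c p" using c_sdown[OF q] b cpq by (metis imageI)
    then have "a \<in> sdown P p" using a by (auto simp: sdown_def)
    then show "b \<in> sdown P p" using key[OF _ bq a(2)] by simp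
  qed
  ultimately show ?case using axB[OF p q] eqv_iff[OF p q] cpq by blast
qed

text \<open>By induction, proper principal restrictions of \<open>k\<close> come from events; these
  form an unambiguous configuration \<open>x\<close> that covers all classes of \<open>k\<close>
  except the top. (D1) supplies an event of the top class with strict causes in \<open>x\<close>,
  and tightness of \<open>k\<close> forbids it to use fewer causes than all of
  \<open>x\<close>.\<close>

lemma \<phi>_surj: "k \<in> primes \<A> \<Longrightarrow> \<exists>p\<in>events P. \<phi> p = k"
proof (induction "card (Field k)" arbitrary: k rule: less_induct)
  case less
  note k = less.prems
  note kF = primes_Field[OF k] and kb = primes_below[OF k]
  define t' where "t' = ltop k"
  have t': "t' \<in> Field k" "ltop k = t'" using kF by (auto simp: t'_def)
  have top: "(e, t') \<in> k" if "e \<in> Field k" for e using kF(4) that by (auto simp: under_def t'_def)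
  have nt: "t' \<notin> under k e" if "e \<in> Field k - {t'}" for e
    using that top[of e] primes_order(3)[OF k, of e t'] by (auto simp: under_def)
  have under_sub: "under k e \<subseteq> Field k" for e by (auto simp: under_def Field_def)
  have ex: "\<exists>p\<in>events P. \<phi> p = below k e" if e: "e \<in> Field k - {t'}" for e
  proof -
    have "under k e \<subset> Field k" using nt[OF e] t'(1) under_sub[of e] by blast
    then have "card (Field (below k e)) < card (Field k)"
      using kb(3)[of e] e kF(2) psubset_card_mono by (metis DiffD1)
    then show ?thesis using less.hyps kb(1) e by blast
  qed
  define x where "x = {p \<in> events P. \<exists>e\<in>Field k - {t'}. \<phi> p = below k e}"
  have xc: "c p \<in> Field k - {t'}" "\<phi> p = below k (c p)" "p \<in> events P" if px: "p \<in> x" for p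
  proof -
    obtain e where e: "e \<in> Field k - {t'}" "\<phi> p = below k e" and pP: "p \<in> events P"
      using px by (auto simp: x_def)
    have "c p = e" using \<phi>_simps(3)[OF pP] kb(2)[of e] e by simp
    then show "c p \<in> Field k - {t'}" "\<phi> p = below k (c p)" "p \<in> events P" using e pP by auto
  qed
  have inj: "inj_on c x"
  proof (rule inj_onI)
    fix p q assume pq: "p \<in> x" "q \<in> x" "c p = c q"
    then have "\<phi> p = \<phi> q" using xc(2)[OF pq(1)] xc(2)[OF pq(2)] by simp
    then show "p = q" using \<phi>_inj xc(3) pq by blast
  qed
  have cx: "c ` x = Field k - {t'}"
  proof
    show "c ` x \<subseteq> Field k - {t'}" using xc(1) by blast
    show "Field k - {t'} \<subseteq> c ` x"
    proof
      fix e assume e: "e \<in> Field k - {t'}"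
      obtain p where p: "p \<in> events P" "\<phi> p = below k e" using ex[OF e] by blast
      then have "p \<in> x" using e by (auto simp: x_def)
      moreover have "c p = e" using \<phi>_simps(3)[OF p(1)] kb(2)[of e] e p by simp
      ultimately show "e \<in> c ` x" by blast
    qed
  qed
  have xP: "x \<subseteq> events P" by (auto simp: x_def)
  have xfin: "finite x" using finite_imageD[OF _ inj] cx kF(2) by simp
  have xd: "dclosed P x"
    unfolding down_closed_def
  proof (intro conjI ballI impI xP)
    fix p q assume p: "p \<in> x" and q: "q \<in> events P" "(q, p) \<in> leq P"
    note pP = xc(3)[OF p]
    have qp: "q \<in> down P p" using q by (simp add: down_def)
    have cp: "c p \<in> Field k" using xc(1)[OF p] by blast
    have "c q \<in> Field (\<phi> p)" using \<phi>_simps(2)[OF pP] qp by blast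
    then have u: "c q \<in> under k (c p)" using xc(2)[OF p] kb(3)[OF cp] by simp
    have "\<phi> q = below k (c q)"
      using \<phi>_simps(4)[OF pP qp] xc(2)[OF p] kb(4)[OF cp u] by simp
    moreover have "c q \<in> Field k - {t'}" using u nt[OF xc(1)[OF p]] under_sub by blast
    ultimately show "q \<in> x" using q by (auto simp: x_def)
  qed
  have "rho (lrel k) ` (rdown (lrel k) t' - {t'}) \<in> \<A>"
    using rclosed_image_in[OF primesD(2)[OF k] rclosed_sdown[OF primesD(2)[OF k]]] .
  moreover have tdown: "rdown (lrel k) t' = Field k" using kF(4) by (simp add: rdown_lrel t'_def)
  ultimately have xconf: "x \<in> fin_configurations P"
    using fin_configuration_c_iff[OF xd xfin] cx by simp
  have un: "unambiguous P x"
    using inj xP eqv_iff unfolding unambiguous_def inj_on_def by blast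
  \<comment> \<open>The event \<open>t\<close> fed into (D1) comes from any configuration that
    realises the classes of \<open>k\<close>. Its causes may be other members of these classes than
    those in \<open>x\<close>; only their classes matter, because (A) decides the consistency of
    \<open>x \<union> down P t\<close>.\<close>
  obtain z where z: "z \<in> fin_configurations P" "Field k = c ` z"
    using finite_gconfiguration[OF kF(1,2)] by blast
  note zD = fin_configurationD[OF z(1)]
  obtain t where t: "t \<in> z" "c t = t'" using t'(1) z(2) by (metis imageE)
  have tP: "t \<in> events P" using t zD by blast
  have tz: "down P t \<subseteq> z" using down_dclosed[OF zD(3) t(1)] .
  have cxt: "c ` (x \<union> down P t) = Field k"
  proof
    show "c ` (x \<union> down P t) \<subseteq> Field k" using cx tz z(2) by blast
    have "t' \<in> c ` down P t" using down_self[OF tP] t(2) by blast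
    then show "Field k \<subseteq> c ` (x \<union> down P t)" unfolding image_Un cx by blast
  qed
  have "dclosed P (x \<union> down P t)"
    using xd dclosed_down[OF pes, of t] unfolding down_closed_def by blast
  moreover have "finite (x \<union> down P t)" using xfin prime_esD(7)[OF pes tP] by simp
  ultimately have xt: "x \<union> down P t \<in> fin_configurations P"
    using fin_configuration_c_iff cxt kF(1) by simp
  have "c ` (x \<union> down P t) = c ` insert t x" using cxt cx t(2) t'(1) by auto
  then have "classes P (x \<union> down P t) = classes P (insert t x)"
    using classes_eq_iff[of "x \<union> down P t" "insert t x"] xP tP down_events by auto
  also have "\<dots> = classes P x \<union> {eqv P `` {t}}" by (auto simp: classes_def quotient_def)
  finally obtain p where p: "p \<in> events P" "(p, t) \<in> eqv P" and xp: "x \<union> {p} \<in> fin_configurations P"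
    using axD1[OF xconf tP un xt] by blast
  have cp: "c p = t'" using eqv_iff[OF p(1) tP] p(2) t(2) by simp
  have spx: "sdown P p \<subseteq> x"
    using down_dclosed[OF fin_configurationD(3)[OF xp], of p] by (auto simp: sdown_def)
  \<comment> \<open>\<open>sdown P p\<close> is only known to be contained in \<open>x\<close>. Its
    classes are down-closed in \<open>k\<close> and, with the top added, form a member of
    \<open>\<A>\<close>, so tightness of \<open>k\<close> makes them all of
    \<open>Field k - {t'}\<close>.\<close>
  have "rclosed (lrel k) (c ` sdown P p)"
    unfolding down_closed_def lrel_simps
  proof (intro conjI ballI impI)
    show "c ` sdown P p \<subseteq> Field k" using spx cx by blast
    fix e e' assume e: "e \<in> c ` sdown P p" and le: "(e', e) \<in> k"
    obtain a where a: "a \<in> sdown P p" "e = c a" using e by blast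
    have ax: "a \<in> x" using a spx by blast
    have "c a \<in> Field k" using xc(1)[OF ax] by blast
    then have "under k (c a) = c ` down P a"
      using kb(3)[of "c a"] xc(2)[OF ax] \<phi>_simps(2)[OF xc(3)[OF ax]] by simp
    then have "e' \<in> c ` down P a" using le a by (auto simp: under_def)
    moreover have "down P a \<subseteq> sdown P p" using down_dclosed[OF dclosed_sdown a(1)] .
    ultimately show "e' \<in> c ` sdown P p" by blast
  qed
  moreover have "c ` sdown P p \<subseteq> rdown (lrel k) t' - {t'}" using spx cx tdown by blast
  moreover have "insert (rho (lrel k) t') (rho (lrel k) ` c ` sdown P p) \<in> \<A>"
  proof -
    have "insert t' (c ` sdown P p) = c ` down P p" unfolding down_eq[OF p(1)] using cp by simp
    then show ?thesis using c_image_in[OF down_fin_configuration[OF pes p(1)]] by simp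
  qed
  moreover have "t' \<in> carr (lrel k)" using t'(1) by simp
  ultimately have "c ` sdown P p = rdown (lrel k) t' - {t'}"
    using primesD(1)[OF k] unfolding tight_def by blast
  then have "c ` sdown P p = c ` x" using cx tdown by simp
  then have px: "sdown P p = x" using inj_on_image_eq_iff[OF inj spx] by simp
  have Fp: "Field (\<phi> p) = Field k"
    using \<phi>_simps(2)[OF p(1)] cx t'(1) cp unfolding down_eq[OF p(1)] px by auto
  \<comment> \<open>It suffices to compare predecessors at each element: at the top they are the
    whole field, and elsewhere they are known from the events in \<open>x\<close>.\<close>
  have "under (\<phi> p) e = under k e" if e: "e \<in> Field k" for e
  proof (cases "e = t'")
    case True
    have "under (\<phi> p) t' = Field (\<phi> p)"
      using primes_Field(4)[OF \<phi>_simps(1)[OF p(1)]] \<phi>_simps(3)[OF p(1)] cp by simp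
    then show ?thesis using True Fp kF(4) by (simp add: t'_def)
  next
    case False
    then obtain a where a: "a \<in> x" "e = c a" using e cx by blast
    have ap: "a \<in> down P p" using a px sdown_down by blast
    have "below (\<phi> p) e = below k e" using \<phi>_simps(4)[OF p(1) ap] xc(2)[OF a(1)] a(2) by simp
    then show ?thesis
      using primes_below(3)[OF \<phi>_simps(1)[OF p(1)], of e] kb(3)[OF e] e Fp by simp
  qed
  then have "(a, b) \<in> \<phi> p \<longleftrightarrow> (a, b) \<in> k" for a b
  proof (cases "b \<in> Field k")
    case False
    then show ?thesis using Fp by (metis FieldI2)
  next
    case True
    then have "under (\<phi> p) b = under k b" using \<open>\<And>e. e \<in> Field k \<Longrightarrow> under (\<phi> p) e = under k e\<close> by blast
    then show ?thesis by (auto simp: under_def)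
  qed
  then have "\<phi> p = k" by auto
  then show ?case using p(1) by blast
qed

lemma siso_\<phi>: "siso \<phi> P (prime_ese \<A>)"
  unfolding siso_def
proof (intro conjI ballI allI impI)
  show "bij_betw \<phi> (events P) (events (prime_ese \<A>))"
    unfolding bij_betw_def prime_ese_simps
  proof
    show "inj_on \<phi> (events P)" using \<phi>_inj by (metis inj_onI)
    have "\<phi> ` events P \<subseteq> primes \<A>" using \<phi>_simps(1) by blast
    moreover have "primes \<A> \<subseteq> \<phi> ` events P" using \<phi>_surj by (metis imageI subsetI)
    ultimately show "\<phi> ` events P = primes \<A>" by blast
  qed
  show "(p, q) \<in> leq P \<longleftrightarrow> (\<phi> p, \<phi> q) \<in> leq (prime_ese \<A>)"
    if p: "p \<in> events P" and q: "q \<in> events P" for p q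
  proof
    assume "(p, q) \<in> leq P"
    then have pq: "p \<in> down P q" using p by (simp add: down_def)
    then have "c p \<in> Field (\<phi> q)" "\<phi> p = below (\<phi> q) (c p)"
      using \<phi>_simps(2,4)[OF q] by auto
    then show "(\<phi> p, \<phi> q) \<in> leq (prime_ese \<A>)"
      using \<phi>_simps(1)[OF p] \<phi>_simps(1)[OF q] unfolding prime_ese_simps by blast
  next
    assume "(\<phi> p, \<phi> q) \<in> leq (prime_ese \<A>)"
    then obtain e where e: "e \<in> Field (\<phi> q)" "\<phi> p = below (\<phi> q) e" by auto
    then obtain r where r: "r \<in> down P q" "e = c r" using \<phi>_simps(2)[OF q] by blast
    have rP: "r \<in> events P" using r down_events by blast
    have "\<phi> p = \<phi> r" using e r \<phi>_simps(4)[OF q r(1)] by simp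
    then have "p = r" using \<phi>_inj p rP by blast
    then show "(p, q) \<in> leq P" using r by (simp add: down_def)
  qed
  show "X \<in> con P \<longleftrightarrow> \<phi> ` X \<in> con (prime_ese \<A>)" if X: "X \<subseteq> events P" for X
  proof -
    let ?D = "\<Union>p\<in>X. down P p"
    have U: "\<Union>(Field ` \<phi> ` X) = c ` ?D" using X \<phi>_simps(2) by (simp add: subset_iff image_UN image_image)
    have sub: "X \<subseteq> ?D" using X down_self by blast
    have fin: "finite (\<phi> ` X) \<longleftrightarrow> finite X"
      using \<phi>_inj X by (intro finite_image_iff inj_onI) blast
    have D: "dclosed P ?D" using dclosed_down[OF pes] unfolding down_closed_def by blast
    show ?thesis
    proof
      assume "X \<in> con P"
      then show "\<phi> ` X \<in> con (prime_ese \<A>)"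
        using c_image_in[OF down_closure_configuration[OF pes]] prime_esD(5)[OF pes] X \<phi>_simps(1) U
        by auto
    next
      assume "\<phi> ` X \<in> con (prime_ese \<A>)"
      then have fX: "finite X" and A: "c ` ?D \<in> \<A>" using fin U by simp_all
      have "finite ?D" using fX X prime_esD(7)[OF pes] by blast
      then have "?D \<in> fin_configurations P" using fin_configuration_c_iff[OF D] A by simp
      then show "X \<in> con P" using fin_configuration_iff[OF pes] prime_esD(9)[OF pes] sub by blast
    qed
  qed
  show "(p, q) \<in> eqv P \<longleftrightarrow> (\<phi> p, \<phi> q) \<in> eqv (prime_ese \<A>)"
    if "p \<in> events P" "q \<in> events P" for p q
    using that eqv_iff \<phi>_simps(1,3) by simp
qed

end

lemma realisable_edc_if_ese_iso:
  assumes P: "edc P" and G: "general_es G" and iso: "ese_iso P (edc_of G)"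
  shows "realisable_edc P"
proof -
  have ese: "ese P" using P by (simp add: edc_def)
  obtain h where "siso h P (prime_ese (gconfigurations G))"
    using ese_iso_edc_of_iff[OF ese G] iso by blast
  then interpret labelled_edc P "gconfigurations G" h
    using ese bounded_complete_gconfigurations by (simp add: labelled_edc_def)
  show ?thesis
    by unfold_locales (fact P | (rule axiom_A axiom_B axiom_C axiom_D1; assumption))+
qed

lemma (in realisable_edc) ese_iso_edc_of: "ese_iso P (edc_of G)"
  using ese_iso_edc_of_iff[OF ese general_es_G] siso_\<phi> by blast

text \<open>Types cannot be quantified over, so the existence of \<open>G\<close> is expressed at
  the type of \<open>P\<close>, which suffices for the construction on classes. The last conjunct
  relates other event types to this one: the axioms follow from a \<open>G\<close> over any type
  \<open>'g\<close> and lead back to one over \<open>'p\<close>.\<close>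

theorem theoremC3:
  fixes P :: "'p ese"
  assumes "edc P"
  shows
    "((\<exists>G :: 'p ges. general_es G \<and> ese_iso P (edc_of G)) \<longleftrightarrow>
        (\<forall>X y. finite X \<and> dclosed P X \<and> y \<in> fin_configurations P \<and>
               classes P X = classes P y \<longrightarrow> X \<in> fin_configurations P) \<and>
        (\<forall>p\<in>events P. \<forall>q\<in>events P.
               sdown P p = sdown P q \<and> (p, q) \<in> eqv P \<longrightarrow> p = q) \<and>
        (\<forall>X. \<forall>p\<in>events P. \<forall>q\<in>events P.
               dclosed P X \<and> (p, q) \<in> eqv P \<and> X \<subseteq> sdown P p \<and>
               classes P (sdown P q) \<subseteq> classes P X \<longrightarrow> X = sdown P p) \<and>
        (\<forall>x\<in>fin_configurations P. \<forall>t\<in>events P.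
               unambiguous P x \<and> x \<union> down P t \<in> fin_configurations P \<and>
               classes P (x \<union> down P t) = classes P x \<union> {eqv P `` {t}} \<longrightarrow>
               (\<exists>p\<in>events P. (p, t) \<in> eqv P \<and> x \<union> {p} \<in> fin_configurations P)))
     \<and> ((\<exists>G :: 'g ges. general_es G \<and> ese_iso P (edc_of G)) \<longrightarrow>
        (\<exists>G :: 'p ges. general_es G \<and> ese_iso P (edc_of G)))"
    (is "(?ex \<longleftrightarrow> ?axioms) \<and> (?exg \<longrightarrow> _)")
proof -
  have axioms: "?axioms \<longleftrightarrow> realisable_edc P"
  proof
    assume ax: ?axioms
    note A = ax[THEN conjunct1] and BCD = ax[THEN conjunct2]
    note B = BCD[THEN conjunct1] and CD = BCD[THEN conjunct2]
    note C = CD[THEN conjunct1] and D = CD[THEN conjunct2]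
    show "realisable_edc P"
    proof (rule realisable_edc.intro[OF assms])
      show "X \<in> fin_configurations P" if "finite X" "dclosed P X" "y \<in> fin_configurations P"
        "classes P X = classes P y" for X y
        using A[rule_format, of X y] that by simp
      show "p = q" if "p \<in> events P" "q \<in> events P" "sdown P p = sdown P q" "(p, q) \<in> eqv P" for p q
        using B[rule_format, of p q] that by simp
      show "X = sdown P p" if "p \<in> events P" "q \<in> events P" "dclosed P X" "(p, q) \<in> eqv P"
        "X \<subseteq> sdown P p" "classes P (sdown P q) \<subseteq> classes P X" for X p q
        using C[rule_format, of p q X] that by simp
      show "\<exists>p\<in>events P. (p, t) \<in> eqv P \<and> x \<union> {p} \<in> fin_configurations P"
        if "x \<in> fin_configurations P" "t \<in> events P" "unambiguous P x"
          "x \<union> down P t \<in> fin_configurations P"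
          "classes P (x \<union> down P t) = classes P x \<union> {eqv P `` {t}}" for x t
        using D[rule_format, of x t] that by simp
    qed
  next
    assume "realisable_edc P"
    then interpret realisable_edc P .
    show ?axioms
      by (intro conjI allI ballI impI; elim conjE) (rule axA axB axC axD1; assumption)+
  qed
  have "?ex" if "realisable_edc P"
    using realisable_edc.general_es_G[OF that] realisable_edc.ese_iso_edc_of[OF that] by blast
  moreover have "realisable_edc P" if ?ex using realisable_edc_if_ese_iso[OF assms] that by blast
  moreover have "realisable_edc P" if ?exg using realisable_edc_if_ese_iso[OF assms] that by blast
  ultimately show ?thesis unfolding axioms by blast
qed

end
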